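(* Let $f(x)=x^3+ax^2+bx+c$ with $a,b,c\in\mathbb{Z}$ be a polynomial without repeated roots, let $g=g(t)$ be a nonconstant polynomial over $\mathbb{Z}$, and let $E_g: y^2=x^3+ag(t)x^2+bg(t)^2x+cg(t)^3$ (the quadratic twist of $y^2=f(x)$ by $g$). Let $t_0\in\mathbb{Q}$ be such that the specialization $E_g(t_0)$ is well defined (an elliptic curve over $\mathbb{Q}$), and let $\sigma_{t_0}:E_g(\mathbb{Q}(t))\to E_g(t_0)(\mathbb{Q})$ be the specialization homomorphism. (i) Assume $c=0$ and that $x^2+ax+b=(x-\theta)(x-\bar\theta)$ is irreducible over $\mathbb{Q}$, with splitting field $K$ of class number $1$. Write $a^2-4b=e^2d$ with $e,d\in\mathbb{Z}$, $d$ square-free, and let $D$ be the discriminant of $K$. Assume $t_0$ satisfies: (A1) for each nonconstant square-free divisor $h$ of $bg$ in $\mathbb{Z}[t]$, $h(t_0)$ is not a square in $\mathbb{Q}$; (A2) for each nonconstant square-free divisor $h$ of $eg$ in $\mathbb{Z}[t]$ and each square-free divisor $d'$ of $D$ in $\mathbb{Z}$, $d'\cdot h(t_0)$ is not a square in $\mathbb{Q}$. Then $\sigma_{t_0}$ is injective. (ii) Assume $f(x)=(x-\theta_1)(x-\theta_2)(x-\theta_3)$ is irreducible over $\mathbb{Q}$ with cyclic Galois group, and its splitting field $K$ (with ring of integers $\mathcal{O}_K$) has class number $1$. Set $e:=\sqrt{D}$, where $D$ is the discriminant of $f$. Let $\mathcal{G}$ be the set of prime factors of $eg$ in $\mathbb{Z}[t]$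 that split in $\mathcal{O}_K[t]$. Assume $t_0$ satisfies: (B) whenever, for each element of $\mathcal{G}$, one chooses either none or two of its prime factors in $\mathcal{O}_K[t]$, and $h$ denotes the product of all chosen prime factors, then for each such nonconstant $h$ and each unit $\epsilon$ of $\mathcal{O}_K$, $\epsilon h(t_0)$ is not a square in $K$. Then $\sigma_{t_0}$ is injective.
   Context: The specialization homomorphism $\sigma_{t_0}$ sends a point of $E_g(\mathbb{Q}(t))$ to the point obtained by evaluating its projective coordinates at $t=t_0$. In case (ii), since the Galois group is cyclic, $D$ is a rational square, so $e\in\mathbb{Z}$; a prime (irreducible) element $H$ of $\mathbb{Z}[t]$ splits in $\mathcal{O}_K[t]$ if $H=\pm\mathcal{P}\mathcal{P}^\tau\mathcal{P}^{\tau^2}$ with $\mathcal{P}$ irreducible in $\mathcal{O}_K[t]$, $\tau$ a generator of $\mathrm{Gal}(K/\mathbb{Q})$, and $\mathcal{P},\mathcal{P}^\tau$ non-associate; its prime factors in $\mathcal{O}_K[t]$ are then $\mathcal{P},\mathcal{P}^\tau,\mathcal{P}^{\tau^2}$. *)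

theory Defs
  imports Complex_Main "HOL-Computational_Algebra.Polynomial_Factorial"
    "HOL-Computational_Algebra.Field_as_Ring" "HOL-Computational_Algebra.Squarefree"
    "HOL-Computational_Algebra.Normalized_Fraction" "HOL-Combinatorics.Permutations"
begin

type_synonym ratfun = "rat poly fract"

definition rf_of_intpoly :: "int poly \<Rightarrow> ratfun" where
  "rf_of_intpoly p = to_fract (map_poly of_int p)"

definition rf_regular :: "rat \<Rightarrow> ratfun \<Rightarrow> bool" where
  "rf_regular t0 r \<longleftrightarrow> poly (snd (quot_of_fract r)) t0 \<noteq> 0"

definition rf_eval :: "rat \<Rightarrow> ratfun \<Rightarrow> rat" where
  "rf_eval t0 r = poly (fst (quot_of_fract r)) t0 / poly (snd (quot_of_fract r)) t0"

text \<open>Points of E_g(Q(t)) for E_g : y^2 = x^3 + a g x^2 + b g^2 x + c g^3;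
  None is the point at infinity.\<close>
definition Eg_points :: "int \<Rightarrow> int \<Rightarrow> int \<Rightarrow> int poly \<Rightarrow> (ratfun \<times> ratfun) option set" where
  "Eg_points a b c g =
     (let G = rf_of_intpoly g in
      {None} \<union> {Some (X, Y) | X Y. Y ^ 2 = X ^ 3 + of_int a * G * X ^ 2
                                     + of_int b * G ^ 2 * X + of_int c * G ^ 3})"

text \<open>Specialization: evaluate projective coordinates [X:Y:1] at t = t0.
  If a coordinate has a pole at t0 the point specializes to the point at infinity.\<close>
definition specialize :: "rat \<Rightarrow> (ratfun \<times> ratfun) option \<Rightarrow> (rat \<times> rat) option" where
  "specialize t0 P = (case P of None \<Rightarrow> None
      | Some (X, Y) \<Rightarrow> if rf_regular t0 X \<and> rf_regular t0 Y
                       then Some (rf_eval t0 X, rf_eval t0 Y) else None)"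

definition subfield_C :: "complex set \<Rightarrow> bool" where
  "subfield_C K \<longleftrightarrow> 0 \<in> K \<and> 1 \<in> K \<and> (\<forall>x\<in>K. \<forall>y\<in>K. x + y \<in> K \<and> x * y \<in> K)
     \<and> (\<forall>x\<in>K. - x \<in> K \<and> inverse x \<in> K)"

definition splitting_field_C :: "int poly \<Rightarrow> complex set" where
  "splitting_field_C p = \<Inter> {K. subfield_C K \<and> {z. poly (map_poly of_int p) z = 0} \<subseteq> K}"

definition algebraic_integer :: "complex \<Rightarrow> bool" where
  "algebraic_integer z \<longleftrightarrow> (\<exists>p :: int poly. lead_coeff p = 1 \<and> poly (map_poly of_int p) z = 0)"

definition ring_of_integers :: "complex set \<Rightarrow> complex set" where
  "ring_of_integers K = {z \<in> K. algebraic_integer z}"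

definition nf_units :: "complex set \<Rightarrow> complex set" where
  "nf_units K = {u \<in> ring_of_integers K. \<exists>v \<in> ring_of_integers K. u * v = 1}"

definition nf_ideal :: "complex set \<Rightarrow> complex set \<Rightarrow> bool" where
  "nf_ideal K I \<longleftrightarrow> I \<subseteq> ring_of_integers K \<and> 0 \<in> I \<and> (\<forall>x\<in>I. \<forall>y\<in>I. x + y \<in> I)
     \<and> (\<forall>r\<in>ring_of_integers K. \<forall>x\<in>I. r * x \<in> I)"

definition class_number_one :: "complex set \<Rightarrow> bool" where
  "class_number_one K \<longleftrightarrow> (\<forall>I. nf_ideal K I \<longrightarrow>
      (\<exists>\<alpha>\<in>ring_of_integers K. I = (\<lambda>x. \<alpha> * x) ` ring_of_integers K))"

definition nf_hom :: "complex set \<Rightarrow> (complex \<Rightarrow> complex) \<Rightarrow> bool" where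
  "nf_hom K \<sigma> \<longleftrightarrow> \<sigma> 1 = 1 \<and> (\<forall>x\<in>K. \<forall>y\<in>K. \<sigma> (x + y) = \<sigma> x + \<sigma> y \<and> \<sigma> (x * y) = \<sigma> x * \<sigma> y)"

definition nf_embeddings :: "complex set \<Rightarrow> (complex \<Rightarrow> complex) set" where
  "nf_embeddings K = {\<sigma>. nf_hom K \<sigma> \<and> (\<forall>z. z \<notin> K \<longrightarrow> \<sigma> z = 0)}"

definition nf_trace :: "complex set \<Rightarrow> complex \<Rightarrow> complex" where
  "nf_trace K x = (\<Sum>\<sigma>\<in>nf_embeddings K. \<sigma> x)"

text \<open>D is the discriminant of the number field K: det(Tr(w_i w_j)) for a Z-basis w of O_K.\<close>
definition nf_disc :: "complex set \<Rightarrow> int \<Rightarrow> bool" where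
  "nf_disc K D \<longleftrightarrow> (\<exists>n (w :: nat \<Rightarrow> complex).
      (\<forall>i<n. w i \<in> ring_of_integers K)
      \<and> bij_betw (\<lambda>c. \<Sum>i<n. of_int (c i) * w i) {c :: nat \<Rightarrow> int. \<forall>i\<ge>n. c i = 0} (ring_of_integers K)
      \<and> of_int D = (\<Sum>p | p permutes {..<n}. of_int (sign p) * (\<Prod>i<n. nf_trace K (w i * w (p i)))))"

definition nf_Gal :: "complex set \<Rightarrow> (complex \<Rightarrow> complex) set" where
  "nf_Gal K = {\<sigma>. nf_hom K \<sigma> \<and> \<sigma> ` K = K \<and> (\<forall>z. z \<notin> K \<longrightarrow> \<sigma> z = z)}"

definition Gal_generator :: "complex set \<Rightarrow> (complex \<Rightarrow> complex) \<Rightarrow> bool" where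
  "Gal_generator K \<tau> \<longleftrightarrow> \<tau> \<in> nf_Gal K \<and> (\<forall>\<sigma>\<in>nf_Gal K. \<exists>k. \<sigma> = \<tau> ^^ k)"

definition Gal_cyclic :: "complex set \<Rightarrow> bool" where
  "Gal_cyclic K \<longleftrightarrow> (\<exists>\<tau>. Gal_generator K \<tau>)"

definition OKt :: "complex set \<Rightarrow> complex poly set" where
  "OKt K = {p. \<forall>i. coeff p i \<in> ring_of_integers K}"

definition OKt_unit :: "complex set \<Rightarrow> complex poly \<Rightarrow> bool" where
  "OKt_unit K u \<longleftrightarrow> u \<in> OKt K \<and> (\<exists>v\<in>OKt K. u * v = 1)"

definition OKt_irreducible :: "complex set \<Rightarrow> complex poly \<Rightarrow> bool" where
  "OKt_irreducible K P \<longleftrightarrow> P \<in> OKt K \<and> P \<noteq> 0 \<and> \<not> OKt_unit K P \<and>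
     (\<forall>Q\<in>OKt K. \<forall>R\<in>OKt K. P = Q * R \<longrightarrow> OKt_unit K Q \<or> OKt_unit K R)"

definition OKt_assoc :: "complex set \<Rightarrow> complex poly \<Rightarrow> complex poly \<Rightarrow> bool" where
  "OKt_assoc K P Q \<longleftrightarrow> (\<exists>u. OKt_unit K u \<and> P = u * Q)"

definition splits_with :: "complex set \<Rightarrow> (complex \<Rightarrow> complex) \<Rightarrow> int poly \<Rightarrow> complex poly \<Rightarrow> bool" where
  "splits_with K \<tau> H P \<longleftrightarrow> Gal_generator K \<tau> \<and> OKt_irreducible K P
     \<and> \<not> OKt_assoc K P (map_poly \<tau> P)
     \<and> (map_poly of_int H = P * map_poly \<tau> P * map_poly (\<tau> \<circ> \<tau>) P
        \<or> map_poly of_int H = - (P * map_poly \<tau> P * map_poly (\<tau> \<circ> \<tau>) P))"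

definition splits_in_OKt :: "complex set \<Rightarrow> int poly \<Rightarrow> bool" where
  "splits_in_OKt K H \<longleftrightarrow> (\<exists>\<tau> P. splits_with K \<tau> H P)"

definition is_rat_square :: "rat \<Rightarrow> bool" where
  "is_rat_square x \<longleftrightarrow> (\<exists>q. q ^ 2 = x)"

definition cond_A1 :: "int \<Rightarrow> int poly \<Rightarrow> rat \<Rightarrow> bool" where
  "cond_A1 b g t0 \<longleftrightarrow> (\<forall>h :: int poly. h dvd smult b g \<and> squarefree h \<and> degree h > 0
      \<longrightarrow> \<not> is_rat_square (poly (map_poly of_int h) t0))"

definition cond_A2 :: "int \<Rightarrow> int \<Rightarrow> int poly \<Rightarrow> rat \<Rightarrow> bool" where
  "cond_A2 e D g t0 \<longleftrightarrow> (\<forall>(h :: int poly) (d' :: int). h dvd smult e g \<and> squarefree h \<and> degree h > 0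
      \<and> d' dvd D \<and> squarefree d'
      \<longrightarrow> \<not> is_rat_square (of_int d' * poly (map_poly of_int h) t0))"

definition cond_B :: "complex set \<Rightarrow> int \<Rightarrow> int poly \<Rightarrow> rat \<Rightarrow> bool" where
  "cond_B K e g t0 \<longleftrightarrow>
     (let Gs = {H \<in> prime_factors (smult e g). splits_in_OKt K H} in
      \<forall>\<tau> (P :: int poly \<Rightarrow> complex poly) (S :: int poly \<Rightarrow> complex poly set) \<epsilon>.
        (\<forall>H\<in>Gs. splits_with K \<tau> H (P H)
                 \<and> S H \<subseteq> {P H, map_poly \<tau> (P H), map_poly (\<tau> \<circ> \<tau>) (P H)}
                 \<and> card (S H) \<in> {0, 2})
        \<and> degree (\<Prod>H\<in>Gs. \<Prod>(S H)) > 0 \<and> \<epsilon> \<in> nf_units K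
        \<longrightarrow> \<not> (\<exists>z\<in>K. z ^ 2 = \<epsilon> * poly (\<Prod>H\<in>Gs. \<Prod>(S H)) (of_rat t0)))"

end

theory Submission
  imports Defs "Jordan_Normal_Form.Char_Poly"
begin

text \<open>
  Two points with the same finite specialization differ by a point with a pole at \<open>t\<^sub>0\<close>, so it suffices
  that no point \<open>P\<close> of \<open>E\<^sub>g(\<rat>(t))\<close> has a pole at \<open>t\<^sub>0\<close>. Write \<open>x(P) = p / q\<^sup>2\<close> in lowest terms over \<open>\<int>[t]\<close>.
  The values \<open>x(P) - \<theta>\<^sub>i g\<close>, for the roots \<open>\<theta>\<^sub>i\<close> of \<open>f\<close>, have square classes that are supported on the
  divisors of the discriminant and of \<open>g\<close>. At a pole these classes specialize to the class of \<open>p(t\<^sub>0)\<close>, a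
  rational square. The hypotheses on \<open>t\<^sub>0\<close> then make the classes constant, hence trivial, and
  the square roots of the \<open>x(P) - \<theta>\<^sub>i g\<close>, with signs such that they agree at \<open>t\<^sub>0\<close>, give a point \<open>Q\<close> with
  \<open>2 Q = P\<close>. By this choice of signs \<open>Q\<close> is defined over \<open>\<rat>(t)\<close> and again has a pole at \<open>t\<^sub>0\<close>. The degree of
  \<open>x / g\<close> is multiplied by four under duplication, so infinite descent reaches a constant \<open>x / g\<close>, which has no
  pole. This descent replaces the Mordell--Weil theorem.
\<close>

text \<open>Let \<open>k1\<close>, \<open>k2\<close>, \<open>k3\<close> be square roots of the three
  values \<open>p - \<theta>\<^sub>i g q\<^sup>2\<close>. The half point then has the numerator
  \<open>p + k1 k2 + k2 k3 + k3 k1\<close>. Since \<open>q\<close> vanishes at the pole,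
  \<open>y\<^sup>2 = p\<^sup>3\<close> there, so \<open>p(t0)\<close> is a nonzero rational square.
  If the three roots take the same rational value \<kappa> at \<open>t0\<close>, the numerator is
  \<open>4 \<kappa>\<^sup>2\<close> there and the pole survives. Conjugation preserves rational
  values, so it permutes roots chosen in this way. If one root of \<open>f\<close> is 0 and the
  other two are conjugate, only the sum \<open>v = k2 + k3\<close> and the product
  \<open>w = k2 k3\<close> occur, and the descent stays in \<int>[t]. The obstacle is then the prime
  2, brought in by \<open>v\<^sup>2 = 2 w + 2 k\<^sup>2 + a g q\<^sup>2\<close>; what becomes of it
  depends on \<open>d mod 4\<close>, which the discriminant of \<open>K\<close> reflects. In the
  cubic case the polynomials over the integers of \<open>K\<close> form a subset of
  \<open>complex poly\<close>. Their unique factorization is derived from principal ideals, with the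
  absolute norm as the measure for the inductions.\<close>

hide_const (open) Module.smult

subsection \<open>Regular rational functions and specialization\<close>
text \<open>The reduced denominator divides every denominator of the same fraction. So regularity
  and the value at \<open>t0\<close>, which are defined through the reduced form, can be read off
  from any representation whose denominator does not vanish at \<open>t0\<close>.\<close>

lemma rf_regular_divideI:
  fixes u v :: "rat poly"
  assumes "poly v t0 \<noteq> 0"
  shows "rf_regular t0 (to_fract u / to_fract v)" "rf_eval t0 (to_fract u / to_fract v) = poly u t0 / poly v t0"
proof -
  define r where "r = to_fract u / to_fract v"
  define a where "a = fst (quot_of_fract r)"
  define b where "b = snd (quot_of_fract r)"
  have v0: "v \<noteq> 0" using assms by auto
  have b0: "b \<noteq> 0" by (simp add: b_def)
  have "r = to_fract a / to_fract b"
    unfolding a_def b_def Fract_conv_to_fract[symmetric] by simp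
  hence "to_fract (u * b) = to_fract (a * v)"
    using v0 b0 by (simp add: r_def field_simps)
  hence eq: "u * b = a * v" by (simp only: to_fract_eq_iff)
  have cop: "coprime a b" unfolding a_def b_def by (rule coprime_quot_of_fract)
  have "b dvd a * v" using eq by (metis dvd_triv_right)
  hence "b dvd v" using cop by (simp add: coprime_commute coprime_dvd_mult_right_iff)
  hence pb: "poly b t0 \<noteq> 0" using assms by (auto elim!: dvdE)
  thus "rf_regular t0 (to_fract u / to_fract v)"
    by (simp add: rf_regular_def b_def r_def)
  have "poly u t0 * poly b t0 = poly a t0 * poly v t0"
    using eq by (metis poly_mult)
  thus "rf_eval t0 (to_fract u / to_fract v) = poly u t0 / poly v t0"
    using pb assms by (simp add: rf_eval_def a_def b_def r_def field_simps)
qed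

lemma rf_regularE:
  assumes "rf_regular t0 r"
  obtains u v where "r = to_fract u / to_fract v" "poly v t0 \<noteq> 0" "rf_eval t0 r = poly u t0 / poly v t0"
proof
  show "r = to_fract (fst (quot_of_fract r)) / to_fract (snd (quot_of_fract r))"
    unfolding Fract_conv_to_fract[symmetric] by simp
qed (use assms in \<open>auto simp: rf_regular_def rf_eval_def\<close>)

lemma rf_to_fract [simp]:
  "rf_regular t0 (to_fract u)" "rf_eval t0 (to_fract u) = poly u t0"
  by (simp_all add: rf_regular_def rf_eval_def)

lemma rf_add:
  assumes "rf_regular t0 r" "rf_regular t0 s"
  shows "rf_regular t0 (r + s)" "rf_eval t0 (r + s) = rf_eval t0 r + rf_eval t0 s"
proof -
  from assms(1) obtain u v where 1: "r = to_fract u / to_fract v" "poly v t0 \<noteq> 0"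
    "rf_eval t0 r = poly u t0 / poly v t0" by (rule rf_regularE)
  from assms(2) obtain u' v' where 2: "s = to_fract u' / to_fract v'" "poly v' t0 \<noteq> 0"
    "rf_eval t0 s = poly u' t0 / poly v' t0" by (rule rf_regularE)
  have nz: "v \<noteq> 0" "v' \<noteq> 0" using 1 2 by auto
  have eq: "r + s = to_fract (u * v' + u' * v) / to_fract (v * v')"
    using nz by (simp add: 1 2 field_simps)
  have "poly (v * v') t0 \<noteq> 0" using 1 2 by simp
  note * = rf_regular_divideI[OF this, of "u * v' + u' * v"]
  show "rf_regular t0 (r + s)" using * eq by simp
  show "rf_eval t0 (r + s) = rf_eval t0 r + rf_eval t0 s"
    using * 1(2,3) 2(2,3) unfolding eq by (simp add: add_frac_eq)
qed

lemma rf_mult: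
  assumes "rf_regular t0 r" "rf_regular t0 s"
  shows "rf_regular t0 (r * s)" "rf_eval t0 (r * s) = rf_eval t0 r * rf_eval t0 s"
proof -
  from assms(1) obtain u v where 1: "r = to_fract u / to_fract v" "poly v t0 \<noteq> 0"
    "rf_eval t0 r = poly u t0 / poly v t0" by (rule rf_regularE)
  from assms(2) obtain u' v' where 2: "s = to_fract u' / to_fract v'" "poly v' t0 \<noteq> 0"
    "rf_eval t0 s = poly u' t0 / poly v' t0" by (rule rf_regularE)
  have eq: "r * s = to_fract (u * u') / to_fract (v * v')"
    by (simp add: 1 2)
  have "poly (v * v') t0 \<noteq> 0" using 1 2 by simp
  note * = rf_regular_divideI[OF this, of "u * u'"]
  show "rf_regular t0 (r * s)" using * eq by simp
  show "rf_eval t0 (r * s) = rf_eval t0 r * rf_eval t0 s"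
    using * 1(2,3) 2(2,3) unfolding eq by simp
qed

lemma rf_uminus:
  assumes "rf_regular t0 r"
  shows "rf_regular t0 (- r)" "rf_eval t0 (- r) = - rf_eval t0 r"
proof -
  have eq: "- r = to_fract (-1) * r" by simp
  show "rf_regular t0 (- r)" "rf_eval t0 (- r) = - rf_eval t0 r"
    unfolding eq using assms by (simp_all only: rf_mult rf_to_fract) simp
qed

lemma rf_diff:
  assumes "rf_regular t0 r" "rf_regular t0 s"
  shows "rf_regular t0 (r - s)" "rf_eval t0 (r - s) = rf_eval t0 r - rf_eval t0 s"
  using rf_add[OF assms(1) rf_uminus(1)[OF assms(2)]] rf_uminus[OF assms(2)] by simp_all

lemma rf_0 [simp]: "rf_regular t0 0" "rf_eval t0 0 = 0"
  using rf_to_fract[of t0 0] by simp_all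

lemma rf_1 [simp]: "rf_regular t0 1" "rf_eval t0 1 = 1"
  using rf_to_fract[of t0 1] by simp_all

lemma rf_power:
  assumes "rf_regular t0 r"
  shows "rf_regular t0 (r ^ n)" "rf_eval t0 (r ^ n) = rf_eval t0 r ^ n"
  by (induction n) (simp_all add: rf_mult assms)

lemma rf_of_nat [simp]: "rf_regular t0 (of_nat n)" "rf_eval t0 (of_nat n) = of_nat n"
  by (induction n) (simp_all add: rf_add)

lemma rf_of_int [simp]: "rf_regular t0 (of_int n)" "rf_eval t0 (of_int n) = of_int n"
  by (cases n; simp add: rf_diff rf_uminus rf_add)+

lemma rf_numeral [simp]: "rf_regular t0 (numeral n)" "rf_eval t0 (numeral n) = numeral n"
  using rf_of_nat[of t0 "numeral n"] by simp_all

lemmas rf_hom = rf_add rf_diff rf_mult rf_power rf_uminus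

text \<open>Squaring cannot cancel a pole: numerator and denominator stay coprime, so
  \<open>b ^ 2\<close> divides every denominator of \<open>r ^ 2\<close>. Regularity of ordinates
  and of slopes is obtained from this.\<close>

lemma rf_regular_of_square:
  assumes "rf_regular t0 (r ^ 2)"
  shows "rf_regular t0 r"
proof -
  define a where "a = fst (quot_of_fract r)"
  define b where "b = snd (quot_of_fract r)"
  have b0: "b \<noteq> 0" by (simp add: b_def)
  have r: "r = to_fract a / to_fract b"
    unfolding a_def b_def Fract_conv_to_fract[symmetric] by simp
  have cop: "coprime a b" unfolding a_def b_def by (rule coprime_quot_of_fract)
  from assms obtain u v where 1: "r ^ 2 = to_fract u / to_fract v" "poly v t0 \<noteq> 0"
    by (rule rf_regularE)
  have v0: "v \<noteq> 0" using 1 by auto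
  have "to_fract (a ^ 2 * v) = to_fract (u * b ^ 2)"
    using 1(1) v0 b0 by (simp add: r power2_eq_square field_simps)
  hence "a ^ 2 * v = u * b ^ 2" by (simp only: to_fract_eq_iff)
  hence "b ^ 2 dvd a ^ 2 * v" by simp
  hence "b ^ 2 dvd v" using cop
    by (metis coprime_commute coprime_dvd_mult_right_iff coprime_power_left_iff coprime_power_right_iff)
  hence "poly b t0 \<noteq> 0" using 1 by (auto elim!: dvdE)
  thus ?thesis by (simp add: rf_regular_def b_def)
qed

section \<open>Chords and tangents of a Weierstrass cubic\<close>

lemma curve_difference:
  fixes A B C :: "'a :: field"
  assumes P: "y1 ^ 2 = x1 ^ 3 + A * x1 ^ 2 + B * x1 + C"
    and Q: "y2 ^ 2 = x2 ^ 3 + A * x2 ^ 2 + B * x2 + C"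
  shows "(y1 - y2) * (y1 + y2) = (x1 - x2) * (x1 ^ 2 + x1 * x2 + x2 ^ 2 + A * (x1 + x2) + B)"
proof -
  have "(y1 - y2) * (y1 + y2) = y1 ^ 2 - y2 ^ 2" by (simp add: algebra_simps power2_eq_square)
  thus ?thesis unfolding P Q by (simp add: algebra_simps power2_eq_square power3_eq_cube)
qed

text \<open>Vieta on the line of slope \<open>l\<close> gives \<open>x3\<close> as the third root.
  The point is left on that line and not reflected, so it is the negative of the sum, which has the
  same abscissa.\<close>

lemma chord_on_curve:
  fixes A B C :: "'a :: field"
  assumes P: "y1 ^ 2 = x1 ^ 3 + A * x1 ^ 2 + B * x1 + C"
    and Q: "y2 ^ 2 = x2 ^ 3 + A * x2 ^ 2 + B * x2 + C"
    and l: "l * (x1 - x2) = y1 - y2" and ne: "x1 \<noteq> x2"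
    and x3: "x3 = l ^ 2 - A - x1 - x2" and y3: "y3 = l * (x3 - x1) + y1"
  shows "y3 ^ 2 = x3 ^ 3 + A * x3 ^ 2 + B * x3 + C"
proof -
  have "(x1 - x2) * (l * (y1 + y2)) = (y1 - y2) * (y1 + y2)"
    by (simp add: l[symmetric] mult_ac)
  also note curve_difference[OF P Q]
  finally have "l * (y1 + y2) = x1 ^ 2 + x1 * x2 + x2 ^ 2 + A * (x1 + x2) + B" using ne by simp
  moreover have "y2 = y1 - l * (x1 - x2)" using l by simp
  ultimately have "2 * l * y1 = x1 ^ 2 + x1 * x2 + x2 ^ 2 + A * (x1 + x2) + B + l ^ 2 * (x1 - x2)"
    by (simp add: algebra_simps power2_eq_square)
  moreover have l2: "l ^ 2 = x3 + A + x1 + x2" using x3 by simp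
  ultimately have "l ^ 2 * (x3 - x1) + 2 * l * y1 = x3 ^ 2 + x1 * x3 + x1 ^ 2 + A * (x3 + x1) + B"
    by (simp only: l2) (simp add: algebra_simps power2_eq_square)
  hence "(x3 - x1) * (l ^ 2 * (x3 - x1) + 2 * l * y1)
           = (x3 - x1) * (x3 ^ 2 + x1 * x3 + x1 ^ 2 + A * (x3 + x1) + B)" by simp
  thus ?thesis unfolding y3 using P by (simp add: algebra_simps power2_eq_square power3_eq_cube)
qed

lemma tangent_on_curve:
  fixes A B C :: "'a :: field"
  assumes P: "y1 ^ 2 = x1 ^ 3 + A * x1 ^ 2 + B * x1 + C"
    and l: "2 * y1 * l = 3 * x1 ^ 2 + 2 * A * x1 + B"
    and x3: "x3 = l ^ 2 - A - 2 * x1" and y3: "y3 = l * (x3 - x1) + y1"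
  shows "y3 ^ 2 = x3 ^ 3 + A * x3 ^ 2 + B * x3 + C"
proof -
  have l2: "l ^ 2 = x3 + A + 2 * x1" using x3 by simp
  have "l ^ 2 * (x3 - x1) + 2 * l * y1 = x3 ^ 2 + x1 * x3 + x1 ^ 2 + A * (x3 + x1) + B"
    using l by (simp only: l2) (simp add: algebra_simps power2_eq_square)
  hence "(x3 - x1) * (l ^ 2 * (x3 - x1) + 2 * l * y1)
           = (x3 - x1) * (x3 ^ 2 + x1 * x3 + x1 ^ 2 + A * (x3 + x1) + B)" by simp
  thus ?thesis unfolding y3 using P by (simp add: algebra_simps power2_eq_square power3_eq_cube)
qed

text \<open>If two points have the same finite specialization, their difference is a point with a pole.\<close>

lemma inj_on_specialize_if_no_pole:
  fixes A B C :: ratfun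
  assumes reg: "rf_regular t0 A" "rf_regular t0 B" "rf_regular t0 C"
    and smooth: "\<And>x. x ^ 3 + rf_eval t0 A * x ^ 2 + rf_eval t0 B * x + rf_eval t0 C = 0 \<Longrightarrow>
                   3 * x ^ 2 + 2 * rf_eval t0 A * x + rf_eval t0 B \<noteq> 0"
    and no_pole: "\<And>X Y. Y ^ 2 = X ^ 3 + A * X ^ 2 + B * X + C \<Longrightarrow> rf_regular t0 X"
  shows "inj_on (specialize t0) ({None} \<union> {Some (X, Y) | X Y. Y ^ 2 = X ^ 3 + A * X ^ 2 + B * X + C})"
proof -
  have regY: "rf_regular t0 Y" if "Y ^ 2 = X ^ 3 + A * X ^ 2 + B * X + C" for X Y
    by (rule rf_regular_of_square) (simp add: that rf_hom reg no_pole[OF that])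
  have spec: "specialize t0 (Some (X, Y)) = Some (rf_eval t0 X, rf_eval t0 Y)"
    if "Y ^ 2 = X ^ 3 + A * X ^ 2 + B * X + C" for X Y
    by (simp add: specialize_def no_pole[OF that] regY[OF that])
  have spec_None: "specialize t0 None = None" by (simp add: specialize_def)
  have "x1 = x2 \<and> y1 = y2"
    if P: "y1 ^ 2 = x1 ^ 3 + A * x1 ^ 2 + B * x1 + C"
    and Q: "y2 ^ 2 = x2 ^ 3 + A * x2 ^ 2 + B * x2 + C"
    and ex: "rf_eval t0 x1 = rf_eval t0 x2" and ey: "rf_eval t0 y1 = rf_eval t0 y2" for x1 y1 x2 y2
  proof (rule ccontr)
    assume ne: "\<not> (x1 = x2 \<and> y1 = y2)"
    note r = no_pole[OF P] no_pole[OF Q] regY[OF P] regY[OF Q] reg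
    define x where "x = rf_eval t0 x1"
    define y where "y = rf_eval t0 y1"
    have "rf_eval t0 (y1 ^ 2) = rf_eval t0 (x1 ^ 3 + A * x1 ^ 2 + B * x1 + C)" using P by simp
    hence xy: "y ^ 2 = x ^ 3 + rf_eval t0 A * x ^ 2 + rf_eval t0 B * x + rf_eval t0 C"
      by (simp add: rf_hom r x_def y_def)
    \<comment> \<open>In the specialization the two points coincide. For a regular \<open>l\<close>,
      the first relation forces the common ordinate to be 0, and the second forces the derivative of
      the cubic to vanish there, because the second factor in \<open>curve_difference\<close>
      becomes that derivative for equal abscissas. Such a singular point is excluded by
      \<open>smooth\<close>.\<close>
    have key: False if l: "rf_regular t0 l" and l1: "l * a = y1 + y2" and a: "rf_regular t0 a" "rf_eval t0 a = 0"
       and l2: "l * b = c * (x1 ^ 2 + x1 * x2 + x2 ^ 2 + A * (x1 + x2) + B)" and b: "rf_regular t0 b" "rf_eval t0 b = 0"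
       and c: "rf_regular t0 c" "rf_eval t0 c \<noteq> 0"
      for l a b c
    proof -
      have "rf_eval t0 (l * a) = rf_eval t0 (y1 + y2)" using l1 by simp
      hence "y = 0" using ey by (simp add: rf_hom r l a y_def)
      have "rf_eval t0 (l * b) = rf_eval t0 (c * (x1 ^ 2 + x1 * x2 + x2 ^ 2 + A * (x1 + x2) + B))" 
        using l2 by simp
      hence "x ^ 2 + x * x + x ^ 2 + rf_eval t0 A * (x + x) + rf_eval t0 B = 0" 
        using ex c(2) by (simp add: rf_hom r l b c(1) x_def)
      moreover have "3 * x ^ 2 + 2 * rf_eval t0 A * x + rf_eval t0 B \<noteq> 0"
        using smooth[of x] xy \<open>y = 0\<close> by simp
      ultimately show False by (simp add: algebra_simps power2_eq_square)
    qed
    show False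
    proof (cases "x1 = x2")
      case False
      \<comment> \<open>Slope of the chord through the first point and the negative of the second.
        So \<open>x3\<close> is the abscissa of their difference, and \<open>no_pole\<close> makes
        \<open>l\<close> regular.\<close>
      define l where "l = (y1 + y2) / (x1 - x2)"
      have l: "l * (x1 - x2) = y1 - (- y2)" using False by (simp add: l_def)
      define x3 where "x3 = l ^ 2 - A - x1 - x2"
      have "(l * (x3 - x1) + y1) ^ 2 = x3 ^ 3 + A * x3 ^ 2 + B * x3 + C"
        by (rule chord_on_curve[OF P _ l False x3_def refl]) (use Q in simp)
      hence "rf_regular t0 x3" by (rule no_pole)
      hence "rf_regular t0 (x3 + A + x1 + x2)" by (simp add: rf_hom r)
      moreover have "x3 + A + x1 + x2 = l ^ 2" by (simp add: x3_def)
      ultimately have lreg: "rf_regular t0 l" using rf_regular_of_square[of t0 l] by simp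
      have "(x1 - x2) * (l * (y1 - y2)) = (l * (x1 - x2)) * (y1 - y2)" by (simp only: mult_ac)
      also have "\<dots> = (y1 - y2) * (y1 + y2)" by (simp add: l)
      also note curve_difference[OF P Q]
      finally have "(x1 - x2) * (l * (y1 - y2)) = (x1 - x2) * (x1 ^ 2 + x1 * x2 + x2 ^ 2 + A * (x1 + x2) + B)" .
      hence l2: "l * (y1 - y2) = 1 * (x1 ^ 2 + x1 * x2 + x2 ^ 2 + A * (x1 + x2) + B)"
        using False by (simp only: mult_cancel_left) simp
      have l1: "l * (x1 - x2) = y1 + y2" using l by simp
      show False
        by (rule key[OF lreg l1 _ _ l2]) (simp_all add: rf_hom r ex ey)
    next
      case True
      have "y1 ^ 2 = y2 ^ 2" using P Q True by simp
      hence y2: "y2 = - y1" using ne True by (simp add: power2_eq_iff)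
      have y0: "y1 \<noteq> 0" using ne True y2 by auto
      \<comment> \<open>The second point is the negative of the first, so the difference is a double
        and the tangent takes the place of the chord.\<close>
      define l where "l = (3 * x1 ^ 2 + 2 * A * x1 + B) / (2 * y1)"
      have l: "2 * y1 * l = 3 * x1 ^ 2 + 2 * A * x1 + B" using y0 by (simp add: l_def)
      define x3 where "x3 = l ^ 2 - A - 2 * x1"
      have "(l * (x3 - x1) + y1) ^ 2 = x3 ^ 3 + A * x3 ^ 2 + B * x3 + C"
        by (rule tangent_on_curve[OF P l x3_def refl])
      hence "rf_regular t0 x3" by (rule no_pole)
      hence "rf_regular t0 (x3 + A + 2 * x1)" by (simp add: rf_hom r)
      moreover have "x3 + A + 2 * x1 = l ^ 2" by (simp add: x3_def)
      ultimately have lreg: "rf_regular t0 l" using rf_regular_of_square[of t0 l] by simp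
      have ey1: "rf_eval t0 y1 = 0" using ey y2 by (simp add: rf_hom r)
      have l1: "l * 0 = y1 + y2" using y2 by simp
      have l2: "l * (2 * y1) = 1 * (x1 ^ 2 + x1 * x2 + x2 ^ 2 + A * (x1 + x2) + B)"
        using l unfolding True[symmetric] by (simp add: algebra_simps power2_eq_square)
      show False
        by (rule key[OF lreg l1 _ _ l2]) (simp_all add: rf_hom r ey1)
    qed
  qed
  note inj = this
  show ?thesis
  proof (rule inj_onI)
    fix P Q
    assume PQ: "P \<in> {None} \<union> {Some (X, Y) | X Y. Y ^ 2 = X ^ 3 + A * X ^ 2 + B * X + C}"
      "Q \<in> {None} \<union> {Some (X, Y) | X Y. Y ^ 2 = X ^ 3 + A * X ^ 2 + B * X + C}"
      and eq: "specialize t0 P = specialize t0 Q"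
    have cases: "R = None \<or> (\<exists>X Y. R = Some (X, Y) \<and> Y ^ 2 = X ^ 3 + A * X ^ 2 + B * X + C)"
      if "R \<in> {None} \<union> {Some (X, Y) | X Y. Y ^ 2 = X ^ 3 + A * X ^ 2 + B * X + C}" for R
      using that by blast
    show "P = Q"
    proof (cases "P = None \<or> Q = None")
      case True
      thus ?thesis using cases[OF PQ(1)] cases[OF PQ(2)] eq spec spec_None by (metis option.distinct(1))
    next
      case False
      then obtain x1 y1 x2 y2 where
          P: "P = Some (x1, y1)" "y1 ^ 2 = x1 ^ 3 + A * x1 ^ 2 + B * x1 + C"
        and Q: "Q = Some (x2, y2)" "y2 ^ 2 = x2 ^ 3 + A * x2 ^ 2 + B * x2 + C"
        using cases[OF PQ(1)] cases[OF PQ(2)] by blast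
      have "x1 = x2 \<and> y1 = y2"
        by (rule inj[OF P(2) Q(2)]) (use eq spec[OF P(2)] spec[OF Q(2)] P(1) Q(1) in simp_all)
      thus ?thesis using P(1) Q(1) by simp
    qed
  qed
qed

subsection \<open>Points in lowest terms\<close>

lemma even_multiplicity_imp_unit_squarefree_part:
  fixes x :: "'a :: factorial_semiring"
  assumes "\<And>p. prime p \<Longrightarrow> p dvd x \<Longrightarrow> even (multiplicity p x)"
  shows "is_unit (squarefree_part x)"
proof (rule ccontr)
  assume "\<not> is_unit (squarefree_part x)"
  then obtain p where p: "prime p" "p dvd squarefree_part x"
    using prime_divisor_exists[of "squarefree_part x"] by auto
  have "p dvd x" using p(2) squarefree_decompose[of x] by (metis dvd_mult2)
  hence "multiplicity p (squarefree_part x) = 0"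
    using assms[OF p(1)] by (simp add: prime_multiplicity_squarefree_part p)
  moreover have "multiplicity p (squarefree_part x) > 0"
    using p by (simp add: prime_multiplicity_gt_zero_iff)
  ultimately show False by simp
qed

lemma coprime_mult_square_imp_unit_squarefree_part:
  fixes x y :: "'a :: factorial_semiring_gcd"
  assumes "coprime x y" "x * y = m ^ 2" "x \<noteq> 0" "y \<noteq> 0"
  shows "is_unit (squarefree_part x)"
proof (rule even_multiplicity_imp_unit_squarefree_part)
  fix p assume p: "prime p" "p dvd x"
  hence "\<not> p dvd y" using assms(1) by (meson coprime_common_divisor not_prime_unit)
  hence "multiplicity p x = multiplicity p (x * y)"
    using p assms(3,4) \<open>\<not> p dvd y\<close>
    by (subst prime_elem_multiplicity_mult_distrib) (auto simp: not_dvd_imp_multiplicity_0)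
  also have "\<dots> = 2 * multiplicity p m"
    using p assms by (subst assms(2), subst prime_elem_multiplicity_power_distrib) auto
  finally show "even (multiplicity p x)" by simp
qed

lemma is_unit_int_poly_iff: "is_unit (u :: int poly) \<longleftrightarrow> u = 1 \<or> u = -1"
proof
  assume "is_unit u"
  then obtain c where c: "u = [:c:]" "is_unit c" by (auto simp: is_unit_poly_iff)
  have "c = 1 \<or> c = -1" using c(2) by auto
  thus "u = 1 \<or> u = -1" using c(1) by (metis minus_pCons minus_zero pCons_one)
qed auto

lemma coprime_mult_square_int_poly:
  fixes x y :: "int poly"
  assumes "coprime x y" "x * y = m ^ 2" "x \<noteq> 0" "y \<noteq> 0"
  obtains r s where "x = r ^ 2 \<and> y = s ^ 2 \<or> x = - (r ^ 2) \<and> y = - (s ^ 2)"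
proof -
  have x: "x = squarefree_part x * square_part x ^ 2" "squarefree_part x = 1 \<or> squarefree_part x = -1"
    using coprime_mult_square_imp_unit_squarefree_part[OF assms] squarefree_decompose[of x]
    by (simp_all add: is_unit_int_poly_iff)
  have "coprime y x" "y * x = m ^ 2" using assms by (simp_all add: coprime_commute mult.commute)
  from coprime_mult_square_imp_unit_squarefree_part[OF this assms(4,3)]
  have y: "y = squarefree_part y * square_part y ^ 2" "squarefree_part y = 1 \<or> squarefree_part y = -1"
    using squarefree_decompose[of y] by (simp_all add: is_unit_int_poly_iff)
  define r where "r = square_part x"
  define s where "s = square_part y"
  have rs: "r * s \<noteq> 0" using assms by (simp add: r_def s_def)
  \<comment> \<open>\<int>[t] is ordered by the sign of the leading coefficient, so a square is not
    the negative of a nonzero square. This makes the two signs equal.\<close>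
  have no: "m ^ 2 \<noteq> - ((r * s) ^ 2)"
  proof
    assume "m ^ 2 = - ((r * s) ^ 2)"
    moreover have "m ^ 2 \<ge> 0" "(r * s) ^ 2 > 0" using rs by (auto simp: less_le)
    ultimately show False by simp
  qed
  have x': "x = r ^ 2 \<or> x = - (r ^ 2)" using x unfolding r_def by (metis mult_1 mult_minus1)
  have y': "y = s ^ 2 \<or> y = - (s ^ 2)" using y unfolding s_def by (metis mult_1 mult_minus1)
  show thesis
    using that[of r s] x' y' no assms(2) by (auto simp: power_mult_distrib)
qed

lemma rf_of_intpoly_hom [simp]:
  "rf_of_intpoly (p + q) = rf_of_intpoly p + rf_of_intpoly q"
  "rf_of_intpoly (p - q) = rf_of_intpoly p - rf_of_intpoly q"
  "rf_of_intpoly (- p) = - rf_of_intpoly p"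
  "rf_of_intpoly (p * q) = rf_of_intpoly p * rf_of_intpoly q"
  "rf_of_intpoly 0 = 0" "rf_of_intpoly 1 = 1"
  "rf_of_intpoly p = rf_of_intpoly q \<longleftrightarrow> p = q"
  by (simp_all add: rf_of_intpoly_def hom_distribs)

lemma rf_of_intpoly_power [simp]: "rf_of_intpoly (p ^ n) = rf_of_intpoly p ^ n"
  by (induction n) simp_all

lemma rf_of_intpoly_eq_0 [simp]: "rf_of_intpoly p = 0 \<longleftrightarrow> p = 0"
  using rf_of_intpoly_hom(7)[of p 0] by simp

lemma rf_of_intpoly_of_int: "rf_of_intpoly [:k:] = of_int k"
proof -
  have "rf_of_intpoly (of_nat n) = of_nat n" for n by (induction n) simp_all
  hence "rf_of_intpoly (of_int k) = of_int k" by (cases k) simp_all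
  thus ?thesis by (simp add: of_int_poly)
qed

lemma rat_poly_clear_denominators:
  fixes r :: "rat poly"
  obtains n :: int and q :: "int poly" where "n > 0" "smult (of_int n) r = of_int_poly q"
proof -
  have "\<exists>n q. n > 0 \<and> smult (of_int n) r = of_int_poly q"
  proof (induction r)
    case 0
    show ?case by (intro exI[of _ 1] exI[of _ 0]) simp
  next
    case (pCons a r)
    then obtain n q where nq: "n > 0" "smult (of_int n) r = of_int_poly q" by blast
    obtain k l where kl: "quotient_of a = (k, l)" by force
    hence l: "l > 0" "a = of_int k / of_int l"
      using quotient_of_denom_pos quotient_of_div by auto
    have "smult (of_int (n * l)) (pCons a r) = pCons (of_int (n * k)) (smult (of_int l) (smult (of_int n) r))"
      using l by (simp add: mult.commute)
    also have "\<dots> = of_int_poly (pCons (n * k) (smult l q))"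
      by (simp add: nq hom_distribs)
    finally show ?case using nq(1) l(1) by (metis mult_pos_pos)
  qed
  thus thesis using that by blast
qed

text \<open>Lowest terms over \<int>[t] and not only over \<rat>[t]: common integer primes are
  removed too, since the square classes are later compared with divisors in \<int>[t].\<close>

lemma ratfun_as_int_quotient:
  obtains u v where "coprime u v" "v \<noteq> 0" "X = rf_of_intpoly u / rf_of_intpoly v"
proof -
  define a where "a = fst (quot_of_fract X)"
  define b where "b = snd (quot_of_fract X)"
  have b0: "b \<noteq> 0" by (simp add: b_def)
  have X: "X = to_fract a / to_fract b"
    unfolding a_def b_def Fract_conv_to_fract[symmetric] by simp
  obtain n a' where n: "n > 0" "smult (of_int n) a = of_int_poly a'" by (rule rat_poly_clear_denominators)
  obtain l b' where l: "l > 0" "smult (of_int l) b = of_int_poly b'" by (rule rat_poly_clear_denominators)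
  have b'0: "b' \<noteq> 0" using l b0 by auto
  have "to_fract (a * of_int_poly ([:n:] * b')) = to_fract (of_int_poly ([:l:] * a') * b)"
    by (simp add: hom_distribs n(2)[symmetric] l(2)[symmetric] mult.commute)
  moreover have nl: "[:n:] * b' \<noteq> 0" "[:l:] * a' \<noteq> 0 \<or> a = 0" using n l b'0 by auto
  ultimately have X2: "X = rf_of_intpoly ([:l:] * a') / rf_of_intpoly ([:n:] * b')"
    unfolding X rf_of_intpoly_def using b0
    by (subst frac_eq_eq) (simp_all only: to_fract_mult to_fract_eq_0_iff of_int_poly_hom.hom_0_iff, simp_all)
  obtain u v where uv: "[:l:] * a' = u * gcd ([:l:] * a') ([:n:] * b')"
      "[:n:] * b' = v * gcd ([:l:] * a') ([:n:] * b')" "coprime u v"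
    using gcd_coprime_exists[of "[:l:] * a'" "[:n:] * b'"] nl(1) by auto
  have "v \<noteq> 0" "gcd ([:l:] * a') ([:n:] * b') \<noteq> 0" using uv nl by auto
  hence "X = rf_of_intpoly u / rf_of_intpoly v"
    unfolding X2 by (subst uv(1), subst uv(2)) (simp del: mult_pCons_left)
  thus thesis using that uv \<open>v \<noteq> 0\<close> by blast
qed

text \<open>\<int>[t] is integrally closed in its fraction field: the denominator in lowest terms is
  a unit.\<close>

lemma rf_square_is_int_poly:
  assumes "Z ^ 2 = rf_of_intpoly m"
  obtains z where "Z = rf_of_intpoly z" "z ^ 2 = m"
proof -
  obtain u v where uv: "coprime u v" "v \<noteq> 0" "Z = rf_of_intpoly u / rf_of_intpoly v"
    by (rule ratfun_as_int_quotient)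
  have "rf_of_intpoly (u ^ 2) = rf_of_intpoly (m * v ^ 2)"
    using assms uv(2) unfolding rf_of_intpoly_hom(4) rf_of_intpoly_power
    by (simp add: uv(3) power_divide field_simps)
  hence eq: "u ^ 2 = m * v ^ 2" unfolding rf_of_intpoly_hom(7) .
  hence "v dvd u ^ 2" by (simp add: power2_eq_square)
  hence "is_unit v" using uv(1)
    by (metis coprime_absorb_right coprime_commute coprime_power_left_iff pos2)
  hence "v = 1 \<or> v = -1" by (simp add: is_unit_int_poly_iff)
  thus thesis using that[of u] that[of "-u"] uv eq by auto
qed

text \<open>For \<open>X = u / v\<close> the cleared cubic \<open>W\<close> is \<open>u ^ 3\<close>
  modulo \<open>v\<close>, so \<open>v\<close> and \<open>W\<close> are coprime, and
  \<open>v * W\<close> is a square. Hence \<open>v\<close> is a square up to sign.\<close>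

lemma curve_point_as_int_polys:
  assumes curve: "Y ^ 2 = X ^ 3 + rf_of_intpoly A * X ^ 2 + rf_of_intpoly B * X + rf_of_intpoly C"
  obtains p q y where "coprime p q" "q \<noteq> 0"
    "X = rf_of_intpoly p / rf_of_intpoly q ^ 2" "Y = rf_of_intpoly y / rf_of_intpoly q ^ 3"
    "y ^ 2 = p ^ 3 + A * p ^ 2 * q ^ 2 + B * p * q ^ 4 + C * q ^ 6"
proof -
  obtain u v where uv: "coprime u v" "v \<noteq> 0" "X = rf_of_intpoly u / rf_of_intpoly v"
    by (rule ratfun_as_int_quotient)
  define W where "W = u ^ 3 + A * u ^ 2 * v + B * u * v ^ 2 + C * v ^ 3"
  have v0: "rf_of_intpoly v \<noteq> 0" using uv by simp
  have "rf_of_intpoly W = rf_of_intpoly v ^ 3 * Y ^ 2"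
    unfolding W_def curve uv(3) using v0
    by (simp add: field_simps power2_eq_square power3_eq_cube)
  hence "(Y * rf_of_intpoly v ^ 2) ^ 2 = rf_of_intpoly (W * v)"
    by (simp add: power2_eq_square power3_eq_cube mult_ac)
  then obtain m where m: "Y * rf_of_intpoly v ^ 2 = rf_of_intpoly m" "m ^ 2 = W * v"
    by (rule rf_square_is_int_poly)
  have W': "W = u ^ 3 + (A * u ^ 2 + B * u * v + C * v ^ 2) * v"
    unfolding W_def by (simp add: algebra_simps power2_eq_square power3_eq_cube)
  have "gcd v W = gcd v (u ^ 3)" unfolding W' by (subst add.commute) (rule gcd_add_mult)
  hence cop: "coprime v W" using uv(1) by (simp add: coprime_iff_gcd_eq_1[symmetric] coprime_commute)
  show thesis
  proof (cases "W = 0")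
    \<comment> \<open>A point with ordinate 0. The splitting of a square into coprime factors needs
      nonzero factors; here \<open>v\<close> is a unit and \<open>q = 1\<close> serves.\<close>
    case True
    hence "is_unit v" using cop by simp
    hence v1: "v = 1 \<or> v = -1" by (simp add: is_unit_int_poly_iff)
    hence "v ^ 2 = 1" by auto
    have "Y = 0" using m True v0 by simp
    define p where "p = u * v"
    have X: "X = rf_of_intpoly p" using v1 by (auto simp: uv(3) p_def)
    have "rf_of_intpoly (p ^ 3 + A * p ^ 2 * 1 ^ 2 + B * p * 1 ^ 4 + C * 1 ^ 6) = Y ^ 2"
      unfolding curve X by (simp add: rf_of_intpoly_of_int[symmetric])
    hence "rf_of_intpoly (p ^ 3 + A * p ^ 2 * 1 ^ 2 + B * p * 1 ^ 4 + C * 1 ^ 6) = 0"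
      using \<open>Y = 0\<close> by simp
    thus thesis using that[of p 1 0] X \<open>Y = 0\<close> unfolding rf_of_intpoly_eq_0 by simp
  next
    case False
    have "v * W = m ^ 2" using m by simp
    then obtain q r where qr: "v = q ^ 2 \<and> W = r ^ 2 \<or> v = - (q ^ 2) \<and> W = - (r ^ 2)"
      using coprime_mult_square_int_poly[OF cop _ uv(2) False] by metis
    \<comment> \<open>The sign common to \<open>v\<close> and \<open>W\<close> moves into the
      numerator, which keeps \<open>q ^ 2\<close> as denominator.\<close>
    define p where "p = (if v = q ^ 2 then u else - u)"
    have q0: "q \<noteq> 0" using qr uv(2) by auto
    have ne: "- (q ^ 2) \<noteq> q ^ 2" using q0 by simp
    have X: "X = rf_of_intpoly p / rf_of_intpoly q ^ 2"
      using qr ne by (auto simp: uv(3) p_def)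
    have q46: "q ^ 4 = (q ^ 2) ^ 2" "q ^ 6 = (q ^ 2) ^ 3" by (simp_all flip: power_mult)
    have r2: "r ^ 2 = p ^ 3 + A * p ^ 2 * q ^ 2 + B * p * q ^ 4 + C * q ^ 6"
    proof (cases "v = q ^ 2")
      case True
      have "W = r ^ 2" "p = u" using True qr ne by (auto simp: p_def)
      thus ?thesis unfolding W_def True q46 by simp
    next
      case False
      hence v: "v = - (q ^ 2)" and "r ^ 2 = - W" "u = - p" using qr by (auto simp: p_def)
      thus ?thesis unfolding W_def q46 v by (simp add: algebra_simps power2_eq_square power3_eq_cube)
    qed
    have "coprime p q" using uv(1) qr by (auto simp: p_def split: if_splits)
    have "(Y * rf_of_intpoly q ^ 3) ^ 2 = Y ^ 2 * rf_of_intpoly (q ^ 6)"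
      by (simp add: power_mult_distrib flip: power_mult)
    also have "\<dots> = rf_of_intpoly (r ^ 2)" 
      unfolding curve X r2 using q0
      by (simp add: field_simps eval_nat_numeral)
    finally obtain y where y: "Y * rf_of_intpoly q ^ 3 = rf_of_intpoly y" "y ^ 2 = r ^ 2"
      by (rule rf_square_is_int_poly)
    have "Y = rf_of_intpoly y / rf_of_intpoly q ^ 3" using y(1) q0 by (simp add: field_simps)
    thus thesis using that[OF \<open>coprime p q\<close> q0 X _ y(2)[unfolded r2]] by blast
  qed
qed

subsection \<open>Heights and duplication\<close>
definition cubic_disc :: "'a :: comm_ring_1 \<Rightarrow> 'a \<Rightarrow> 'a \<Rightarrow> 'a" where
  "cubic_disc a b c = a^2 * b^2 - 4 * b^3 - 4 * a^3 * c - 27 * c^2 + 18 * a * b * c"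

text \<open>If a point has abscissa \<open>u / v\<close>, its double has abscissa
  \<open>dup_num / dup_den\<close>. Both forms are homogeneous of degree four in \<open>u\<close>
  and \<open>v\<close>.\<close>

definition dup_num :: "'a :: comm_ring_1 \<Rightarrow> 'a \<Rightarrow> 'a \<Rightarrow> 'a \<Rightarrow> 'a \<Rightarrow> 'a" where
  "dup_num a b c u v = u ^ 4 - 2 * b * u ^ 2 * v ^ 2 - 8 * c * u * v ^ 3 + (b ^ 2 - 4 * a * c) * v ^ 4"

definition dup_den :: "'a :: comm_ring_1 \<Rightarrow> 'a \<Rightarrow> 'a \<Rightarrow> 'a \<Rightarrow> 'a \<Rightarrow> 'a" where
  "dup_den a b c u v = 4 * v * (u ^ 3 + a * u ^ 2 * v + b * u * v ^ 2 + c * v ^ 3)"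

text \<open>Bezout identity for the cubic and its derivative, homogenized. The cofactor of the
  derivative reappears in \<open>T\<close>.\<close>

lemma cubic_disc_combination:
  fixes a b c u v :: "'a :: comm_ring_1"
  shows "cubic_disc a b c * v ^ 4 =
      ((18 * b - 6 * a^2) * u + (15 * a * b - 4 * a^3 - 27 * c) * v) * (u ^ 3 + a * u ^ 2 * v + b * u * v ^ 2 + c * v ^ 3)
    + ((2 * a^2 - 6 * b) * u ^ 2 + (2 * a^3 - 7 * a * b + 9 * c) * u * v + (a^2 * b + 3 * a * c - 4 * b^2) * v ^ 2)
      * (3 * u ^ 2 + 2 * a * u * v + b * v ^ 2)"
  unfolding cubic_disc_def by (simp add: algebra_simps eval_nat_numeral)

text \<open>The tangent formula \<open>l^2 - a - 2 x\<close> with \<open>l = f' / (2 y)\<close>,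
  brought to the denominator \<open>4 f\<close>.\<close>

lemma dup_num_eq:
  fixes a b c u v :: "'a :: comm_ring_1"
  shows "dup_num a b c u v = (3 * u ^ 2 + 2 * a * u * v + b * v ^ 2) ^ 2
            - (8 * u + 4 * a * v) * (u ^ 3 + a * u ^ 2 * v + b * u * v ^ 2 + c * v ^ 3)"
  unfolding dup_num_def by (simp add: algebra_simps eval_nat_numeral)

lemma degree_mult_leI: "degree p \<le> i \<Longrightarrow> degree q \<le> j \<Longrightarrow> i + j \<le> k \<Longrightarrow> degree (p * q) \<le> k"
  using degree_mult_le[of p q] by linarith

lemma degree_power_leI: "degree p \<le> i \<Longrightarrow> n * i \<le> k \<Longrightarrow> degree (p ^ n) \<le> k"
  using degree_power_le[of p n] mult_le_mono[of "degree p" i n n] by (metis le_trans mult.commute order_refl)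

lemma degree_const_mult_leI: "degree p \<le> 0 \<Longrightarrow> degree q \<le> k \<Longrightarrow> degree (p * q) \<le> k"
  using degree_mult_leI[of p 0 q k k] by simp

lemma degree_const_power_leI: "degree p \<le> 0 \<Longrightarrow> degree (p ^ n) \<le> 0"
  using degree_power_leI[of p 0 n 0] by simp

text \<open>Up to the factor \<open>4 D\<^sup>2\<close>, the ninth power of the denominator lies in the ideal generated by
  numerator and denominator of the duplication map. So these are coprime and duplication
  multiplies the height by four.\<close>

lemma dup_degree_bound:
  fixes a b c u v U V :: "'a :: {field_char_0, field_gcd} poly"
  assumes const: "degree a = 0" "degree b = 0" "degree c = 0"
    and disc: "cubic_disc a b c \<noteq> 0"
    and cop: "coprime u v" and v0: "v \<noteq> 0" and V0: "V \<noteq> 0"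
    and eq: "dup_num a b c u v * V = dup_den a b c u v * U"
    and deg: "degree U \<le> n" "degree V \<le> n"
  shows "4 * degree u \<le> n" "4 * degree v \<le> n"
proof -
  define D where "D = cubic_disc a b c"
  define f where "f = u ^ 3 + a * u ^ 2 * v + b * u * v ^ 2 + c * v ^ 3"
  define f' where "f' = 3 * u ^ 2 + 2 * a * u * v + b * v ^ 2"
  define s where "s = (18 * b - 6 * a^2) * u + (15 * a * b - 4 * a^3 - 27 * c) * v"
  define t where "t = (2 * a^2 - 6 * b) * u ^ 2 + (2 * a^3 - 7 * a * b + 9 * c) * u * v + (a^2 * b + 3 * a * c - 4 * b^2) * v ^ 2"
  define A where "A = dup_num a b c u v"
  define B where "B = dup_den a b c u v"
  \<comment> \<open>In \<open>(s f + t f')^2\<close> the square of \<open>f'\<close> is rewritten by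
    \<open>A_eq\<close>. Apart from \<open>t^2 A\<close>, everything is then a multiple of
    \<open>f\<close>, with cofactor \<open>R\<close>. Multiplication by \<open>4 v\<close> turns
    \<open>f\<close> into \<open>B\<close>.\<close>
  define R where "R = t ^ 2 * (8 * u + 4 * a * v) + s ^ 2 * f + 2 * s * t * f'"
  have A_eq: "A = f' ^ 2 - (8 * u + 4 * a * v) * f"
    unfolding A_def f_def f'_def by (rule dup_num_eq)
  have B_eq: "B = 4 * v * f" unfolding B_def f_def dup_den_def ..
  have "D * v ^ 4 = s * f + t * f'"
    unfolding D_def f_def f'_def s_def t_def by (rule cubic_disc_combination)
  hence "(D * v ^ 4) ^ 2 = (s * f + t * f') ^ 2" by simp
  also have "\<dots> = t ^ 2 * A + f * R"
    unfolding A_eq R_def by (simp add: algebra_simps power2_eq_square)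
  finally have "4 * v * (D * v ^ 4) ^ 2 = 4 * v * (t ^ 2 * A + f * R)" by simp
  hence key: "4 * D ^ 2 * v ^ 9 = (4 * v * t ^ 2) * A + R * B"
    unfolding B_eq by (simp add: algebra_simps eval_nat_numeral)
  have c0: "degree a \<le> 0" "degree b \<le> 0" "degree c \<le> 0" using const by simp_all
  have num: "degree (numeral k :: 'a poly) \<le> 0" for k by simp
  note mul0 = degree_const_mult_leI and pow0 = degree_const_power_leI
  have "degree D \<le> 0" unfolding D_def cubic_disc_def
    by (intro degree_add_le degree_diff_le mul0 pow0 num c0)
  hence cD: "degree D = 0" by simp
  have "D \<noteq> 0" using disc by (simp add: D_def)
  have unit_D: "is_unit (4 * D ^ 2)"
  proof -
    obtain d where d: "D = [:d:]" using cD by (rule degree_eq_zeroE)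
    have "4 * D ^ 2 = [:4 * d ^ 2:]" by (simp add: d power2_eq_square numeral_poly)
    thus ?thesis using \<open>D \<noteq> 0\<close> d by (simp add: is_unit_const_poly_iff)
  qed
  have coprime_AB: "coprime A B"
  proof (rule coprimeI)
    fix p assume p: "p dvd A" "p dvd B"
    hence "p dvd 4 * D ^ 2 * v ^ 9" unfolding key by (intro dvd_add dvd_mult)
    hence pv: "p dvd v ^ 9" using unit_D by (metis dvd_mult_unit_iff')
    have "A = u ^ 4 + v * ((b ^ 2 - 4 * a * c) * v ^ 3 - 2 * b * u ^ 2 * v - 8 * c * u * v ^ 2)"
      unfolding A_def dup_num_def by (simp add: algebra_simps eval_nat_numeral)
    hence "gcd v A = gcd v (u ^ 4)"
      by (metis add.commute gcd_add_mult mult.commute)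
    hence "coprime v A" using cop by (simp add: coprime_iff_gcd_eq_1[symmetric] coprime_commute)
    hence "coprime (v ^ 9) A" by simp
    thus "is_unit p" using p(1) pv by (meson coprime_common_divisor)
  qed
  have "A dvd B * U" using eq unfolding A_def B_def by (metis dvd_triv_left)
  hence "A dvd U" using coprime_AB by (simp add: coprime_dvd_mult_right_iff)
  hence dA: "degree A \<le> n"
  proof (cases "U = 0")
    case True
    hence "A = 0" using eq V0 by (simp add: A_def)
    thus ?thesis by simp
  next
    case False
    thus ?thesis using \<open>A dvd U\<close> deg(1) dvd_imp_degree_le by (metis le_trans)
  qed
  have "B dvd A * V" using eq unfolding A_def B_def by (metis dvd_triv_left)
  hence "B dvd V" using coprime_AB by (simp add: coprime_dvd_mult_right_iff coprime_commute)
  hence dB: "degree B \<le> n" using deg(2) V0 dvd_imp_degree_le by (metis le_trans)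
  \<comment> \<open>If \<open>v\<close> has the larger degree \<open>M\<close>, or an equal one,
    then \<open>key\<close> has degree \<open>9 M\<close> on the left, while the cofactors of
    \<open>A\<close> and \<open>B\<close> have degree at most \<open>5 M\<close>. Otherwise
    \<open>u ^ 4\<close> dominates \<open>A\<close>.\<close>
  have "4 * max (degree u) (degree v) \<le> n"
  proof (cases "degree u \<le> degree v")
    case True
    define M where "M = degree v"
    have du: "degree u \<le> M" and dv: "degree v \<le> M" using True by (simp_all add: M_def)
    have u2: "degree (u ^ 2) \<le> 2 * M" "degree (v ^ 2) \<le> 2 * M" "degree (u ^ 3) \<le> 3 * M" "degree (v ^ 3) \<le> 3 * M"
      by (rule degree_power_leI[OF du] degree_power_leI[OF dv]; simp)+
    have uv: "degree (u * v) \<le> 2 * M" by (rule degree_mult_leI[OF du dv]) simp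
    have fM: "degree f \<le> 3 * M" unfolding f_def
      by (intro degree_add_le u2 degree_mult_leI[OF mul0[OF c0(1) u2(1)] dv]
          degree_mult_leI[OF mul0[OF c0(2) du] u2(2)] mul0[OF c0(3) u2(4)]) simp_all
    have f'M: "degree f' \<le> 2 * M" unfolding f'_def mult.assoc
      by (intro degree_add_le mul0 num c0 u2 uv)
    have cs: "degree (18 * b - 6 * a^2) \<le> 0" "degree (15 * a * b - 4 * a^3 - 27 * c) \<le> 0"
        "degree (2 * a^2 - 6 * b) \<le> 0" "degree (2 * a^3 - 7 * a * b + 9 * c) \<le> 0"
        "degree (a^2 * b + 3 * a * c - 4 * b^2) \<le> 0" "degree (4 * a) \<le> 0"
      by (intro degree_add_le degree_diff_le mul0 pow0 num c0)+
    have sM: "degree s \<le> M" unfolding s_def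
      by (intro degree_add_le mul0 cs du dv)
    have tM: "degree t \<le> 2 * M" unfolding t_def mult.assoc[of _ u v]
      by (intro degree_add_le mul0 cs u2 uv)
    have t2: "degree (t ^ 2) \<le> 4 * M" "degree (s ^ 2) \<le> 2 * M"
      by (rule degree_power_leI[OF tM] degree_power_leI[OF sM]; simp)+
    have linM: "degree (8 * u + 4 * a * v) \<le> M"
      by (intro degree_add_le mul0 cs num du dv)
    have RM: "degree R \<le> 5 * M" unfolding R_def
      by (intro degree_add_le degree_mult_leI[OF t2(1) linM] degree_mult_leI[OF t2(2) fM]
         degree_mult_leI[OF degree_mult_leI[OF mul0[OF num sM] tM order.refl] f'M]) simp_all
    have "degree ((4 * v * t ^ 2) * A) \<le> 5 * M + n"
      by (rule degree_mult_leI[OF degree_mult_leI[OF mul0[OF num dv] t2(1) order.refl] dA]) simp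
    moreover have "degree (R * B) \<le> 5 * M + n"
      by (rule degree_mult_leI[OF RM dB]) simp
    ultimately have "degree (4 * D ^ 2 * v ^ 9) \<le> 5 * M + n"
      unfolding key by (rule degree_add_le)
    moreover have "degree (4 * D ^ 2 * v ^ 9) = 9 * M"
      using unit_D v0 by (subst degree_mult_eq) (auto simp: degree_power_eq M_def is_unit_iff_degree)
    ultimately show ?thesis using True by (simp add: M_def)
  next
    case False
    define r where "r = (b ^ 2 - 4 * a * c) * v ^ 3 - 2 * b * u ^ 2 * v - 8 * c * u * v ^ 2"
    define m where "m = degree u"
    have du: "degree u \<le> m" and dv: "degree v \<le> m" using False by (simp_all add: m_def)
    have u2: "degree (u ^ 2) \<le> 2 * m" "degree (v ^ 2) \<le> 2 * m" "degree (v ^ 3) \<le> 3 * m"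
      by (rule degree_power_leI[OF du] degree_power_leI[OF dv]; simp)+
    have cs: "degree (2 * b) \<le> 0" "degree (8 * c) \<le> 0" "degree (b ^ 2 - 4 * a * c) \<le> 0"
      by (intro degree_diff_le mul0 pow0 num c0)+
    have "degree r \<le> 3 * m" unfolding r_def
      by (intro degree_add_le degree_diff_le degree_mult_leI[OF mul0[OF cs(1) u2(1)] dv]
          degree_mult_leI[OF mul0[OF cs(2) du] u2(2)] mul0[OF cs(3) u2(3)]) simp_all
    hence "degree (v * r) < 4 * m"
      using False degree_mult_le[of v r] by (simp add: m_def)
    moreover have "A = u ^ 4 + v * r"
      unfolding A_def dup_num_def r_def by (simp add: algebra_simps eval_nat_numeral)
    moreover have "degree (u ^ 4) = 4 * m" using False by (subst degree_power_eq) (auto simp: m_def)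
    ultimately have "degree A = 4 * m" by (simp add: degree_add_eq_left)
    thus ?thesis using dA False by (simp add: m_def)
  qed
  thus "4 * degree u \<le> n" "4 * degree v \<le> n" by simp_all
qed

text \<open>The coefficients of the twist have weights 1, 2, 3 in \<open>g\<close>, so the
  substitution pulls out pure powers of \<open>g\<close>. Those of numerator and denominator differ
  by the one factor \<open>g\<close> by which abscissas scale.\<close>

lemma dup_num_scale: "dup_num (a * g) (b * g ^ 2) (c * g ^ 3) (g * u) v = g ^ 4 * dup_num a b c u v"
  unfolding dup_num_def by (simp add: algebra_simps eval_nat_numeral)

lemma dup_den_scale: "dup_den (a * g) (b * g ^ 2) (c * g ^ 3) (g * u) v = g ^ 3 * dup_den a b c u v"
  unfolding dup_den_def by (simp add: algebra_simps eval_nat_numeral)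

lemma dup_homogeneous:
  "dup_num a b c (w * u) (w * v) = w ^ 4 * dup_num a b c u v"
  "dup_den a b c (w * u) (w * v) = w ^ 4 * dup_den a b c u v"
  unfolding dup_num_def dup_den_def by (simp_all add: algebra_simps eval_nat_numeral)

lemma dup_to_fract:
  "dup_num (to_fract a) (to_fract b) (to_fract c) (to_fract u) (to_fract v) = to_fract (dup_num a b c u v)"
  "dup_den (to_fract a) (to_fract b) (to_fract c) (to_fract u) (to_fract v) = to_fract (dup_den a b c u v)"
proof -
  have p: "to_fract x ^ n = to_fract (x ^ n)" for x :: 'a and n
    by (induction n) simp_all
  have "of_nat n = to_fract (of_nat n :: 'a)" for n by (induction n) simp_all
  hence n: "numeral k = to_fract (numeral k :: 'a)" for k by (metis of_nat_numeral)
  show "dup_num (to_fract a) (to_fract b) (to_fract c) (to_fract u) (to_fract v) = to_fract (dup_num a b c u v)"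
   "dup_den (to_fract a) (to_fract b) (to_fract c) (to_fract u) (to_fract v) = to_fract (dup_den a b c u v)"
    unfolding dup_num_def dup_den_def p n by (simp_all del: to_fract_mult to_fract_add to_fract_diff add: to_fract_mult[symmetric] to_fract_add[symmetric] to_fract_diff[symmetric])
qed

text \<open>The height of a point is measured by \<open>X / g\<close>, a coordinate on the untwisted curve, where the
  duplication map has constant coefficients.\<close>

lemma halving_degree_drop:
  fixes a b c u v :: "rat poly" and g X X' :: ratfun
  assumes const: "degree a = 0" "degree b = 0" "degree c = 0"
    and disc: "cubic_disc a b c \<noteq> 0" and g0: "g \<noteq> 0"
    and X: "X = g * (to_fract u / to_fract v)" and v0: "v \<noteq> 0"
    and deg: "degree u \<le> n" "degree v \<le> n"
    and dup: "dup_num (to_fract a * g) (to_fract b * g ^ 2) (to_fract c * g ^ 3) X' 1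
       = X * dup_den (to_fract a * g) (to_fract b * g ^ 2) (to_fract c * g ^ 3) X' 1"
  obtains u' v' where "X' = g * (to_fract u' / to_fract v')" "v' \<noteq> 0"
    "4 * degree u' \<le> n" "4 * degree v' \<le> n"
proof -
  define u' where "u' = fst (quot_of_fract (X' / g))"
  define v' where "v' = snd (quot_of_fract (X' / g))"
  have v'0: "v' \<noteq> 0" by (simp add: v'_def)
  have cop: "coprime u' v'" unfolding u'_def v'_def by (rule coprime_quot_of_fract)
  define r where "r = to_fract u' / to_fract v'"
  have "X' / g = r"
    unfolding r_def u'_def v'_def Fract_conv_to_fract[symmetric] by simp
  hence X': "X' = g * r" using g0 by (simp add: field_simps)
  have nz: "to_fract v \<noteq> 0" "to_fract v' \<noteq> 0" using v0 v'0 by simp_all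
  define N where "N = dup_num (to_fract a) (to_fract b) (to_fract c) r 1"
  define M where "M = dup_den (to_fract a) (to_fract b) (to_fract c) r 1"
  have "g ^ 4 * N = X * (g ^ 3 * M)"
    using dup unfolding X' dup_num_scale dup_den_scale N_def M_def .
  hence "g ^ 4 * N = g ^ 4 * (to_fract u / to_fract v * M)"
    by (simp add: X eval_nat_numeral mult_ac)
  hence "N = to_fract u / to_fract v * M" using g0 by (simp only: mult_cancel_left) simp
  hence NM: "N * to_fract v = M * to_fract u" using nz by (simp add: mult_ac)
  have vr: "to_fract v' * r = to_fract u'" using nz by (simp add: r_def)
  have "to_fract v' ^ 4 * N = to_fract (dup_num a b c u' v')"
    unfolding N_def dup_homogeneous(1)[symmetric] vr by (simp add: dup_to_fract)
  moreover have "to_fract v' ^ 4 * M = to_fract (dup_den a b c u' v')"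
    unfolding M_def dup_homogeneous(2)[symmetric] vr by (simp add: dup_to_fract)
  moreover have "to_fract v' ^ 4 * N * to_fract v = to_fract v' ^ 4 * M * to_fract u"
    using NM by (simp only: mult.assoc)
  ultimately have "to_fract (dup_num a b c u' v' * v) = to_fract (dup_den a b c u' v' * u)"
    by simp
  hence "dup_num a b c u' v' * v = dup_den a b c u' v' * u" by (simp only: to_fract_eq_iff)
  from dup_degree_bound[OF const disc cop v'0 v0 this deg]
  show thesis using that[of u' v'] X' v'0 by (simp add: r_def)
qed

subsection \<open>Descent by halving\<close>
text \<open>Gauss lemma: the linear factor is primitive, so its divisibility over \<rat>[t] descends
  to \<int>[t].\<close>

lemma linear_dvd_int_poly:
  fixes p :: "int poly"
  assumes root: "poly (of_int_poly p) t0 = (0 :: rat)" and kl: "quotient_of t0 = (k, l)"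
  shows "[:- k, l:] dvd p"
proof -
  have l: "l > 0" "t0 = of_int k / of_int l" "coprime k l"
    using kl quotient_of_denom_pos quotient_of_div quotient_of_coprime by auto
  obtain R where R: "of_int_poly p = [:- t0, 1:] * R" using root by (auto simp: poly_eq_0_iff_dvd)
  obtain n R' where n: "n > 0" "smult (of_int n) R = of_int_poly R'" by (rule rat_poly_clear_denominators)
  have "(of_int_poly (smult (l * n) p) :: rat poly) = smult (of_int l) [:- t0, 1:] * smult (of_int n) R"
    by (simp only: of_int_hom.map_poly_hom_smult of_int_mult R mult_smult_left mult_smult_right smult_smult mult.commute[of "rat_of_int n"])
  also have "smult (of_int l) [:- t0, 1:] = of_int_poly [:- k, l:]" using l by simp
  finally have "(of_int_poly (smult (l * n) p) :: rat poly) = of_int_poly ([:- k, l:] * R')"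
    by (simp only: n(2) of_int_poly_hom.hom_mult)
  hence eq: "smult (l * n) p = [:- k, l:] * R'" by (simp only: of_int_poly_hom.eq_iff)
  have "content [:- k, l:] = 1" using l by (simp add: content_def)
  hence "content R' = content (smult (l * n) p)" unfolding eq by (simp only: content_mult mult_1)
  hence "[:l * n:] dvd R'" by (simp add: const_poly_dvd_iff_dvd_content)
  then obtain S where "R' = smult (l * n) S" by (auto elim!: dvdE)
  hence "smult (l * n) p = smult (l * n) ([:- k, l:] * S)" using eq by (simp only: mult_smult_right)
  moreover have "l * n \<noteq> 0" using l n by simp
  ultimately have "p = [:- k, l:] * S" by (metis smult_cancel)
  thus ?thesis by (metis dvd_triv_left)
qed

lemma coprime_int_poly_no_common_root:
  fixes p q :: "int poly" and t0 :: rat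
  assumes "coprime p q" "poly (of_int_poly q) t0 = 0"
  shows "poly (of_int_poly p) t0 \<noteq> 0"
proof
  assume p: "poly (of_int_poly p) t0 = 0"
  obtain k l where kl: "quotient_of t0 = (k, l)" by force
  have "[:- k, l:] dvd 1"
    using linear_dvd_int_poly[OF p kl] linear_dvd_int_poly[OF assms(2) kl] assms(1)
    by (rule coprime_common_divisor[rotated])
  moreover have "l > 0" using kl quotient_of_denom_pos by auto
  ultimately show False by (simp add: is_unit_poly_iff)
qed

text \<open>The arithmetic is confined to \<open>halve\<close>. There the equation for
  \<open>dup_num\<close> says that the point with abscissa \<open>p' / q^2\<close> doubles to the
  given one, both having the denominator \<open>q^2\<close>, and
  \<open>poly p' t0 \<noteq> 0\<close> says that the pole persists. The descent is on a bound
  \<open>n\<close> for the degrees in any fraction, reduced or not, that represents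
  \<open>X / g\<close>.\<close>

lemma no_pole_if_halvable:
  fixes a b c :: int and g :: "int poly" and t0 :: rat
  defines "A \<equiv> [:a:] * g" and "B \<equiv> [:b:] * g ^ 2" and "C \<equiv> [:c:] * g ^ 3"
  assumes disc: "cubic_disc a b c \<noteq> 0" and g0: "g \<noteq> 0"
    and halve: "\<And>p q y. coprime p q \<Longrightarrow> q \<noteq> 0 \<Longrightarrow>
       y ^ 2 = p ^ 3 + A * p ^ 2 * q ^ 2 + B * p * q ^ 4 + C * q ^ 6 \<Longrightarrow>
       poly (of_int_poly q) t0 = 0 \<Longrightarrow> poly (of_int_poly p) t0 \<noteq> 0 \<Longrightarrow>
       \<exists>p' y' :: rat poly. poly p' t0 \<noteq> 0
         \<and> y' ^ 2 = p' ^ 3 + of_int_poly A * p' ^ 2 * of_int_poly q ^ 2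
             + of_int_poly B * p' * of_int_poly q ^ 4 + of_int_poly C * of_int_poly q ^ 6
         \<and> dup_num (of_int_poly A) (of_int_poly B) (of_int_poly C) p' (of_int_poly q ^ 2) = 4 * of_int_poly p * y' ^ 2"
    and curve: "Y ^ 2 = X ^ 3 + rf_of_intpoly A * X ^ 2 + rf_of_intpoly B * X + rf_of_intpoly C"
  shows "rf_regular t0 X"
proof -
  define G where "G = rf_of_intpoly g"
  have G0: "G \<noteq> 0" using g0 by (simp add: G_def)
  have step: "rf_regular t0 X"
    if "Y ^ 2 = X ^ 3 + rf_of_intpoly A * X ^ 2 + rf_of_intpoly B * X + rf_of_intpoly C"
      "X = G * (to_fract u / to_fract v)" "v \<noteq> 0" "degree u \<le> n" "degree v \<le> n" for X Y u v n
    using that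
  proof (induction n arbitrary: X Y u v rule: less_induct)
    case (less n)
    note curve = less.prems(1)
    obtain p q y where pqy: "coprime p q" "q \<noteq> 0"
      "X = rf_of_intpoly p / rf_of_intpoly q ^ 2" "Y = rf_of_intpoly y / rf_of_intpoly q ^ 3"
      "y ^ 2 = p ^ 3 + A * p ^ 2 * q ^ 2 + B * p * q ^ 4 + C * q ^ 6"
      by (rule curve_point_as_int_polys[OF curve])
    define Q where "Q = (of_int_poly q :: rat poly)"
    define P where "P = (of_int_poly p :: rat poly)"
    have Q0: "Q \<noteq> 0" using pqy(2) by (simp add: Q_def)
    have XPQ: "X = to_fract P / to_fract (Q ^ 2)"
      by (simp add: pqy(3) rf_of_intpoly_def P_def Q_def power2_eq_square)
    show ?case
    proof (rule ccontr)
      assume irr: "\<not> rf_regular t0 X"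
      have q_t0: "poly Q t0 = 0"
        using rf_regular_divideI(1)[of "Q ^ 2" t0 P] irr XPQ by auto
      have p_t0: "poly P t0 \<noteq> 0"
        unfolding P_def by (rule coprime_int_poly_no_common_root[OF pqy(1)]) (use q_t0 in \<open>simp add: Q_def\<close>)
      obtain p' y' :: "rat poly" where py': "poly p' t0 \<noteq> 0"
        "y' ^ 2 = p' ^ 3 + of_int_poly A * p' ^ 2 * Q ^ 2 + of_int_poly B * p' * Q ^ 4 + of_int_poly C * Q ^ 6"
        "dup_num (of_int_poly A) (of_int_poly B) (of_int_poly C) p' (Q ^ 2) = 4 * P * y' ^ 2"
        using halve[OF pqy(1,2,5)] q_t0 p_t0 unfolding P_def Q_def by blast
      define F where "F = to_fract Q"
      have F0: "F \<noteq> 0" using Q0 by (simp add: F_def)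
      define X' where "X' = to_fract p' / F ^ 2"
      define Y' where "Y' = to_fract y' / F ^ 3"
      have tf_pow: "to_fract x ^ k = to_fract (x ^ k)" for x :: "rat poly" and k
        by (induction k) simp_all
      have p'X: "to_fract p' = F ^ 2 * X'" and y'Y: "to_fract y' = F ^ 3 * Y'"
        using F0 by (simp_all add: X'_def Y'_def)
      have "to_fract (y' ^ 2) = to_fract (p' ^ 3 + of_int_poly A * p' ^ 2 * Q ^ 2 + of_int_poly B * p' * Q ^ 4 + of_int_poly C * Q ^ 6)"
        by (simp only: py'(2))
      hence "to_fract y' ^ 2 = to_fract p' ^ 3 + rf_of_intpoly A * to_fract p' ^ 2 * F ^ 2
            + rf_of_intpoly B * to_fract p' * F ^ 4 + rf_of_intpoly C * F ^ 6"
        by (simp only: to_fract_add to_fract_mult tf_pow F_def rf_of_intpoly_def)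
      hence "F ^ 6 * Y' ^ 2 = F ^ 6 * (X' ^ 3 + rf_of_intpoly A * X' ^ 2 + rf_of_intpoly B * X' + rf_of_intpoly C)"
        unfolding p'X y'Y by (simp add: algebra_simps eval_nat_numeral)
      hence curve': "Y' ^ 2 = X' ^ 3 + rf_of_intpoly A * X' ^ 2 + rf_of_intpoly B * X' + rf_of_intpoly C"
        using F0 by (simp only: mult_cancel_left) simp
      have four: "(4 :: ratfun) = to_fract 4"
      proof -
        have "(4 :: rat poly) = 1 + 1 + 1 + 1" by simp
        thus ?thesis by (simp only: to_fract_add to_fract_1)
      qed
      have F6: "(F ^ 3) ^ 2 = F ^ 6" by (simp flip: power_mult)
      have dn: "F ^ 8 * dup_num (rf_of_intpoly A) (rf_of_intpoly B) (rf_of_intpoly C) X' 1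
                = 4 * (F ^ 2 * X) * (F ^ 6 * Y' ^ 2)"
      proof -
        have "F ^ 8 * dup_num (rf_of_intpoly A) (rf_of_intpoly B) (rf_of_intpoly C) X' 1
           = dup_num (rf_of_intpoly A) (rf_of_intpoly B) (rf_of_intpoly C) (F ^ 2 * X') (F ^ 2 * 1)"
          unfolding dup_homogeneous(1) by (simp flip: power_mult)
        also have "\<dots> = to_fract (dup_num (of_int_poly A) (of_int_poly B) (of_int_poly C) p' (Q ^ 2))"
          unfolding p'X[symmetric] dup_to_fract(1)[symmetric] by (simp add: rf_of_intpoly_def F_def tf_pow)
        also have "\<dots> = 4 * to_fract P * (F ^ 6 * Y' ^ 2)"
          unfolding py'(3) by (simp only: to_fract_mult four tf_pow[symmetric] y'Y power_mult_distrib F6)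
        also have "to_fract P = F ^ 2 * X"
          using F0 by (simp add: XPQ F_def tf_pow)
        finally show ?thesis .
      qed
      have "dup_num (rf_of_intpoly A) (rf_of_intpoly B) (rf_of_intpoly C) X' 1 = 4 * X * Y' ^ 2"
      proof -
        have "F ^ 8 * dup_num (rf_of_intpoly A) (rf_of_intpoly B) (rf_of_intpoly C) X' 1 = F ^ 8 * (4 * X * Y' ^ 2)"
          unfolding dn by (simp add: eval_nat_numeral mult_ac)
        thus ?thesis using F0 by (simp only: mult_cancel_left) simp
      qed
      also have "\<dots> = X * dup_den (rf_of_intpoly A) (rf_of_intpoly B) (rf_of_intpoly C) X' 1"
        unfolding curve' dup_den_def by simp
      finally have dup: "dup_num (rf_of_intpoly A) (rf_of_intpoly B) (rf_of_intpoly C) X' 1 = \<dots>" .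
      define a' b' c' :: "rat poly" where "a' = of_int_poly [:a:]" and "b' = of_int_poly [:b:]" and "c' = of_int_poly [:c:]"
      have ABC: "rf_of_intpoly A = to_fract a' * G" "rf_of_intpoly B = to_fract b' * G ^ 2" "rf_of_intpoly C = to_fract c' * G ^ 3"
        unfolding A_def B_def C_def a'_def b'_def c'_def G_def
        by (simp_all only: rf_of_intpoly_hom rf_of_intpoly_power) (simp_all only: rf_of_intpoly_def)
      have const: "degree a' = 0" "degree b' = 0" "degree c' = 0" by (simp_all add: a'_def b'_def c'_def)
      have "poly (cubic_disc a' b' c') 0 = of_int (cubic_disc a b c)"
        unfolding cubic_disc_def a'_def b'_def c'_def by simp
      hence disc': "cubic_disc a' b' c' \<noteq> 0" using disc by auto
      obtain u' v' where uv': "X' = G * (to_fract u' / to_fract v')" "v' \<noteq> 0"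
        "4 * degree u' \<le> n" "4 * degree v' \<le> n"
        using halving_degree_drop[OF const disc' G0 less.prems(2-5) dup[unfolded ABC]] by blast
      \<comment> \<open>A constant \<open>X / g\<close> makes \<open>X\<close> regular. So
        \<open>n div 4\<close> is smaller than \<open>n\<close>.\<close>
      have n0: "n > 0"
      proof (rule ccontr)
        assume "\<not> n > 0"
        hence "degree v = 0" "degree u = 0" using less.prems by simp_all
        then obtain v0 u0 where "v = [:v0:]" "u = [:u0:]" by (metis degree_eq_zeroE)
        hence "poly v t0 \<noteq> 0" using less.prems(3) by simp
        hence "rf_regular t0 X"
          unfolding less.prems(2) G_def rf_of_intpoly_def by (intro rf_mult(1) rf_to_fract rf_regular_divideI(1))
        thus False using irr by simp
      qed
      \<comment> \<open>A regular \<open>X'\<close> would make the numerator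
        \<open>p' = q^2 X'\<close> vanish at \<open>t0\<close>.\<close>
      have "rf_regular t0 X'"
        by (rule less.IH[OF _ curve' uv'(1,2), of "n div 4"]) (use uv' n0 in auto)
      hence "rf_eval t0 (F ^ 2 * X') = 0"
        by (simp add: rf_hom F_def q_t0)
      thus False using py'(1) by (simp flip: p'X)
    qed
  qed
  define r where "r = X / G"
  have "X = G * (to_fract (fst (quot_of_fract r)) / to_fract (snd (quot_of_fract r)))"
    unfolding Fract_conv_to_fract[symmetric] using G0 by (simp add: r_def)
  from step[OF curve this, of "max (degree (fst (quot_of_fract r))) (degree (snd (quot_of_fract r)))"]
  show ?thesis by simp
qed

subsection \<open>Halving over the rationals, the case of a rational two-torsion point\<close>
lemma squarefree_dvd_if_prime_divisors_dvd:
  fixes s n :: "'a :: factorial_semiring"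
  assumes "squarefree s" "\<And>p. prime p \<Longrightarrow> p dvd s \<Longrightarrow> p dvd n"
  shows "s dvd n"
proof (cases "n = 0")
  case False
  have s0: "s \<noteq> 0" using assms(1) by auto
  show ?thesis unfolding prime_multiplicity_le_imp_dvd[OF s0 False]
  proof (intro allI impI)
    fix p :: 'a assume p: "prime p"
    show "multiplicity p s \<le> multiplicity p n"
    proof (cases "p dvd s")
      case True
      have "multiplicity p s \<le> 1"
        using assms(1) s0 p squarefree_factorial_semiring''[of s] by simp
      moreover have "multiplicity p n \<ge> 1"
        using assms(2)[OF p True] False p by (simp add: Suc_le_eq prime_multiplicity_gt_zero_iff)
      ultimately show ?thesis by simp
    qed (simp add: not_dvd_imp_multiplicity_0)
  qed
qed simp

lemma prime_dvd_squarefree_part_imp_odd: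
  assumes "prime p" "p dvd squarefree_part n"
  shows "odd (multiplicity p n)"
proof -
  have "multiplicity p (squarefree_part n) > 0"
    using assms by (simp add: prime_multiplicity_gt_zero_iff)
  thus ?thesis using assms(1) by (simp add: prime_multiplicity_squarefree_part odd_iff_mod_2_eq_one)
qed

text \<open>A prime that divides only one of the factors, and not \<open>N\<close>, takes its whole
  multiplicity from the fourth power.\<close>

lemma even_multiplicity_cofactor:
  fixes n n' N x :: "'a :: factorial_semiring"
  assumes p: "prime p" and eq: "n * n' = N * x ^ 4" and N: "\<not> p dvd N"
    and nz: "n \<noteq> 0" "n' \<noteq> 0" and ndvd: "\<not> (p dvd n \<and> p dvd n')"
  shows "even (multiplicity p n)"
proof (cases "p dvd n")
  case True
  hence n': "multiplicity p n' = 0" using ndvd by (simp add: not_dvd_imp_multiplicity_0)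
  have N0: "N \<noteq> 0" using N by auto
  have x0: "x \<noteq> 0" using eq nz by auto
  have "multiplicity p (n * n') = multiplicity p (N * x ^ 4)" by (simp only: eq)
  hence "multiplicity p n = 4 * multiplicity p x"
    using p nz N0 x0 n' N
    by (simp add: prime_elem_multiplicity_mult_distrib prime_elem_multiplicity_power_distrib not_dvd_imp_multiplicity_0)
  thus ?thesis by simp
qed (simp add: not_dvd_imp_multiplicity_0)

lemma rat_sqrt_of_int:
  assumes "(r :: rat) ^ 2 = of_int n"
  obtains m where "r = of_int m" "m ^ 2 = n"
proof -
  obtain k l where kl: "quotient_of r = (k, l)" by force
  hence l: "l > 0" "r = of_int k / of_int l" "coprime k l"
    using quotient_of_denom_pos quotient_of_div quotient_of_coprime by auto
  have "of_int (k ^ 2) = (of_int (n * l ^ 2) :: rat)"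
    using assms l by (simp add: power_divide field_simps)
  hence "k ^ 2 = n * l ^ 2" by (simp only: of_int_eq_iff)
  hence "l dvd k ^ 2" by (simp add: power2_eq_square)
  hence "is_unit l" using l(3)
    by (metis coprime_absorb_right coprime_commute coprime_power_left_iff pos2)
  hence "l = 1" using l(1) by simp
  hence "r = of_int k" using l by simp
  moreover have "k ^ 2 = n" using \<open>k ^ 2 = n * l ^ 2\<close> \<open>l = 1\<close> by simp
  ultimately show thesis using that by blast
qed

lemma squarefree_int_rat_square:
  assumes "squarefree (n :: int)" "is_rat_square (of_int n)"
  shows "n = 1"
proof -
  obtain r :: rat where "r ^ 2 = of_int n" using assms(2) by (auto simp: is_rat_square_def)
  then obtain m where m: "m ^ 2 = n" by (rule rat_sqrt_of_int)
  hence "m dvd 1" using assms(1) squarefreeD[of n m] by simp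
  hence "m = 1 \<or> m = -1" by auto
  thus ?thesis using m by auto
qed

lemma squarefree_const_poly:
  assumes "squarefree [:n :: int:]"
  shows "squarefree n"
proof (rule squarefreeI)
  fix x assume "x ^ 2 dvd n"
  hence "[:x:] ^ 2 dvd [:n:]" by (simp add: power2_eq_square)
  hence "[:x:] dvd 1" using assms by (rule squarefreeD[rotated])
  thus "x dvd 1" by (simp add: is_unit_const_poly_iff)
qed

text \<open>A constant squarefree part is a squarefree integer, and the only one that is a rational
  square is 1. So it disappears, sign included.\<close>

lemma constant_squarefree_part_square:
  fixes m :: "int poly"
  assumes "degree (squarefree_part m) = 0"
    and "is_rat_square (poly (of_int_poly (squarefree_part m)) t0)"
  shows "m = square_part m ^ 2"
proof -
  obtain n where n: "squarefree_part m = [:n:]" using assms(1) by (rule degree_eq_zeroE)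
  have "poly (of_int_poly [:n:]) t0 = of_int n" by (simp add: hom_distribs)
  have "squarefree n" using squarefree_squarefree_part[of m] unfolding n by (rule squarefree_const_poly)
  moreover have "is_rat_square (of_int n)" using assms(2) unfolding n by (simp add: hom_distribs)
  ultimately have "n = 1" by (rule squarefree_int_rat_square)
  hence "squarefree_part m = 1" using n by (simp add: one_pCons)
  thus ?thesis using squarefree_decompose[of m] by simp
qed

lemma prime_two_int_poly: "prime ([:2:] :: int poly)"
proof (rule primeI)
  show "prime_elem ([:2:] :: int poly)" by (rule lift_prime_elem_poly) simp
  show "normalize [:2 :: int:] = [:2:]" by (simp add: normalize_const_poly)
qed

text \<open>If \<open>\<theta>\<close>, \<open>\<theta>'\<close> are the roots of \<open>x\<^sup>2 + a x + b\<close>, then \<open>w\<^sup>2 = (k\<^sup>2 - \<theta> g q\<^sup>2) (k\<^sup>2 - \<theta>' g q\<^sup>2)\<close>, and \<open>m\<close> is the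
  square of the sum of the square roots of the two factors. So over \<open>\<rat>(\<theta>)\<close> it has their square class.\<close>

lemma prime_divisor_of_trace_square_class:
  fixes a b e d :: int and g k q w p :: "int poly"
  defines "A \<equiv> [:a:] * g" and "B \<equiv> [:b:] * g ^ 2"
  defines "m \<equiv> 2 * w + 2 * k ^ 2 + A * q ^ 2" and "m' \<equiv> - 2 * w + 2 * k ^ 2 + A * q ^ 2"
  assumes w: "w ^ 2 = k ^ 4 + A * k ^ 2 * q ^ 2 + B * q ^ 4"
    and cop: "coprime k q" and disc: "a ^ 2 - 4 * b = e ^ 2 * d"
    and nz: "m \<noteq> 0" "m' \<noteq> 0"
    and p: "prime p" and odd: "odd (multiplicity p m)"
  shows "p dvd smult e g \<or> p dvd [:if d mod 4 = 1 then d else 2 * d:]"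
proof (rule ccontr)
  assume "\<not> ?thesis"
  hence eg: "\<not> p dvd [:e:] * g" and D0: "\<not> p dvd [:if d mod 4 = 1 then d else 2 * d:]" by simp_all
  have e: "\<not> p dvd [:e:]" and g: "\<not> p dvd g" using eg by (auto simp del: mult_pCons_left mult_pCons_right)
  have d: "\<not> p dvd [:d:]"
  proof
    assume "p dvd [:d:]"
    moreover have "[:d:] dvd [:if d mod 4 = 1 then d else 2 * d:]" by simp
    ultimately show False using D0 dvd_trans by blast
  qed
  have pe: "prime_elem p" using p by simp
  \<comment> \<open>\<open>N\<close> is the discriminant of the quadratic factor of the twisted
    cubic, which gives \<open>m * m' = N * q ^ 4\<close>.\<close>
  define N where "N = [:e:] ^ 2 * [:d:] * g ^ 2"
  have N: "\<not> p dvd N" unfolding N_def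
    using e d g pe by (auto simp: prime_elem_dvd_mult_iff prime_elem_dvd_power_iff simp del: mult_pCons_left mult_pCons_right)
  have AB: "A ^ 2 - 4 * B = N"
  proof -
    have "[:a:] ^ 2 - 4 * [:b:] = [:e:] ^ 2 * [:d:]"
    proof -
      have "[:a ^ 2 - 4 * b:] = [:e ^ 2 * d:]" by (simp only: disc)
      thus ?thesis by (simp add: power2_eq_square numeral_poly mult_ac)
    qed
    hence "([:a:] ^ 2 - 4 * [:b:]) * g ^ 2 = [:e:] ^ 2 * [:d:] * g ^ 2" by (simp only:)
    thus ?thesis unfolding A_def B_def N_def
      by (simp only: power_mult_distrib left_diff_distrib mult.assoc)
  qed
  have mm': "m * m' = N * q ^ 4"
  proof -
    have "m * m' = (2 * k ^ 2 + A * q ^ 2) ^ 2 - 4 * w ^ 2"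
      unfolding m_def m'_def by (simp add: algebra_simps power2_eq_square)
    also have "\<dots> = (A ^ 2 - 4 * B) * q ^ 4"
      unfolding w by (simp add: algebra_simps eval_nat_numeral)
    finally show ?thesis unfolding AB .
  qed
  have pk: "\<not> p dvd k" if "p dvd q" using cop that p by (meson coprime_common_divisor not_prime_unit)
  have pm: "p dvd m" using odd by (metis even_zero not_dvd_imp_multiplicity_0)
  show False
  proof (cases "p dvd [:2:]")
    case False
    \<comment> \<open>A common prime would divide \<open>q\<close> and, being different from 2, also
      \<open>k\<close>, because \<open>m + m'\<close> is \<open>4 k^2\<close> modulo
      \<open>q\<close>.\<close>
    have "\<not> (p dvd m \<and> p dvd m')"
    proof
      assume *: "p dvd m \<and> p dvd m'"
      hence "p dvd N * q ^ 4" unfolding mm'[symmetric] by simp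
      hence pq: "p dvd q" using N pe by (meson prime_elem_dvd_mult_iff prime_elem_dvd_power)
      have "p dvd m + m'" using * by simp
      also have "m + m' = [:2:] * [:2:] * k ^ 2 + (2 * A * q) * q"
        unfolding m_def m'_def by (simp add: algebra_simps eval_nat_numeral numeral_poly)
      finally have "p dvd [:2:] * [:2:] * k ^ 2" using pq by (simp only: dvd_add_left_iff dvd_mult)
      thus False using False pk[OF pq] pe
        by (auto simp: prime_elem_dvd_mult_iff prime_elem_dvd_power_iff simp del: mult_pCons_left mult_pCons_right)
    qed
    from even_multiplicity_cofactor[OF p mm' N nz this] odd show False by simp
  next
    case True
    hence p2: "p = [:2:]" using primes_dvd_imp_eq[OF p prime_two_int_poly] by simp
    have two: "[:2 :: int:] = 2" by (simp add: numeral_poly)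
    \<comment> \<open>If not, 2 would divide the excluded constant \<open>2 * d\<close>. Now
      \<open>d\<close>, \<open>e\<close> and hence \<open>a\<close> are odd, which forces
      \<open>q\<close> to be even.\<close>
    have d1: "d mod 4 = 1"
    proof (rule ccontr)
      assume "d mod 4 \<noteq> 1"
      thus False using D0 p2 by simp
    qed
    have "odd d" using d1 by presburger
    moreover have "odd e" using e p2 by auto
    ultimately have "odd (a ^ 2 - 4 * b)" unfolding disc by simp
    hence "odd a" by simp
    hence pa: "\<not> p dvd [:a:]" unfolding p2 by simp
    have "A * q ^ 2 = m - p * (w + k ^ 2)" unfolding m_def p2 two by (simp add: algebra_simps)
    hence "p dvd A * q ^ 2" using pm by simp
    hence pq: "p dvd q" unfolding A_def using pa g pe
      by (auto simp: prime_elem_dvd_mult_iff prime_elem_dvd_power_iff simp del: mult_pCons_left mult_pCons_right)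
    then obtain q' where q': "q = p * q'" by (rule dvdE)
    note pk = pk[OF pq]
    have "(w + k ^ 2) * (w - k ^ 2) = p * (p * (A * k ^ 2 * q' ^ 2 + p ^ 2 * B * q' ^ 4))"
    proof -
      have "(w + k ^ 2) * (w - k ^ 2) = w ^ 2 - k ^ 4" by (simp add: algebra_simps eval_nat_numeral)
      thus ?thesis unfolding w q' by (simp add: algebra_simps eval_nat_numeral)
    qed
    hence "p dvd (w + k ^ 2) * (w - k ^ 2)" by (metis dvd_triv_left)
    hence "p dvd w + k ^ 2 \<or> p dvd w - k ^ 2" using pe by (simp add: prime_elem_dvd_mult_iff)
    moreover have "w + k ^ 2 = (w - k ^ 2) + p * k ^ 2" unfolding p2 two by simp
    ultimately have "p dvd w + k ^ 2" by (metis dvd_add dvd_triv_left)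
    then obtain n1 where n1: "w + k ^ 2 = p * n1" by (rule dvdE)
    have "k ^ 2 - w = p * (k ^ 2 - n1)"
    proof -
      have "k ^ 2 - w = p * k ^ 2 - (w + k ^ 2)" unfolding p2 two by simp
      thus ?thesis unfolding n1 by (simp only: right_diff_distrib)
    qed
    note n1' = this
    \<comment> \<open>Both \<open>m\<close> and \<open>m'\<close> are divisible by 4. For the
      quotients the relation becomes \<open>n * n' = N * q' ^ 4\<close>, and \<open>n + n'\<close>
      is \<open>k ^ 2\<close> modulo 2, so the argument for the other primes applies again.\<close>
    define n where "n = n1 + A * q' ^ 2"
    define n' where "n' = (k ^ 2 - n1) + A * q' ^ 2"
    have mn: "m = p ^ 2 * n" 
    proof -
      have "m = p * (w + k ^ 2) + A * q ^ 2" unfolding m_def p2 two by (simp add: algebra_simps)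
      thus ?thesis unfolding n1 n_def q' by (simp add: algebra_simps power2_eq_square)
    qed
    have mn': "m' = p ^ 2 * n'" 
    proof -
      have "m' = p * (k ^ 2 - w) + A * q ^ 2" unfolding m'_def p2 two by (simp add: algebra_simps)
      thus ?thesis unfolding n1' n'_def q' by (simp add: algebra_simps power2_eq_square)
    qed
    have p0: "p \<noteq> 0" using p by auto
    have "p ^ 4 * (n * n') = p ^ 4 * (N * q' ^ 4)"
      using mm' unfolding mn mn' q' by (simp add: eval_nat_numeral mult_ac)
    hence nn': "n * n' = N * q' ^ 4" using p0 by (simp only: mult_cancel_left) simp
    have nz': "n \<noteq> 0" "n' \<noteq> 0" using nz mn mn' by auto
    have "\<not> (p dvd n \<and> p dvd n')"
    proof
      assume *: "p dvd n \<and> p dvd n'"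
      hence "p dvd n + n'" by simp
      also have "n + n' = k ^ 2 + p * (A * q' ^ 2)"
        unfolding n_def n'_def p2 two by (simp add: algebra_simps)
      finally have "p dvd k ^ 2" by (simp add: dvd_add_left_iff)
      thus False using pk pe by (meson prime_elem_dvd_power)
    qed
    from even_multiplicity_cofactor[OF p nn' N nz' this]
    have "even (multiplicity p m)" unfolding mn using p0 nz' pe
      by (simp add: prime_elem_multiplicity_mult_distrib prime_elem_multiplicity_power_distrib)
    thus False using odd by simp
  qed
qed

text \<open>The roots of the cubic are 0 and two conjugates. Here \<open>k\<close> is a square root
  of the numerator, \<open>w\<close> is the product and \<open>v\<close> the sum of the other two
  square roots, so that \<open>k ^ 2 + k * v + w\<close> is the numerator of the half point.\<close>

lemma halvable_of_cond_A:
  fixes a b e d D :: int and g p q y :: "int poly" and t0 :: rat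
  defines "A \<equiv> [:a:] * g" and "B \<equiv> [:b:] * g ^ 2"
  assumes A1: "cond_A1 b g t0" and A2: "cond_A2 e D g t0"
    and disc: "a ^ 2 - 4 * b = e ^ 2 * d" "e ^ 2 * d \<noteq> 0" and g0: "g \<noteq> 0"
    and D: "(if d mod 4 = 1 then d else 2 * d) dvd D"
    and cop: "coprime p q" and q0: "q \<noteq> 0"
    and y: "y ^ 2 = p ^ 3 + A * p ^ 2 * q ^ 2 + B * p * q ^ 4"
    and qt: "poly (of_int_poly q) t0 = 0" and pt: "poly (of_int_poly p) t0 \<noteq> 0"
  shows "\<exists>k v w. p = k ^ 2 \<and> w ^ 2 = k ^ 4 + A * k ^ 2 * q ^ 2 + B * q ^ 4 \<and> v ^ 2 = 2 * w + 2 * k ^ 2 + A * q ^ 2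
     \<and> poly (of_int_poly (k ^ 2 + k * v + w)) t0 \<noteq> 0"
proof -
  define ev where "ev = (\<lambda>x :: int poly. poly (of_int_poly x) t0)"
  have ev [simp]: "ev (x + z) = ev x + ev z" "ev (x - z) = ev x - ev z" "ev (x * z) = ev x * ev z"
     "ev (- x) = - ev x" "ev (x ^ n) = ev x ^ n" for x z n
    by (simp_all add: ev_def hom_distribs)
  have ev2 [simp]: "ev 2 = 2" by (simp add: ev_def hom_distribs)
  have qt: "ev q = 0" and pt: "ev p \<noteq> 0" using qt pt by (simp_all add: ev_def)
  have ev_sqf: "is_rat_square (ev (squarefree_part x))" if "ev x = r ^ 2" "ev x \<noteq> 0" for x r
  proof -
    have "ev x = ev (squarefree_part x) * ev (square_part x) ^ 2"
      using arg_cong[OF squarefree_decompose[of x], of ev] by simp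
    hence "(r / ev (square_part x)) ^ 2 = ev (squarefree_part x)"
      using that by (simp add: power_divide)
    thus ?thesis unfolding is_rat_square_def by blast
  qed
  have "ev (y ^ 2) = ev p ^ 3" unfolding y by (simp add: qt)
  hence evy: "ev y ^ 2 = ev p ^ 3" by simp
  have y0: "y \<noteq> 0" using evy pt by (auto simp: ev_def)
  have p0: "p \<noteq> 0" using pt by (auto simp: ev_def)
  define W where "W = p ^ 2 + A * p * q ^ 2 + B * q ^ 4"
  have yW: "y ^ 2 = p * W" unfolding y W_def by (simp add: algebra_simps eval_nat_numeral)
  have W0: "W \<noteq> 0" using yW y0 by auto

  \<comment> \<open>A prime of odd multiplicity in \<open>p\<close> also has odd multiplicity in
    \<open>W\<close>, because \<open>p * W\<close> is a square, and \<open>W\<close> is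
    \<open>B q^4\<close> modulo \<open>p\<close>.\<close>
  have "squarefree_part p dvd smult b g"
  proof (rule squarefree_dvd_if_prime_divisors_dvd)
    fix r :: "int poly" assume r: "prime r" "r dvd squarefree_part p"
    have pe: "prime_elem r" using r by simp
    have odd: "odd (multiplicity r p)" by (rule prime_dvd_squarefree_part_imp_odd[OF r])
    have rp: "r dvd p" using odd by (metis even_zero not_dvd_imp_multiplicity_0)
    hence rq: "\<not> r dvd q" using cop r(1) by (meson coprime_common_divisor not_prime_unit)
    have "multiplicity r (y ^ 2) = multiplicity r p + multiplicity r W"
      unfolding yW using pe p0 W0 by (simp add: prime_elem_multiplicity_mult_distrib)
    moreover have "multiplicity r (y ^ 2) = 2 * multiplicity r y"
      using pe y0 by (simp add: prime_elem_multiplicity_power_distrib)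
    ultimately have "odd (multiplicity r W)" using odd by presburger
    hence "r dvd W" by (metis even_zero not_dvd_imp_multiplicity_0)
    moreover have "W = p * (p + A * q ^ 2) + B * q ^ 4" unfolding W_def by (simp add: algebra_simps power2_eq_square)
    ultimately have "r dvd B * q ^ 4" using rp by (simp add: dvd_add_right_iff)
    hence "r dvd [:b:] * g" using rq pe unfolding B_def
      by (auto simp: prime_elem_dvd_mult_iff prime_elem_dvd_power_iff simp del: mult_pCons_left mult_pCons_right)
    thus "r dvd smult b g" by simp
  qed simp
  moreover have psq: "ev p = (ev y / ev p) ^ 2"
    using evy pt by (simp add: power_divide power2_eq_square power3_eq_cube)
  hence "is_rat_square (ev (squarefree_part p))" using pt by (rule ev_sqf)
  ultimately have "p = square_part p ^ 2"
    using A1 unfolding cond_A1_def ev_def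
    by (intro constant_squarefree_part_square[where ?t0.0 = t0]) auto
  then obtain k where k: "p = k ^ 2" by blast
  have evk: "ev k \<noteq> 0" using pt k by auto
  have copk: "coprime k q" using cop k by simp

  have "k ^ 2 dvd y ^ 2" unfolding yW k by simp
  hence "k dvd y" by (simp add: pow_divides_pow_iff)
  then obtain w1 where w1: "y = k * w1" by (rule dvdE)
  have "k ^ 2 * w1 ^ 2 = k ^ 2 * W" using yW unfolding w1 k by (simp add: power_mult_distrib)
  hence "w1 ^ 2 = W" using evk by (auto simp: ev_def)
  hence w1W: "w1 ^ 2 = k ^ 4 + A * k ^ 2 * q ^ 2 + B * q ^ 4" unfolding W_def k by (simp flip: power_mult)
  \<comment> \<open>First choice of sign: \<open>w\<close> is to be the product of two square roots
    with equal values at \<open>t0\<close>, which means \<open>k^2\<close> and not its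
    negative.\<close>
  have "ev (w1 ^ 2) = ev (k ^ 4)" unfolding w1W by (simp add: qt)
  hence "ev w1 ^ 2 = (ev k ^ 2) ^ 2" by simp
  hence "ev w1 = ev k ^ 2 \<or> ev w1 = - (ev k ^ 2)" by (simp only: power2_eq_iff)
  then obtain w where w: "w ^ 2 = k ^ 4 + A * k ^ 2 * q ^ 2 + B * q ^ 4" "ev w = ev k ^ 2"
    using w1W that[of w1] that[of "- w1"] by auto

  define m where "m = 2 * w + 2 * k ^ 2 + A * q ^ 2"
  define m' where "m' = - 2 * w + 2 * k ^ 2 + A * q ^ 2"
  have evm: "ev m = (2 * ev k) ^ 2" unfolding m_def by (simp add: qt w power_mult_distrib)
  have m0: "m \<noteq> 0" using evm evk by (auto simp: ev_def)
  have m'0: "m' \<noteq> 0"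
  proof
    assume "m' = 0"
    hence "m * m' = 0" by simp
    also have "m * m' = (2 * k ^ 2 + A * q ^ 2) ^ 2 - 4 * w ^ 2"
      unfolding m_def m'_def by (simp add: algebra_simps power2_eq_square)
    also have "\<dots> = (A ^ 2 - 4 * B) * q ^ 4"
      unfolding w by (simp add: algebra_simps eval_nat_numeral)
    finally have "A ^ 2 - 4 * B = 0" using q0 by simp
    moreover have "A ^ 2 - 4 * B = [:a ^ 2 - 4 * b:] * g ^ 2"
      unfolding A_def B_def by (simp add: algebra_simps power2_eq_square numeral_poly smult_diff_left)
    ultimately show False using disc g0 by simp
  qed
  define s where "s = squarefree_part m"
  have sdvd: "r dvd smult e g \<or> r dvd [:if d mod 4 = 1 then d else 2 * d:]" if "prime r" "r dvd s" for r
    by (rule prime_divisor_of_trace_square_class[OF w(1)[unfolded A_def B_def] copk disc(1)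
         m0[unfolded m_def A_def] m'0[unfolded m'_def A_def] that(1)
         prime_dvd_squarefree_part_imp_odd[OF that[unfolded s_def m_def A_def]]])
  have s_sqf: "squarefree s" by (simp add: s_def)
  have s_sq: "is_rat_square (ev s)" unfolding s_def by (rule ev_sqf[OF evm]) (use evm evk in auto)
  \<comment> \<open>A2 speaks of products \<open>d' * h\<close>. The primes of \<open>s\<close> that
    divide \<open>e g\<close> go into \<open>h\<close>; the cofactor then has only primes of the
    constant \<open>d\<close> or \<open>2 * d\<close>, so it is an integer
    \<open>d'\<close>.\<close>
  define h where "h = gcd s (smult e g)"
  obtain d0 where d0: "s = h * d0" unfolding h_def by (meson gcd_dvd1 dvdE)
  have "squarefree d0" using s_sqf d0 by (metis dvd_triv_right squarefree_mono)
  have "d0 dvd [:if d mod 4 = 1 then d else 2 * d:]"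
  proof (rule squarefree_dvd_if_prime_divisors_dvd[OF \<open>squarefree d0\<close>])
    fix r :: "int poly" assume r: "prime r" "r dvd d0"
    hence rs: "r dvd s" using d0 by simp
    have "\<not> r dvd smult e g"
    proof
      assume "r dvd smult e g"
      hence "r dvd h" unfolding h_def using rs by simp
      hence "r ^ 2 dvd s" unfolding d0 power2_eq_square using r by (intro mult_dvd_mono)
      hence "is_unit r" using s_sqf squarefreeD by blast
      thus False using r by auto
    qed
    thus "r dvd [:if d mod 4 = 1 then d else 2 * d:]" using sdvd[OF r(1) rs] by simp
  qed
  note d0_dvd = this
  have "[:if d mod 4 = 1 then d else 2 * d:] \<noteq> 0" using disc(2) by auto
  from dvd_imp_degree_le[OF d0_dvd this] have "degree d0 = 0" by simp
  then obtain d' where d': "d0 = [:d':]" by (rule degree_eq_zeroE)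
  have d'_dvd: "d' dvd (if d mod 4 = 1 then d else 2 * d)"
    using d0_dvd unfolding d' const_poly_dvd_const_poly_iff .
  have "squarefree d'" using \<open>squarefree d0\<close> unfolding d' by (rule squarefree_const_poly)
  have "ev s = of_int d' * ev h" unfolding d0 d' by (simp add: ev_def hom_distribs)
  hence "is_rat_square (of_int d' * poly (of_int_poly h) t0)" using s_sq by (simp add: ev_def)
  moreover have "h dvd smult e g" by (simp add: h_def)
  moreover have "squarefree h" by (rule squarefree_mono[OF _ s_sqf]) (simp add: h_def)
  moreover have "d' dvd D" using d'_dvd D by (rule dvd_trans)
  ultimately have "degree h = 0"
    using A2[unfolded cond_A2_def, rule_format, of h d'] \<open>squarefree d'\<close> by auto
  hence "degree s = 0" unfolding d0 d' by simp
  hence "m = square_part m ^ 2"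
    using s_sq unfolding s_def ev_def by (rule constant_squarefree_part_square)
  then obtain v1 where v1: "v1 ^ 2 = m" by metis
  \<comment> \<open>Second choice of sign: with the value \<open>2 k\<close> for \<open>v\<close> at
    \<open>t0\<close>, the three terms of the numerator add up to \<open>4 k^2\<close> instead of
    cancelling.\<close>
  have "ev v1 ^ 2 = (2 * ev k) ^ 2" using evm v1 by (metis ev(5))
  hence "ev v1 = 2 * ev k \<or> ev v1 = - (2 * ev k)" by (simp only: power2_eq_iff)
  then obtain v where v: "v ^ 2 = m" "ev v = 2 * ev k"
    using v1 that[of v1] that[of "- v1"] by auto
  have ev_half: "ev (k ^ 2 + k * v + w) = 4 * ev k ^ 2" by (simp add: v w power2_eq_square)
  have "ev (k ^ 2 + k * v + w) \<noteq> 0" unfolding ev_half using evk by simp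
  thus ?thesis using k w(1) v(1) unfolding m_def ev_def by blast
qed

text \<open>Halving with three square roots in the case \<open>k1 = k\<close>,
  \<open>k2 k3 = w\<close>, \<open>k2 + k3 = v\<close>: the ordinate, the product of the pairwise
  sums, becomes \<open>v * p'\<close>. The term \<open>0 * q ^ 6\<close> keeps the shape of the
  general cubic.\<close>

lemma half_point_of_square_roots:
  fixes k v w A B :: "'a :: idom" and q
  assumes w: "w ^ 2 = k ^ 4 + A * k ^ 2 * q ^ 2 + B * q ^ 4" and v: "v ^ 2 = 2 * w + 2 * k ^ 2 + A * q ^ 2"
  defines "p' \<equiv> k ^ 2 + k * v + w"
  shows "(v * p') ^ 2 = p' ^ 3 + A * p' ^ 2 * q ^ 2 + B * p' * q ^ 4 + 0 * q ^ 6"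
    and "dup_num A B 0 p' (q ^ 2) = 4 * k ^ 2 * (v * p') ^ 2"
proof -
  have A: "A * q ^ 2 = v ^ 2 - 2 * w - 2 * k ^ 2" using v by simp
  have "B * q ^ 4 = w ^ 2 - k ^ 4 - k ^ 2 * (A * q ^ 2)" unfolding w by (simp add: algebra_simps)
  also have "\<dots> = w ^ 2 + k ^ 4 + 2 * k ^ 2 * w - k ^ 2 * v ^ 2" unfolding A by (simp add: algebra_simps eval_nat_numeral)
  finally have B: "B * q ^ 4 = w ^ 2 + k ^ 4 + 2 * k ^ 2 * w - k ^ 2 * v ^ 2" .
  have "v ^ 2 * p' = p' ^ 2 + (A * q ^ 2) * p' + B * q ^ 4"
    unfolding A B p'_def by (simp add: algebra_simps eval_nat_numeral)
  hence "p' * (v ^ 2 * p') = p' * (p' ^ 2 + (A * q ^ 2) * p' + B * q ^ 4)" by (simp only:)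
  thus "(v * p') ^ 2 = p' ^ 3 + A * p' ^ 2 * q ^ 2 + B * p' * q ^ 4 + 0 * q ^ 6"
    by (simp add: algebra_simps eval_nat_numeral)
  have "p' ^ 2 - B * q ^ 4 = 2 * k * v * p'"
    unfolding B p'_def by (simp add: algebra_simps eval_nat_numeral)
  hence "(p' ^ 2 - B * q ^ 4) ^ 2 = (2 * k * v * p') ^ 2" by (simp only:)
  thus "dup_num A B 0 p' (q ^ 2) = 4 * k ^ 2 * (v * p') ^ 2"
    unfolding dup_num_def by (simp add: algebra_simps eval_nat_numeral)
qed

subsection \<open>Algebraic integers\<close>
text \<open>Determinant trick: the characteristic polynomial of an integer matrix is monic over
  \<int> and vanishes at every eigenvalue.\<close>

lemma algebraic_integer_eigenvalue:
  fixes A :: "nat \<Rightarrow> nat \<Rightarrow> int" and v :: "nat \<Rightarrow> complex"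
  assumes eq: "\<And>i. i < n \<Longrightarrow> x * v i = (\<Sum>j<n. of_int (A i j) * v j)"
    and nz: "\<exists>i<n. v i \<noteq> 0"
  shows "algebraic_integer x"
proof -
  define M where "M = mat n n (\<lambda>(i, j). A i j)"
  define M' where "M' = (map_mat of_int M :: complex mat)"
  define V where "V = vec n v"
  have M: "M \<in> carrier_mat n n" by (simp add: M_def)
  have M': "M' \<in> carrier_mat n n" by (simp add: M'_def M)
  have "eigenvector M' V x"
    unfolding eigenvector_def
  proof (intro conjI)
    show "V \<in> carrier_vec (dim_row M')" using M' by (simp add: V_def)
    show "V \<noteq> 0\<^sub>v (dim_row M')"
    proof
      assume "V = 0\<^sub>v (dim_row M')"
      hence "vec n v = 0\<^sub>v n" using M' by (simp add: V_def)
      hence "\<forall>i<n. v i = 0" by (metis index_vec index_zero_vec(1))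
      thus False using nz by auto
    qed
    show "M' *\<^sub>v V = x \<cdot>\<^sub>v V"
    proof (rule eq_vecI)
      fix i assume "i < dim_vec (x \<cdot>\<^sub>v V)"
      hence i: "i < n" by (simp add: V_def)
      have "(M' *\<^sub>v V) $ i = (\<Sum>j<n. of_int (A i j) * v j)"
        using i unfolding M'_def M_def V_def
        by (simp add: scalar_prod_def lessThan_atLeast0)
      thus "(M' *\<^sub>v V) $ i = (x \<cdot>\<^sub>v V) $ i" using eq[OF i] i by (simp add: V_def)
    qed (use M' in \<open>simp add: V_def\<close>)
  qed
  hence "eigenvalue M' x" unfolding eigenvalue_def by blast
  hence "poly (char_poly M') x = 0" using eigenvalue_root_char_poly[OF M'] by simp
  moreover have "char_poly M' = of_int_poly (char_poly M)"
    unfolding M'_def by (rule of_int_hom.char_poly_hom[OF M])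
  moreover have "lead_coeff (char_poly M) = 1" using degree_monic_char_poly[OF M] by simp
  ultimately show ?thesis unfolding algebraic_integer_def by metis
qed

definition zspan :: "'i set \<Rightarrow> ('i \<Rightarrow> complex) \<Rightarrow> complex set" where
  "zspan I v = {z. \<exists>c :: 'i \<Rightarrow> int. z = (\<Sum>i\<in>I. of_int (c i) * v i)}"

lemma zspan_zero: "0 \<in> zspan I v"
  unfolding zspan_def by (auto intro: exI[of _ "\<lambda>_. 0"])

lemma zspan_add: "z \<in> zspan I v \<Longrightarrow> w \<in> zspan I v \<Longrightarrow> z + w \<in> zspan I v"
proof -
  assume "z \<in> zspan I v" "w \<in> zspan I v"
  then obtain c d where "z = (\<Sum>i\<in>I. of_int (c i) * v i)" "w = (\<Sum>i\<in>I. of_int (d i) * v i)"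
    unfolding zspan_def by auto
  hence "z + w = (\<Sum>i\<in>I. of_int (c i + d i) * v i)" by (simp add: sum.distrib distrib_right)
  thus ?thesis unfolding zspan_def by (intro CollectI exI)
qed

lemma zspan_scale: "z \<in> zspan I v \<Longrightarrow> of_int k * z \<in> zspan I v"
proof -
  assume "z \<in> zspan I v"
  then obtain c where "z = (\<Sum>i\<in>I. of_int (c i) * v i)" unfolding zspan_def by auto
  hence "of_int k * z = (\<Sum>i\<in>I. of_int (k * c i) * v i)" by (simp add: sum_distrib_left mult.assoc)
  thus ?thesis unfolding zspan_def by (intro CollectI exI)
qed

lemma zspan_sum: "(\<And>j. j \<in> J \<Longrightarrow> f j \<in> zspan I v) \<Longrightarrow> (\<Sum>j\<in>J. of_int (k j) * f j) \<in> zspan I v"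
  by (induction J rule: infinite_finite_induct) (auto intro!: zspan_zero zspan_add zspan_scale)

lemma zspan_gen: "finite I \<Longrightarrow> i \<in> I \<Longrightarrow> v i \<in> zspan I v"
proof -
  assume I: "finite I" "i \<in> I"
  have "(\<Sum>j\<in>I. of_int (if j = i then 1 else 0) * v j) = (\<Sum>j\<in>I. if j = i then v j else 0)"
    by (rule sum.cong) auto
  also have "\<dots> = v i" using I by (simp add: sum.delta)
  finally have "v i = (\<Sum>j\<in>I. of_int (if j = i then 1 else 0) * v j)" by simp
  thus ?thesis unfolding zspan_def by (intro CollectI exI)
qed

lemma zspan_stable:
  assumes "\<And>i. i \<in> I \<Longrightarrow> x * v i \<in> zspan I v" "z \<in> zspan I v"
  shows "x * z \<in> zspan I v"
proof -
  obtain c where "z = (\<Sum>i\<in>I. of_int (c i) * v i)" using assms(2) unfolding zspan_def by auto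
  hence "x * z = (\<Sum>i\<in>I. of_int (c i) * (x * v i))" by (simp add: sum_distrib_left mult_ac)
  also have "\<dots> \<in> zspan I v" by (rule zspan_sum[OF assms(1)])
  finally show ?thesis .
qed

text \<open>Multiplication by \<open>x\<close> on a nonzero finitely generated group that it
  preserves is given by an integer matrix. The index set is arbitrary, so that pairs of exponents
  can serve as indices.\<close>

lemma algebraic_integer_if_stable:
  assumes fin: "finite I" and nz: "\<exists>i\<in>I. v i \<noteq> 0"
    and stable: "\<And>i. i \<in> I \<Longrightarrow> x * v i \<in> zspan I v"
  shows "algebraic_integer x"
proof -
  obtain h where h: "bij_betw h {..<card I} I"
    using ex_bij_betw_nat_finite[OF fin] by (auto simp: lessThan_atLeast0)
  have "\<exists>c. \<forall>i\<in>I. x * v i = (\<Sum>j\<in>I. of_int (c i j) * v j)"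
    using stable unfolding zspan_def by (intro bchoice) auto
  then obtain c :: "'a \<Rightarrow> 'a \<Rightarrow> int" where c: "\<And>i. i \<in> I \<Longrightarrow> x * v i = (\<Sum>j\<in>I. of_int (c i j) * v j)"
    by blast
  show ?thesis
  proof (rule algebraic_integer_eigenvalue[of "card I" x "v \<circ> h" "\<lambda>i j. c (h i) (h j)"])
    fix i assume "i < card I"
    hence "h i \<in> I" using h by (auto simp: bij_betw_def)
    from c[OF this] show "x * (v \<circ> h) i = (\<Sum>j<card I. of_int (c (h i) (h j)) * (v \<circ> h) j)"
      using sum.reindex_bij_betw[OF h, of "\<lambda>j. of_int (c (h i) j) * v j"] by simp
  next
    show "\<exists>i<card I. (v \<circ> h) i \<noteq> 0"
    proof -
      obtain i where i: "i \<in> I" "v i \<noteq> 0" using nz by auto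
      have "i \<in> h ` {..<card I}" using h i(1) by (simp add: bij_betw_def)
      then obtain k where "k < card I" "h k = i" by auto
      thus ?thesis using i by auto
    qed
  qed
qed

lemma algebraic_integerE:
  assumes "algebraic_integer x"
  obtains m and c :: "nat \<Rightarrow> int" where "m > 0" "x ^ m = (\<Sum>k<m. of_int (c k) * x ^ k)"
proof -
  obtain p :: "int poly" where p: "lead_coeff p = 1" "poly (of_int_poly p) x = 0"
    using assms unfolding algebraic_integer_def by auto
  define m where "m = degree p"
  have "m > 0"
  proof (rule ccontr)
    assume "\<not> m > 0"
    hence "degree p = 0" by (simp add: m_def)
    then obtain k where "p = [:k:]" by (rule degree_eq_zeroE)
    thus False using p by (auto simp: hom_distribs)
  qed
  have "0 = (\<Sum>k\<le>m. of_int (coeff p k) * x ^ k)"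
    using p(2) by (simp add: poly_altdef m_def)
  also have "\<dots> = x ^ m + (\<Sum>k<m. of_int (coeff p k) * x ^ k)"
    using p(1) by (simp add: m_def lessThan_Suc_atMost[symmetric])
  finally have "x ^ m = (\<Sum>k<m. of_int (- coeff p k) * x ^ k)"
    by (simp add: sum_negf eq_neg_iff_add_eq_0)
  thus thesis by (rule that[OF \<open>m > 0\<close>])
qed

text \<open>The products \<open>x ^ i * y ^ j\<close> below the degrees of the two monic equations
  span a group stable under both \<open>x\<close> and \<open>y\<close>: when an exponent reaches the
  degree, the monic equation rewrites that power.\<close>

lemma algebraic_integer_add_mult:
  assumes "algebraic_integer x" "algebraic_integer y"
  shows "algebraic_integer (x + y)" "algebraic_integer (x * y)"
proof -
  obtain m c where x: "m > 0" "x ^ m = (\<Sum>k<m. of_int (c k :: int) * x ^ k)"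
    using assms(1) by (rule algebraic_integerE)
  obtain n d where y: "n > 0" "y ^ n = (\<Sum>k<n. of_int (d k :: int) * y ^ k)"
    using assms(2) by (rule algebraic_integerE)
  define I where "I = {..<m} \<times> {..<n}"
  define v where "v = (\<lambda>(i, j). x ^ i * y ^ j)"
  have fin: "finite I" by (simp add: I_def)
  have "(0, 0) \<in> I" "v (0, 0) \<noteq> 0" using x y by (simp_all add: I_def v_def)
  hence nz: "\<exists>i\<in>I. v i \<noteq> 0" by blast
  have X: "x * v i \<in> zspan I v" if iI: "i \<in> I" for i
  proof -
    obtain r s where i: "i = (r, s)" "r < m" "s < n" using iI by (cases i) (auto simp: I_def)
    show ?thesis
    proof (cases "Suc r < m")
      case True
      hence "v (Suc r, s) \<in> zspan I v" using i by (intro zspan_gen[OF fin]) (simp add: I_def)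
      thus ?thesis by (simp add: i v_def mult_ac)
    next
      case False
      hence "Suc r = m" using i by simp
      hence "x * v i = x ^ m * y ^ s" using i by (simp add: v_def mult_ac flip: power_Suc)
      also have "\<dots> = (\<Sum>k<m. of_int (c k) * v (k, s))"
        unfolding x(2) by (simp add: v_def sum_distrib_left mult_ac)
      also have "\<dots> \<in> zspan I v"
        by (intro zspan_sum zspan_gen[OF fin]) (use i in \<open>simp add: I_def\<close>)
      finally show ?thesis .
    qed
  qed
  have Y: "y * v i \<in> zspan I v" if iI: "i \<in> I" for i
  proof -
    obtain r s where i: "i = (r, s)" "r < m" "s < n" using iI by (cases i) (auto simp: I_def)
    show ?thesis
    proof (cases "Suc s < n")
      case True
      hence "v (r, Suc s) \<in> zspan I v" using i by (intro zspan_gen[OF fin]) (simp add: I_def)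
      thus ?thesis by (simp add: i v_def mult_ac)
    next
      case False
      hence "Suc s = n" using i by simp
      hence "y * v i = x ^ r * y ^ n" using i by (auto simp add: v_def mult_ac)
      also have "\<dots> = (\<Sum>k<n. of_int (d k) * v (r, k))"
        unfolding y(2) by (simp add: v_def sum_distrib_left mult_ac)
      also have "\<dots> \<in> zspan I v"
        by (intro zspan_sum zspan_gen[OF fin]) (use i in \<open>simp add: I_def\<close>)
      finally show ?thesis .
    qed
  qed
  show "algebraic_integer (x + y)"
    by (rule algebraic_integer_if_stable[OF fin nz]) (simp add: distrib_right zspan_add X Y)
  show "algebraic_integer (x * y)"
  proof (rule algebraic_integer_if_stable[OF fin nz])
    fix i assume "i \<in> I"
    have "x * (y * v i) \<in> zspan I v" by (rule zspan_stable[OF X Y[OF \<open>i \<in> I\<close>]])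
    thus "x * y * v i \<in> zspan I v" by (simp add: mult.assoc)
  qed
qed

lemma algebraic_integer_of_int [simp]: "algebraic_integer (of_int n)"
  unfolding algebraic_integer_def by (intro exI[of _ "[:- n, 1:]"]) (simp add: hom_distribs)

lemma algebraic_integer_uminus: "algebraic_integer x \<Longrightarrow> algebraic_integer (- x)"
  using algebraic_integer_add_mult(2)[of "of_int (-1)" x] algebraic_integer_of_int[of "-1"] by simp

lemma rational_algebraic_integer:
  assumes "algebraic_integer (of_rat r)"
  obtains n where "r = of_int n"
proof -
  obtain p :: "int poly" where p: "lead_coeff p = 1" "poly (of_int_poly p) (of_rat r :: complex) = 0"
    using assms unfolding algebraic_integer_def by auto
  have "poly (of_int_poly p) (of_rat r) = (of_rat (poly (of_int_poly p) r) :: complex)"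
    by (simp add: poly_altdef of_rat_sum of_rat_mult of_rat_power)
  hence 0: "poly (of_int_poly p) r = 0" using p(2) by simp
  obtain k l where kl: "quotient_of r = (k, l)" by force
  have "algebraic_int r"
    unfolding algebraic_int_altdef_ipoly using p(1) 0 by blast
  moreover have "r \<in> \<rat>" by (auto simp: Rats_def)
  ultimately have "r \<in> \<int>" by (rule rational_algebraic_int_is_int)
  thus thesis using that by (auto elim: Ints_cases)
qed

subsection \<open>Quadratic fields\<close>
lemma subfield_of_rat:
  assumes "subfield_C K"
  shows "of_rat r \<in> K"
proof -
  have K: "0 \<in> K" "1 \<in> K" "\<And>x y. x \<in> K \<Longrightarrow> y \<in> K \<Longrightarrow> x + y \<in> K \<and> x * y \<in> K"
     "\<And>x. x \<in> K \<Longrightarrow> - x \<in> K \<and> inverse x \<in> K"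
    using assms unfolding subfield_C_def by auto
  have nat: "of_nat n \<in> K" for n by (induction n) (auto simp: K)
  have int: "of_int n \<in> K" for n by (cases n) (use nat K in \<open>auto simp del: of_nat_Suc\<close>)
  obtain k l where "quotient_of r = (k, l)" by force
  hence "r = of_int k / of_int l" by (rule quotient_of_div)
  hence "of_rat r = of_int k * inverse (of_int l :: complex)" by (simp add: of_rat_divide flip: divide_inverse)
  thus ?thesis using int K by simp
qed

lemma splitting_field_C_subfield: "subfield_C (splitting_field_C p)"
  unfolding splitting_field_C_def subfield_C_def by auto

lemma splitting_field_C_roots: "poly (of_int_poly p) z = 0 \<Longrightarrow> z \<in> splitting_field_C p"
  unfolding splitting_field_C_def by auto

lemma splitting_field_C_least:
  "subfield_C L \<Longrightarrow> {z. poly (of_int_poly p) z = 0} \<subseteq> L \<Longrightarrow> splitting_field_C p \<subseteq> L"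
  unfolding splitting_field_C_def by auto

lemma nf_hom_of_rat:
  assumes K: "subfield_C K" and s: "nf_hom K s"
  shows "s (of_rat r) = of_rat r"
proof -
  have rK: "of_rat q \<in> K" for q by (rule subfield_of_rat[OF K])
  have s1: "s 1 = 1" and add: "\<And>x y. x \<in> K \<Longrightarrow> y \<in> K \<Longrightarrow> s (x + y) = s x + s y"
    and mult: "\<And>x y. x \<in> K \<Longrightarrow> y \<in> K \<Longrightarrow> s (x * y) = s x * s y"
    using s unfolding nf_hom_def by auto
  have natK: "of_nat n \<in> K" and intK: "of_int k \<in> K" for n k
    using rK[of "of_nat n"] rK[of "of_int k"] by simp_all
  have s0: "s 0 = 0" using add[of 0 0] rK[of 0] by simp
  have nat: "s (of_nat n) = of_nat n" for n
  proof (induction n)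
    case (Suc n)
    thus ?case using add[OF rK[of 1] rK[of "of_nat n"]] s1 by simp
  qed (simp add: s0)
  have int: "s (of_int n) = of_int n" for n
  proof (cases n)
    case (neg m)
    have "s (of_int n + of_nat (Suc m)) = s (of_int n) + s (of_nat (Suc m))"
      by (rule add[OF intK natK])
    moreover have "of_int n + of_nat (Suc m) = (0 :: complex)" by (simp add: neg)
    ultimately have "s (of_int n) + of_nat (Suc m) = 0" using s0 nat[of "Suc m"] by metis
    thus ?thesis by (simp add: neg add_eq_0_iff2)
  qed (simp add: nat)
  obtain k l where kl: "quotient_of r = (k, l)" by force
  hence l: "r = of_int k / of_int l" "l > 0" using quotient_of_div quotient_of_denom_pos by auto
  have rl: "of_rat r * of_int l = (of_int k :: complex)" using l by (simp add: of_rat_divide)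
  have "s (of_rat r) * of_int l = s (of_rat r * of_int l)"
    using mult[OF rK[of r] intK[of l]] int[of l] by simp
  also have "\<dots> = of_rat r * of_int l" by (simp only: rl int)
  finally have "s (of_rat r) * of_int l = of_rat r * of_int l" .
  thus ?thesis using l(2) by simp
qed

text \<open>The square of the denominator of \<open>y\<close> divides \<open>d\<close>.\<close>

lemma squarefree_mult_square_int:
  assumes "squarefree (d :: int)" "of_int d * (y :: rat) ^ 2 = of_int N"
  obtains v where "y = of_int v"
proof -
  obtain k l where kl: "quotient_of y = (k, l)" by force
  hence l: "l > 0" "y = of_int k / of_int l" "coprime k l"
    using quotient_of_denom_pos quotient_of_div quotient_of_coprime by auto
  have "of_int (d * k ^ 2) = (of_int (N * l ^ 2) :: rat)"
    using assms(2) l by (simp add: power_divide field_simps)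
  hence "d * k ^ 2 = N * l ^ 2" by (simp only: of_int_eq_iff)
  hence "l ^ 2 dvd d * k ^ 2" by simp
  moreover have "coprime (l ^ 2) (k ^ 2)" using l(3) by (simp add: coprime_commute)
  ultimately have "l ^ 2 dvd d" by (simp add: coprime_dvd_mult_left_iff)
  hence "l dvd 1" using assms(1) squarefreeD by blast
  hence "l = 1" using l(1) by simp
  thus thesis using that l(2) by simp
qed

text \<open>Coordinates on \<rat>(\<omega>) inside the complex numbers. The aim is
  \<open>disc_dvd\<close>: \<open>nf_disc\<close> speaks of an unspecified integral basis, so
  embeddings, trace and the shape of integers are worked out explicitly.\<close>

locale quadratic_field =
  fixes d :: int and \<omega> :: complex and K :: "complex set"
  assumes sqf: "squarefree d" and \<omega>2: "\<omega> ^ 2 = of_int d"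
    and nonsquare: "\<And>r :: rat. r ^ 2 \<noteq> of_int d"
    and K_def: "K = {of_rat x + of_rat y * \<omega> | x y. True}"
    and sub: "subfield_C K"
begin

lemma \<omega>_nz: "\<omega> \<noteq> 0"
  using \<omega>2 nonsquare[of 0] by auto

lemma \<omega>_irrational: "of_rat x + of_rat y * \<omega> = 0 \<longleftrightarrow> x = 0 \<and> y = 0"
proof
  assume *: "of_rat x + of_rat y * \<omega> = 0"
  have "y = 0"
  proof (rule ccontr)
    assume "y \<noteq> 0"
    define r where "r = - x / y"
    have "\<omega> = of_rat r" using * \<open>y \<noteq> 0\<close>
      by (simp add: r_def of_rat_divide of_rat_minus field_simps add_eq_0_iff2)
    hence "of_rat (r ^ 2) = (of_rat (of_int d) :: complex)" using \<omega>2 by (simp add: of_rat_power)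
    thus False using nonsquare by (simp only: of_rat_eq_iff)
  qed
  thus "x = 0 \<and> y = 0" using * by simp
qed simp

lemma coords_unique:
  assumes "of_rat x + of_rat y * \<omega> = of_rat x' + of_rat y' * \<omega>"
  shows "x = x'" "y = y'"
proof -
  have "of_rat (x - x') + of_rat (y - y') * \<omega> = 0"
    using assms by (simp add: of_rat_diff algebra_simps)
  thus "x = x'" "y = y'" unfolding \<omega>_irrational by simp_all
qed

lemma hom_cases:
  assumes s: "nf_hom K s"
  obtains "\<And>x y. s (of_rat x + of_rat y * \<omega>) = of_rat x + of_rat y * \<omega>"
  | "\<And>x y. s (of_rat x + of_rat y * \<omega>) = of_rat x - of_rat y * \<omega>"
proof -
  have \<omega>K: "\<omega> \<in> K" unfolding K_def by (intro CollectI exI[of _ 0] exI[of _ 1]) simp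
  have rK: "of_rat r \<in> K" for r by (rule subfield_of_rat[OF sub])
  have add: "s (x + y) = s x + s y" and mult: "s (x * y) = s x * s y" if "x \<in> K" "y \<in> K" for x y
    using s that unfolding nf_hom_def by auto
  have mulK: "x * y \<in> K" if "x \<in> K" "y \<in> K" for x y using sub that unfolding subfield_C_def by auto
  have "s \<omega> * s \<omega> = s (of_rat (of_int d))" using \<omega>2 mult[OF \<omega>K \<omega>K] by (simp add: power2_eq_square)
  hence "s \<omega> ^ 2 = \<omega> ^ 2" using nf_hom_of_rat[OF sub s, of "of_int d"] \<omega>2 by (simp add: power2_eq_square)
  hence "s \<omega> = \<omega> \<or> s \<omega> = - \<omega>" by (simp add: power2_eq_iff)
  moreover have "s (of_rat x + of_rat y * \<omega>) = of_rat x + of_rat y * s \<omega>" for x y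
    using add[OF rK mulK[OF rK \<omega>K]] mult[OF rK \<omega>K] nf_hom_of_rat[OF sub s] by simp
  ultimately show thesis using that by auto
qed

definition co1 :: "complex \<Rightarrow> rat" where "co1 z = (THE x. \<exists>y. z = of_rat x + of_rat y * \<omega>)"
definition co2 :: "complex \<Rightarrow> rat" where "co2 z = (THE y. \<exists>x. z = of_rat x + of_rat y * \<omega>)"

lemma co [simp]: "co1 (of_rat x + of_rat y * \<omega>) = x" "co2 (of_rat x + of_rat y * \<omega>) = y"
  unfolding co1_def co2_def by (rule the_equality; use coords_unique in blast)+

text \<open>The value 0 outside \<open>K\<close> follows the convention of
  \<open>nf_embeddings\<close>.\<close>

definition conj :: "complex \<Rightarrow> complex" where
  "conj z = (if z \<in> K then of_rat (co1 z) - of_rat (co2 z) * \<omega> else 0)"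

lemma conj_eq: "conj (of_rat x + of_rat y * \<omega>) = of_rat x - of_rat y * \<omega>"
  unfolding conj_def by (auto simp: K_def)

lemma conj_hom: "nf_hom K conj"
  unfolding nf_hom_def
proof (intro conjI ballI)
  show "conj 1 = 1" using conj_eq[of 1 0] by simp
  fix z w assume "z \<in> K" "w \<in> K"
  then obtain x y x' y' where z: "z = of_rat x + of_rat y * \<omega>" and w: "w = of_rat x' + of_rat y' * \<omega>"
    unfolding K_def by blast
  have "z + w = of_rat (x + x') + of_rat (y + y') * \<omega>"
    unfolding z w by (simp add: of_rat_add algebra_simps)
  thus "conj (z + w) = conj z + conj w"
    unfolding z w by (simp only: conj_eq) (simp add: of_rat_add algebra_simps)
  have "z * w = of_rat (x * x') + of_rat (y * y') * \<omega> ^ 2 + of_rat (x * y' + x' * y) * \<omega>"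
    unfolding z w by (simp add: of_rat_add of_rat_mult algebra_simps power2_eq_square)
  hence zw: "z * w = of_rat (x * x' + of_int d * (y * y')) + of_rat (x * y' + x' * y) * \<omega>"
    unfolding \<omega>2 by (simp add: of_rat_add of_rat_mult algebra_simps)
  have "conj z * conj w = of_rat (x * x') + of_rat (y * y') * \<omega> ^ 2 - of_rat (x * y' + x' * y) * \<omega>"
    unfolding z w conj_eq by (simp add: of_rat_add of_rat_mult algebra_simps power2_eq_square)
  also have "\<dots> = of_rat (x * x' + of_int d * (y * y')) - of_rat (x * y' + x' * y) * \<omega>"
    unfolding \<omega>2 by (simp add: of_rat_add of_rat_mult algebra_simps)
  finally show "conj (z * w) = conj z * conj w" unfolding zw conj_eq by simp
qed

lemma embeddings: "nf_embeddings K = {\<lambda>z. if z \<in> K then z else 0, conj}"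
proof (intro equalityI subsetI)
  fix s assume "s \<in> nf_embeddings K"
  hence s: "nf_hom K s" "\<And>z. z \<notin> K \<Longrightarrow> s z = 0" unfolding nf_embeddings_def by auto
  from s(1) show "s \<in> {\<lambda>z. if z \<in> K then z else 0, conj}"
  proof (cases rule: hom_cases)
    case 1
    have "s = (\<lambda>z. if z \<in> K then z else 0)"
      using 1 s(2) by (intro ext) (auto simp: K_def)
    thus ?thesis by simp
  next
    case 2
    have "s z = conj z" for z
    proof (cases "z \<in> K")
      case True
      then obtain x y where "z = of_rat x + of_rat y * \<omega>" unfolding K_def by blast
      thus ?thesis using 2 conj_eq by simp
    qed (simp add: s(2) conj_def)
    hence "s = conj" by (rule ext)
    thus ?thesis by simp
  qed
next
  fix s assume "s \<in> {\<lambda>z. if z \<in> K then z else 0, conj}"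
  moreover have "nf_hom K (\<lambda>z. if z \<in> K then z else 0)"
    using sub unfolding nf_hom_def subfield_C_def by auto
  ultimately show "s \<in> nf_embeddings K"
    unfolding nf_embeddings_def using conj_hom by (auto simp: conj_def)
qed

lemma trace: "nf_trace K (of_rat x + of_rat y * \<omega>) = of_rat (2 * x)"
proof -
  have K1: "of_rat x + of_rat y * \<omega> \<in> K" for x y by (auto simp: K_def)
  have "(\<lambda>z. if z \<in> K then z else 0) \<noteq> conj"
  proof
    assume "(\<lambda>z. if z \<in> K then z else 0) = conj"
    from fun_cong[OF this, of "of_rat 0 + of_rat 1 * \<omega>"] have "\<omega> = - \<omega>"
      using K1[of 0 1] conj_eq[of 0 1] by simp
    thus False using \<omega>_nz by simp
  qed
  thus ?thesis unfolding nf_trace_def embeddings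
    using K1[of x y] conj_eq[of x y] by (simp add: of_rat_mult)
qed

text \<open>Trace and norm of an algebraic integer are rational integers. The trace makes
  \<open>2 x\<close> integral, the norm then makes \<open>d (2 y)^2\<close> integral, and
  \<open>d\<close> is squarefree.\<close>

lemma integer_coords:
  assumes "z \<in> ring_of_integers K"
  obtains u v :: int where "z = of_rat (of_int u / 2) + of_rat (of_int v / 2) * \<omega>"
    "4 dvd u ^ 2 - d * v ^ 2"
proof -
  have zK: "z \<in> K" and zi: "algebraic_integer z" using assms unfolding ring_of_integers_def by auto
  obtain x y where z: "z = of_rat x + of_rat y * \<omega>" using zK unfolding K_def by blast
  define z' where "z' = of_rat x - of_rat y * \<omega>"
  \<comment> \<open>Conjugation fixes integer coefficients, so \<open>z'\<close> is a root of the
    same monic polynomial.\<close>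
  have "algebraic_integer z'"
  proof -
    obtain p :: "int poly" where p: "lead_coeff p = 1" "poly (of_int_poly p) z = 0"
      using zi unfolding algebraic_integer_def by auto
    have mulK: "a * b \<in> K" "a + b \<in> K" if "a \<in> K" "b \<in> K" for a b using sub that unfolding subfield_C_def by auto
    have intK: "of_int k \<in> K" for k using subfield_of_rat[OF sub, of "of_int k"] by simp
    have cint: "conj (of_int k) = of_int k" for k using nf_hom_of_rat[OF sub conj_hom, of "of_int k"] by simp
    have "poly (of_int_poly q) z \<in> K \<and> conj (poly (of_int_poly q) z) = poly (of_int_poly q) (conj z)" for q :: "int poly"
    proof (induction q)
      case 0
      show ?case using intK[of 0] cint[of 0] by simp
    next
      case (pCons k q)
      thus ?case using conj_hom zK mulK intK cint unfolding nf_hom_def by (simp add: hom_distribs)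
    qed
    from this[of p] have "poly (of_int_poly p) (conj z) = 0" using p(2) cint[of 0] by simp
    thus ?thesis using p(1) unfolding algebraic_integer_def z'_def z conj_eq by blast
  qed
  have "z + z' = of_rat (2 * x)" unfolding z z'_def by (simp add: of_rat_mult)
  moreover have "algebraic_integer (z + z')" by (rule algebraic_integer_add_mult(1)[OF zi \<open>algebraic_integer z'\<close>])
  ultimately obtain u where u: "2 * x = of_int u" using rational_algebraic_integer by metis
  have "z * z' = of_rat (x ^ 2) - of_rat (y ^ 2) * \<omega> ^ 2"
    unfolding z z'_def by (simp add: of_rat_mult of_rat_power algebra_simps power2_eq_square)
  also have "\<dots> = of_rat (x ^ 2 - of_int d * y ^ 2)"
    unfolding \<omega>2 by (simp add: of_rat_diff of_rat_mult)
  finally have "z * z' = \<dots>" .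
  moreover have "algebraic_integer (z * z')" by (rule algebraic_integer_add_mult(2)[OF zi \<open>algebraic_integer z'\<close>])
  ultimately obtain N where N: "x ^ 2 - of_int d * y ^ 2 = of_int N" using rational_algebraic_integer by metis
  have "of_int d * (2 * y) ^ 2 = (2 * x) ^ 2 - 4 * (x ^ 2 - of_int d * y ^ 2)"
    by (simp add: algebra_simps power2_eq_square)
  also have "\<dots> = of_int (u ^ 2 - 4 * N)" unfolding u N by simp
  finally have dy: "of_int d * (2 * y) ^ 2 = of_int (u ^ 2 - 4 * N)" .
  obtain v where v: "2 * y = of_int v" by (rule squarefree_mult_square_int[OF sqf dy])
  have "of_int (u ^ 2 - d * v ^ 2) = (of_int (4 * N) :: rat)"
    unfolding of_int_diff of_int_mult of_int_power u[symmetric] v[symmetric] N[symmetric]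
    by (simp add: algebra_simps power2_eq_square)
  hence "u ^ 2 - d * v ^ 2 = 4 * N" by (simp only: of_int_eq_iff)
  hence "4 dvd u ^ 2 - d * v ^ 2" by simp
  moreover have xy: "x = of_int u / 2" "y = of_int v / 2" using u v by simp_all
  ultimately show thesis using that[of u v] unfolding z xy by blast
qed

lemma \<omega>_integral: "\<omega> \<in> ring_of_integers K"
proof -
  have "\<omega> \<in> K" unfolding K_def by (intro CollectI exI[of _ 0] exI[of _ 1]) simp
  moreover have "algebraic_integer \<omega>"
    unfolding algebraic_integer_def using \<omega>2
    by (intro exI[of _ "[:- d, 0, 1:]"]) (simp add: hom_distribs power2_eq_square)
  ultimately show ?thesis by (simp add: ring_of_integers_def)
qed

lemma one_integral: "1 \<in> ring_of_integers K"
  using sub algebraic_integer_of_int[of 1] unfolding ring_of_integers_def subfield_C_def by auto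

text \<open>The rank is existentially quantified in \<open>nf_disc\<close>. Rank 1 would make
  \<omega> rational, and three or more basis elements would be dependent, having only two rational
  coordinates.\<close>

lemma integral_basis_size:
  assumes w: "\<And>i. i < n \<Longrightarrow> w i \<in> ring_of_integers K"
    and bij: "bij_betw (\<lambda>c. \<Sum>i<n. of_int (c i) * w i) {c :: nat \<Rightarrow> int. \<forall>i\<ge>n. c i = 0} (ring_of_integers K)"
  shows "n = 2"
proof -
  define S where "S = (\<lambda>c :: nat \<Rightarrow> int. \<Sum>i<n. of_int (c i) * w i)"
  have surj: "\<exists>c. z = S c" if "z \<in> ring_of_integers K" for z
    using bij that unfolding bij_betw_def S_def by (metis (no_types, lifting) imageE)
  have inj: "c = (\<lambda>_. 0)" if "\<forall>i\<ge>n. c i = 0" "S c = 0" for c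
    by (rule inj_onD[of S "{c. \<forall>i\<ge>n. c i = 0}"]) (use bij that in \<open>auto simp: bij_betw_def S_def\<close>)
  have "n \<noteq> 0"
  proof
    assume "n = 0"
    thus False using surj[OF one_integral] by (simp add: S_def)
  qed
  moreover have "n \<noteq> 1"
  proof
    assume "n = 1"
    hence S: "S c = of_int (c 0) * w 0" for c by (simp add: S_def)
    obtain c where "1 = S c" using surj[OF one_integral] ..
    hence c: "1 = of_int (c 0) * w 0" by (simp only: S)
    obtain c' where "\<omega> = S c'" using surj[OF \<omega>_integral] ..
    hence c': "\<omega> = of_int (c' 0) * w 0" by (simp only: S)
    have "of_int (c' 0) * (of_int (c 0) * w 0) = of_int (c 0) * (of_int (c' 0) * w 0)"
      by (simp only: mult_ac)
    hence "of_int (c' 0) = of_int (c 0) * \<omega>" unfolding c[symmetric] c'[symmetric] by simp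
    hence "of_rat (of_int (c' 0)) + of_rat (of_int (- c 0)) * \<omega> = 0" by (simp add: of_rat_minus)
    hence "c 0 = 0" unfolding \<omega>_irrational by simp
    thus False using c by simp
  qed
  moreover have "\<not> n > 2"
  proof
    assume n: "n > 2"
    have "\<exists>u v :: int. w i = of_rat (of_int u / 2) + of_rat (of_int v / 2) * \<omega>" if "i < n" for i
      using integer_coords[OF w[OF that]] by metis
    then obtain u v :: "nat \<Rightarrow> int" where uv: "\<And>i. i < n \<Longrightarrow> w i = of_rat (of_int (u i) / 2) + of_rat (of_int (v i) / 2) * \<omega>"
      by metis
    have rel: "x = 0 \<and> y = 0 \<and> z = 0"
      if "x * u 0 + y * u 1 + z * u 2 = 0" "x * v 0 + y * v 1 + z * v 2 = 0" for x y z :: int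
    proof -
      define c where "c = (\<lambda>i :: nat. if i = 0 then x else if i = 1 then y else if i = 2 then z else 0)"
      have "S c = (\<Sum>i\<in>{0,1,2}. of_int (c i) * w i)"
        unfolding S_def using n by (intro sum.mono_neutral_right) (auto simp: c_def)
      also have "\<dots> = of_int x * w 0 + of_int y * w 1 + of_int z * w 2"
        by (simp add: c_def)
      also have "\<dots> = of_rat (of_int (x * u 0 + y * u 1 + z * u 2) / 2) + of_rat (of_int (x * v 0 + y * v 1 + z * v 2) / 2) * \<omega>"
        using n by (simp add: uv of_rat_add of_rat_mult of_rat_divide algebra_simps add_divide_distrib)
      also have "\<dots> = 0" unfolding that by simp
      finally have "c = (\<lambda>_. 0)" using n by (intro inj) (auto simp: c_def)
      from fun_cong[OF this, of 0] fun_cong[OF this, of 1] fun_cong[OF this, of 2]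
      show ?thesis by (simp add: c_def)
    qed
    \<comment> \<open>The cross product of the two coordinate vectors is orthogonal to both, so
      independence makes it vanish. The vanishing minor then provides two more relations, which
      force the coordinates themselves to vanish.\<close>
    have "u 0 * v 1 - u 1 * v 0 = 0"
      using rel[of "u 1 * v 2 - u 2 * v 1" "u 2 * v 0 - u 0 * v 2" "u 0 * v 1 - u 1 * v 0"]
      by (simp add: algebra_simps)
    hence "u 1 = 0 \<and> u 0 = 0" "v 1 = 0 \<and> v 0 = 0"
      using rel[of "u 1" "- u 0" 0] rel[of "v 1" "- v 0" 0] by (simp_all add: algebra_simps)
    thus False using rel[of 1 0 0] by simp
  qed
  ultimately show "n = 2" by linarith
qed

lemma det_permutes_2:
  fixes T :: "nat \<Rightarrow> nat \<Rightarrow> 'a :: comm_ring_1"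
  shows "(\<Sum>p | p permutes {..<2}. of_int (sign p) * (\<Prod>i<2. T i (p i))) = T 0 0 * T 1 1 - T 0 1 * T 1 0"
proof -
  have two: "{..<2 :: nat} = {0, 1}" by auto
  have "{p. p permutes {..<2 :: nat}} = {id, transpose 0 1}"
    unfolding two by (auto simp: permutes_doubleton_iff)
  moreover have "id \<noteq> (transpose 0 1 :: nat \<Rightarrow> nat)"
    by (metis id_apply transpose_apply_first zero_neq_one)
  ultimately show ?thesis by (simp add: two sign_swap_id)
qed

text \<open>In half-integer coordinates the trace form gives
  \<open>4 D = d (u0 v1 - u1 v0)^2\<close>. By the norm condition modulo 4, \<open>u\<close> and
  \<open>v\<close> have equal parity if \<open>d mod 4 = 1\<close> and are both even otherwise, so
  the determinant supplies a factor 2 or 4. A divisor of \<open>D\<close> suffices, as A2 ranges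
  over all squarefree divisors of \<open>D\<close>.\<close>

lemma disc_dvd:
  assumes "nf_disc K D"
  shows "(if d mod 4 = 1 then d else 2 * d) dvd D"
proof -
  obtain n and w :: "nat \<Rightarrow> complex" where w: "\<And>i. i < n \<Longrightarrow> w i \<in> ring_of_integers K"
    and bij: "bij_betw (\<lambda>c. \<Sum>i<n. of_int (c i) * w i) {c :: nat \<Rightarrow> int. \<forall>i\<ge>n. c i = 0} (ring_of_integers K)"
    and D: "of_int D = (\<Sum>p | p permutes {..<n}. of_int (sign p) * (\<Prod>i<n. nf_trace K (w i * w (p i))))"
    using assms unfolding nf_disc_def by blast
  have n: "n = 2" by (rule integral_basis_size[OF w bij])
  obtain u0 v0 where w0: "w 0 = of_rat (of_int u0 / 2) + of_rat (of_int v0 / 2) * \<omega>" "4 dvd u0 ^ 2 - d * v0 ^ 2"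
    using integer_coords[OF w[of 0]] n by auto
  obtain u1 v1 where w1: "w 1 = of_rat (of_int u1 / 2) + of_rat (of_int v1 / 2) * \<omega>" "4 dvd u1 ^ 2 - d * v1 ^ 2"
    using integer_coords[OF w[of 1]] n by auto
  have tr: "nf_trace K ((of_rat x + of_rat y * \<omega>) * (of_rat x' + of_rat y' * \<omega>)) = of_rat (2 * (x * x' + of_int d * (y * y')))" for x y x' y'
  proof -
    have "(of_rat x + of_rat y * \<omega>) * (of_rat x' + of_rat y' * \<omega>)
        = of_rat (x * x') + of_rat (y * y') * \<omega> ^ 2 + of_rat (x * y' + x' * y) * \<omega>"
      by (simp add: of_rat_add of_rat_mult algebra_simps power2_eq_square)
    also have "\<dots> = of_rat (x * x' + of_int d * (y * y')) + of_rat (x * y' + x' * y) * \<omega>"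
      unfolding \<omega>2 by (simp add: of_rat_add of_rat_mult algebra_simps)
    finally show ?thesis by (simp only: trace)
  qed
  have "of_rat (of_int D) = nf_trace K (w 0 * w 0) * nf_trace K (w 1 * w 1) - nf_trace K (w 0 * w 1) * nf_trace K (w 1 * w 0)"
    using D det_permutes_2[of "\<lambda>i j. nf_trace K (w i * w j)"] unfolding n by simp
  also have "\<dots> = of_rat (of_int d * of_int (u0 * v1 - u1 * v0) ^ 2 / 4)"
    unfolding w0(1) w1(1) tr by (simp only: of_rat_mult[symmetric] of_rat_diff[symmetric] of_rat_eq_iff) (simp add: field_simps power2_eq_square)
  finally have "(of_int (4 * D) :: rat) = of_int (d * (u0 * v1 - u1 * v0) ^ 2)"
    unfolding of_rat_eq_iff by simp
  hence D4: "4 * D = d * (u0 * v1 - u1 * v0) ^ 2" by (simp only: of_int_eq_iff)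
  show ?thesis
  proof (cases "d mod 4 = 1")
    case True
    have par: "even u \<longleftrightarrow> even v" if "4 dvd u ^ 2 - d * v ^ 2" for u v :: int
    proof -
      have "odd d" using True by presburger
      moreover have "even (u ^ 2 - d * v ^ 2)" using that by (metis dvd_trans even_numeral)
      ultimately show ?thesis by simp
    qed
    have "even (u0 * v1 - u1 * v0)" using par[OF w0(2)] par[OF w1(2)] by auto
    then obtain k where "u0 * v1 - u1 * v0 = 2 * k" by (rule dvdE)
    hence "D = d * k ^ 2" using D4 by (simp add: power_mult_distrib)
    thus ?thesis using True by simp
  next
    case False
    have "d mod 4 \<noteq> 0"
    proof
      assume "d mod 4 = 0"
      hence "2 ^ 2 dvd d" by (simp add: dvd_eq_mod_eq_0)
      hence "(2 :: int) dvd 1" using sqf squarefreeD by blast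
      thus False by simp
    qed
    hence d: "d mod 4 = 2 \<or> d mod 4 = 3" using False by presburger
    have ev: "even u \<and> even v" if "4 dvd u ^ 2 - d * v ^ 2" for u v :: int
    proof -
      have sq: "x ^ 2 mod 4 = (if even x then 0 else 1)" for x :: int
      proof (cases "even x")
        case True
        then obtain k where "x = 2 * k" by (rule dvdE)
        thus ?thesis by (simp add: power_mult_distrib)
      next
        case False
        then obtain k where "x = 2 * k + 1" by (rule oddE)
        hence "x ^ 2 = 4 * (k ^ 2 + k) + 1" by (simp add: algebra_simps power2_eq_square)
        hence "x ^ 2 mod 4 = 1" by presburger
        thus ?thesis using False by simp
      qed
      have "(u ^ 2 - d * v ^ 2) mod 4 = 0" using that by (simp add: dvd_eq_mod_eq_0)
      moreover have "(u ^ 2 - d * v ^ 2) mod 4 = (u ^ 2 mod 4 - (d mod 4) * (v ^ 2 mod 4)) mod 4"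
      proof -
        have "(u ^ 2 mod 4 - (d mod 4) * (v ^ 2 mod 4)) mod 4
            = (u ^ 2 mod 4 - (d mod 4) * (v ^ 2 mod 4) mod 4) mod 4" by (simp only: mod_diff_right_eq)
        also have "\<dots> = (u ^ 2 - d * v ^ 2) mod 4" by (simp only: mod_mult_eq mod_diff_eq)
        finally show ?thesis by (rule sym)
      qed
      ultimately have "(u ^ 2 mod 4 - (d mod 4) * (v ^ 2 mod 4)) mod 4 = 0" by simp
      thus ?thesis using d unfolding sq by (auto split: if_splits)
    qed
    obtain a0 b0 a1 b1 where "u0 = 2 * a0" "v0 = 2 * b0" "u1 = 2 * a1" "v1 = 2 * b1"
      using ev[OF w0(2)] ev[OF w1(2)] by (meson dvdE)
    hence "4 * D = 4 * (2 * d * (2 * (a0 * b1 - a1 * b0) ^ 2))"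
      unfolding D4 by (simp add: algebra_simps power2_eq_square)
    hence "D = 2 * d * (2 * (a0 * b1 - a1 * b0) ^ 2)" by simp
    thus ?thesis using False by simp
  qed
qed

end

text \<open>The splitting field is an intersection of subfields, so it lies in \<rat>(\<omega>) once
  the latter is known to be a field; nonvanishing norms provide the inverses. Irreducibility enters
  in that \<open>e^2 d\<close> is not a rational square.\<close>

lemma quadratic_field_splitting:
  fixes a b e d :: int
  assumes irr: "irreducible (of_int_poly [:b, a, 1:] :: rat poly)"
    and disc: "a ^ 2 - 4 * b = e ^ 2 * d" and sqf: "squarefree d"
  shows "quadratic_field d (csqrt (of_int d)) (splitting_field_C [:b, a, 1:])" and "e ^ 2 * d \<noteq> 0"
proof -
  define \<omega> where "\<omega> = csqrt (of_int d)"
  have \<omega>2: "\<omega> ^ 2 = of_int d" by (simp add: \<omega>_def)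
  have nosquare: "of_int (e ^ 2 * d) \<noteq> (r :: rat) ^ 2" for r
  proof
    assume r: "of_int (e ^ 2 * d) = r ^ 2"
    have "of_int (a ^ 2 - 4 * b) = r ^ 2" using r disc by simp
    hence r2: "of_int a ^ 2 - 4 * of_int b = r ^ 2" by simp
    have "of_int_poly [:b, a, 1:] = [:(of_int a - r) / 2, 1:] * [:(of_int a + r) / 2, 1:]"
      using r2 by (simp add: hom_distribs field_simps power2_eq_square)
    from irreducibleD[OF irr this] show False by (simp add: is_unit_poly_iff)
  qed
  have e0: "e \<noteq> 0"
  proof
    assume "e = 0"
    thus False using nosquare[of 0] by simp
  qed
  show "e ^ 2 * d \<noteq> 0"
  proof
    assume "e ^ 2 * d = 0"
    thus False using nosquare[of 0] by simp
  qed
  have nonsquare: "r ^ 2 \<noteq> of_int d" for r :: rat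
    using nosquare[of "of_int e * r"] by (auto simp: power_mult_distrib)
  define K where "K = splitting_field_C [:b, a, 1:]"
  define L where "L = {of_rat x + of_rat y * \<omega> | x y. True}"
  have sub: "subfield_C K" unfolding K_def by (rule splitting_field_C_subfield)
  have Kcl: "x + y \<in> K" "x * y \<in> K" "- x \<in> K" if "x \<in> K" "y \<in> K" for x y
    using sub that unfolding subfield_C_def by auto
  have rK: "of_rat r \<in> K" for r by (rule subfield_of_rat[OF sub])
  define \<theta> where "\<theta> = (- of_int a + of_int e * \<omega>) / 2"
  have "(of_int e * \<omega>) ^ 2 = of_int (a ^ 2 - 4 * b)" unfolding disc by (simp add: power_mult_distrib \<omega>2)
  hence eo: "(of_int e * \<omega>) ^ 2 = of_int a ^ 2 - 4 * of_int b" by simp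
  have roots: "poly (of_int_poly [:b, a, 1:]) z = 0 \<longleftrightarrow> (2 * z + of_int a) ^ 2 = (of_int e * \<omega>) ^ 2" for z
  proof -
    have 1: "poly (of_int_poly [:b, a, 1:]) z = z ^ 2 + of_int a * z + of_int b"
      by (simp add: hom_distribs algebra_simps power2_eq_square)
    have "(2 * z + of_int a) ^ 2 - (of_int a ^ 2 - 4 * of_int b) = 4 * (z ^ 2 + of_int a * z + of_int b)"
      by (simp add: algebra_simps power2_eq_square)
    thus ?thesis unfolding 1 eo by (metis eq_iff_diff_eq_0 mult_eq_0_iff zero_neq_numeral)
  qed
  have "poly (of_int_poly [:b, a, 1:]) \<theta> = 0" unfolding roots \<theta>_def by simp
  hence \<theta>K: "\<theta> \<in> K" unfolding K_def by (rule splitting_field_C_roots)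
  have "\<omega> = of_rat (of_int a / of_int e) + of_rat (2 / of_int e) * \<theta>"
    using e0 by (simp add: \<theta>_def of_rat_divide field_simps)
  hence \<omega>K: "\<omega> \<in> K" using Kcl rK \<theta>K by metis
  have "L \<subseteq> K" unfolding L_def using Kcl rK \<omega>K by auto
  moreover have "K \<subseteq> L" unfolding K_def
  proof (rule splitting_field_C_least)
    have memL: "of_rat x + of_rat y * \<omega> \<in> L" for x y unfolding L_def by blast
    have \<omega>d: "\<omega> * \<omega> = of_int d" using \<omega>2 by (simp add: power2_eq_square)
    show "subfield_C L"
      unfolding subfield_C_def
    proof (intro conjI ballI)
      show "0 \<in> L" "1 \<in> L" using memL[of 0 0] memL[of 1 0] by simp_all
      fix z assume "z \<in> L"
      then obtain x y where z: "z = of_rat x + of_rat y * \<omega>" unfolding L_def by blast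
      show "- z \<in> L" using memL[of "- x" "- y"] by (simp add: z of_rat_minus)
      show "inverse z \<in> L"
      proof (cases "x ^ 2 - of_int d * y ^ 2 = 0")
        case True
        have "y = 0"
        proof (rule ccontr)
          assume "y \<noteq> 0"
          hence "(x / y) ^ 2 = of_int d" using True by (simp add: field_simps)
          thus False using nonsquare by blast
        qed
        hence "z = 0" using True z by simp
        thus ?thesis using memL[of 0 0] by simp
      next
        case False
        define N where "N = x ^ 2 - of_int d * y ^ 2"
        have "z * (of_rat (x / N) + of_rat (- y / N) * \<omega>) = (of_rat x ^ 2 - of_rat y ^ 2 * (\<omega> * \<omega>)) / of_rat N"
          unfolding z by (simp add: of_rat_divide of_rat_minus add_divide_distrib diff_divide_distrib algebra_simps power2_eq_square)
        also have "of_rat x ^ 2 - of_rat y ^ 2 * (\<omega> * \<omega>) = of_rat N"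
          unfolding \<omega>d N_def by (simp add: of_rat_diff of_rat_mult of_rat_power)
        also have "of_rat N / of_rat N = (1 :: complex)" using False by (simp add: N_def)
        finally have "inverse z = of_rat (x / N) + of_rat (- y / N) * \<omega>" by (rule inverse_unique)
        thus ?thesis using memL by metis
      qed
      fix w assume "w \<in> L"
      then obtain x' y' where w: "w = of_rat x' + of_rat y' * \<omega>" unfolding L_def by blast
      have "z + w = of_rat (x + x') + of_rat (y + y') * \<omega>"
        unfolding z w by (simp add: of_rat_add algebra_simps)
      thus "z + w \<in> L" using memL by metis
      have "z * w = of_rat (x * x') + of_rat (y * y') * (\<omega> * \<omega>) + of_rat (x * y' + x' * y) * \<omega>"
        unfolding z w by (simp add: of_rat_add of_rat_mult algebra_simps)
      also have "\<dots> = of_rat (x * x' + of_int d * (y * y')) + of_rat (x * y' + x' * y) * \<omega>"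
        unfolding \<omega>d by (simp add: of_rat_add of_rat_mult algebra_simps)
      finally show "z * w \<in> L" using memL by metis
    qed
    show "{z. poly (of_int_poly [:b, a, 1:]) z = 0} \<subseteq> L"
    proof
      fix z :: complex assume "z \<in> {z. poly (of_int_poly [:b, a, 1:]) z = 0}"
      hence "(2 * z + of_int a) ^ 2 = (of_int e * \<omega>) ^ 2" using roots by blast
      hence "2 * z + of_int a = of_int e * \<omega> \<or> 2 * z + of_int a = - (of_int e * \<omega>)" by (simp only: power2_eq_iff)
      hence "z = of_rat (- of_int a / 2) + of_rat (of_int e / 2) * \<omega> \<or> z = of_rat (- of_int a / 2) + of_rat (- of_int e / 2) * \<omega>"
        by (auto simp: of_rat_divide of_rat_minus field_simps eq_neg_iff_add_eq_0)
      thus "z \<in> L" using memL by metis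
    qed
  qed
  ultimately have KL: "K = {of_rat x + of_rat y * \<omega> | x y. True}" unfolding L_def by simp
  show "quadratic_field d (csqrt (of_int d)) (splitting_field_C [:b, a, 1:])"
    unfolding \<omega>_def[symmetric] K_def[symmetric]
    by unfold_locales (use sqf \<omega>2 nonsquare KL sub in auto)
qed

subsection \<open>Polynomials over a ring of integers of class number one\<close>
locale integer_ring =
  fixes K :: "complex set" and R :: "complex set"
  defines "R \<equiv> ring_of_integers K"
  assumes sub: "subfield_C K"
begin

lemma K_closed: "0 \<in> K" "1 \<in> K" "x \<in> K \<Longrightarrow> y \<in> K \<Longrightarrow> x + y \<in> K" "x \<in> K \<Longrightarrow> y \<in> K \<Longrightarrow> x * y \<in> K"
   "x \<in> K \<Longrightarrow> - x \<in> K" "x \<in> K \<Longrightarrow> inverse x \<in> K" "x \<in> K \<Longrightarrow> y \<in> K \<Longrightarrow> x - y \<in> K" "x \<in> K \<Longrightarrow> y \<in> K \<Longrightarrow> x / y \<in> K"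
  using sub unfolding subfield_C_def by (auto simp: divide_inverse diff_conv_add_uminus simp del: add_uminus_conv_diff)

lemma R_subset_K: "R \<subseteq> K" by (auto simp: R_def ring_of_integers_def)

lemma R_closed: "0 \<in> R" "1 \<in> R" "x \<in> R \<Longrightarrow> y \<in> R \<Longrightarrow> x + y \<in> R" "x \<in> R \<Longrightarrow> y \<in> R \<Longrightarrow> x * y \<in> R"
    "x \<in> R \<Longrightarrow> - x \<in> R" "x \<in> R \<Longrightarrow> y \<in> R \<Longrightarrow> x - y \<in> R"
proof -
  show "0 \<in> R" "1 \<in> R" using K_closed algebraic_integer_of_int[of 0] algebraic_integer_of_int[of 1]
    by (auto simp: R_def ring_of_integers_def)
  show add: "x + y \<in> R" if "x \<in> R" "y \<in> R" for x y
    using that K_closed algebraic_integer_add_mult by (auto simp: R_def ring_of_integers_def)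
  show "x * y \<in> R" if "x \<in> R" "y \<in> R" for x y
    using that K_closed algebraic_integer_add_mult by (auto simp: R_def ring_of_integers_def)
  show um: "- x \<in> R" if "x \<in> R" for x
    using that K_closed algebraic_integer_uminus by (auto simp: R_def ring_of_integers_def)
  show "x - y \<in> R" if "x \<in> R" "y \<in> R" for x y
    using add[OF that(1) um[OF that(2)]] by simp
qed

lemma R_sum: "(\<And>i. i \<in> I \<Longrightarrow> f i \<in> R) \<Longrightarrow> sum f I \<in> R"
  by (induction I rule: infinite_finite_induct) (auto intro: R_closed)

lemma OKt_iff: "P \<in> OKt K \<longleftrightarrow> (\<forall>i. coeff P i \<in> R)" by (simp add: OKt_def R_def)

lemma OKt_closed: "0 \<in> OKt K" "1 \<in> OKt K" "P \<in> OKt K \<Longrightarrow> Q \<in> OKt K \<Longrightarrow> P + Q \<in> OKt K"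
  "P \<in> OKt K \<Longrightarrow> Q \<in> OKt K \<Longrightarrow> P * Q \<in> OKt K" "P \<in> OKt K \<Longrightarrow> - P \<in> OKt K"
  "P \<in> OKt K \<Longrightarrow> Q \<in> OKt K \<Longrightarrow> P - Q \<in> OKt K" "c \<in> R \<Longrightarrow> [:c:] \<in> OKt K" "c \<in> R \<Longrightarrow> P \<in> OKt K \<Longrightarrow> smult c P \<in> OKt K"
  "c \<in> R \<Longrightarrow> monom c n \<in> OKt K"
  by (auto simp: OKt_iff coeff_mult R_closed coeff_pCons split: nat.splits intro!: R_sum)

lemma OKt_prod: "(\<And>i. i \<in> I \<Longrightarrow> f i \<in> OKt K) \<Longrightarrow> prod f I \<in> OKt K"
  by (induction I rule: infinite_finite_induct) (auto intro: OKt_closed)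

lemma OKt_power: "P \<in> OKt K \<Longrightarrow> P ^ n \<in> OKt K"
  by (induction n) (auto intro: OKt_closed)

text \<open>Divisibility in the ring of polynomials over the integers of \<open>K\<close>; on
  \<open>complex poly\<close>, \<open>dvd\<close> would admit arbitrary complex cofactors.\<close>

definition rdvd :: "complex poly \<Rightarrow> complex poly \<Rightarrow> bool" (infix "rdvd" 50) where
  "P rdvd Q \<longleftrightarrow> (\<exists>S\<in>OKt K. Q = P * S)"

lemma rdvdI: "S \<in> OKt K \<Longrightarrow> Q = P * S \<Longrightarrow> P rdvd Q" unfolding rdvd_def by blast

lemma rdvdE: "P rdvd Q \<Longrightarrow> (\<And>S. S \<in> OKt K \<Longrightarrow> Q = P * S \<Longrightarrow> thesis) \<Longrightarrow> thesis"
  unfolding rdvd_def by blast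

lemma rdvd_refl: "P rdvd P" by (rule rdvdI[of 1]) (auto intro: OKt_closed)

lemma rdvd_trans: "P rdvd Q \<Longrightarrow> Q rdvd S \<Longrightarrow> P rdvd S"
  unfolding rdvd_def using OKt_closed(4) by (metis mult.assoc)

lemma rdvd_mult_right: "S \<in> OKt K \<Longrightarrow> P rdvd Q \<Longrightarrow> P rdvd Q * S"
  unfolding rdvd_def using OKt_closed(4) by (metis mult.assoc)

lemma rdvd_mult_left: "S \<in> OKt K \<Longrightarrow> P rdvd Q \<Longrightarrow> P rdvd S * Q"
  using rdvd_mult_right[of S P Q] by (simp only: mult.commute)

lemma rdvd_add: "P rdvd Q \<Longrightarrow> P rdvd S \<Longrightarrow> P rdvd Q + S"
proof -
  assume "P rdvd Q" "P rdvd S"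
  then obtain A B where "A \<in> OKt K" "Q = P * A" "B \<in> OKt K" "S = P * B" by (elim rdvdE) blast
  thus ?thesis by (intro rdvdI[of "A + B"]) (auto intro: OKt_closed simp: algebra_simps)
qed

lemma rdvd_uminus: "P rdvd Q \<Longrightarrow> P rdvd - Q"
  by (elim rdvdE, rule rdvdI[of "- S" for S]) (auto intro: OKt_closed)

lemma rdvd_diff: "P rdvd Q \<Longrightarrow> P rdvd S \<Longrightarrow> P rdvd Q - S"
  using rdvd_add[OF _ rdvd_uminus, of P Q S] by simp

lemma rdvd_mono: "P rdvd Q \<Longrightarrow> P' rdvd Q' \<Longrightarrow> P * P' rdvd Q * Q'"
proof -
  assume "P rdvd Q" "P' rdvd Q'"
  then obtain A B where "A \<in> OKt K" "Q = P * A" "B \<in> OKt K" "Q' = P' * B" by (elim rdvdE) blast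
  thus ?thesis by (intro rdvdI[of "A * B"]) (auto intro: OKt_closed simp: mult_ac)
qed

lemma unit_iff: "OKt_unit K u \<longleftrightarrow> (\<exists>\<epsilon>\<in>nf_units K. u = [:\<epsilon>:])"
proof
  assume "OKt_unit K u"
  then obtain v where uv: "u \<in> OKt K" "v \<in> OKt K" "u * v = 1" unfolding OKt_unit_def by auto
  hence "u \<noteq> 0" "v \<noteq> 0" by auto
  hence "degree u + degree v = 0" using uv(3) by (metis degree_1 degree_mult_eq)
  then obtain a b where ab: "u = [:a:]" "v = [:b:]" by (metis add_is_0 degree_eq_zeroE)
  have "a \<in> R" "b \<in> R" using uv ab by (metis OKt_iff coeff_pCons_0)+
  moreover have "a * b = 1" using uv(3) ab by (simp add: one_pCons mult.commute)
  ultimately show "\<exists>\<epsilon>\<in>nf_units K. u = [:\<epsilon>:]" using ab by (auto simp: nf_units_def R_def)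
next
  assume "\<exists>\<epsilon>\<in>nf_units K. u = [:\<epsilon>:]"
  then obtain \<epsilon> \<delta> where "\<epsilon> \<in> R" "\<delta> \<in> R" "\<epsilon> * \<delta> = 1" "u = [:\<epsilon>:]" by (auto simp: nf_units_def R_def)
  thus "OKt_unit K u" unfolding OKt_unit_def
    by (intro conjI bexI[of _ "[:\<delta>:]"]) (auto intro: OKt_closed simp: one_pCons mult.commute)
qed

lemma unit_mem: "OKt_unit K u \<Longrightarrow> u \<in> OKt K" by (simp add: OKt_unit_def)

lemma unit_mult: "OKt_unit K u \<Longrightarrow> OKt_unit K v \<Longrightarrow> OKt_unit K (u * v)"
proof -
  assume "OKt_unit K u" "OKt_unit K v"
  then obtain u' v' where "u \<in> OKt K" "u' \<in> OKt K" "u * u' = 1" "v \<in> OKt K" "v' \<in> OKt K" "v * v' = 1"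
    unfolding OKt_unit_def by auto
  thus ?thesis unfolding OKt_unit_def
    by (intro conjI bexI[of _ "u' * v'"]) (auto intro: OKt_closed, metis mult.assoc mult.commute mult_1)
qed

lemma unit_inverse: "OKt_unit K u \<Longrightarrow> \<exists>v. OKt_unit K v \<and> u * v = 1"
  unfolding OKt_unit_def by (auto simp: mult.commute)

lemma unit_of_mult: "A \<in> OKt K \<Longrightarrow> B \<in> OKt K \<Longrightarrow> OKt_unit K (A * B) \<Longrightarrow> OKt_unit K A"
  unfolding OKt_unit_def by (metis OKt_closed(4) mult.assoc)

lemma assoc_sym: "OKt_assoc K P Q \<Longrightarrow> OKt_assoc K Q P"
proof -
  assume "OKt_assoc K P Q"
  then obtain u where u: "OKt_unit K u" "P = u * Q" unfolding OKt_assoc_def by auto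
  obtain v where v: "OKt_unit K v" "u * v = 1" using unit_inverse[OF u(1)] by auto
  have "Q = v * P" unfolding u using v by (metis mult.assoc mult.commute mult_1)
  thus ?thesis using v unfolding OKt_assoc_def by auto
qed

lemma assoc_trans: "OKt_assoc K P Q \<Longrightarrow> OKt_assoc K Q S \<Longrightarrow> OKt_assoc K P S"
  unfolding OKt_assoc_def using unit_mult by (metis mult.assoc)

lemma assoc_imp_rdvd: "OKt_assoc K P Q \<Longrightarrow> Q rdvd P"
  unfolding OKt_assoc_def by (auto intro!: rdvdI simp: mult.commute dest: unit_mem)

lemma assoc_imp_rdvd': "OKt_assoc K P Q \<Longrightarrow> P rdvd Q"
  using assoc_imp_rdvd assoc_sym by blast

lemma irreducible_rdvd_imp_assoc:
  assumes "OKt_irreducible K P" "OKt_irreducible K Q" "P rdvd Q"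
  shows "OKt_assoc K P Q"
proof -
  obtain S where S: "S \<in> OKt K" "Q = P * S" using assms(3) by (rule rdvdE)
  hence "OKt_unit K S" using assms unfolding OKt_irreducible_def by blast
  hence "OKt_assoc K Q P" unfolding OKt_assoc_def using S by (auto simp: mult.commute)
  thus ?thesis by (rule assoc_sym)
qed

end

text \<open>Principal ideals turn irreducible elements into primes. The norm, multiplicative and
  equal to 1 only on units, is the measure for the inductions that split off irreducible
  factors.\<close>

locale normed_pid = integer_ring +
  fixes N :: "complex \<Rightarrow> nat"
  assumes class_one: "class_number_one K"
    and N_mult: "x \<in> R \<Longrightarrow> y \<in> R \<Longrightarrow> N (x * y) = N x * N y"
    and N_pos: "x \<in> R \<Longrightarrow> x \<noteq> 0 \<Longrightarrow> N x > 0"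
    and N_unit: "x \<in> R \<Longrightarrow> N x = 1 \<Longrightarrow> x \<in> nf_units K"
begin

definition irr :: "complex \<Rightarrow> bool" where
  "irr \<pi> \<longleftrightarrow> \<pi> \<in> R \<and> \<pi> \<noteq> 0 \<and> \<pi> \<notin> nf_units K \<and> (\<forall>x\<in>R. \<forall>y\<in>R. \<pi> = x * y \<longrightarrow> x \<in> nf_units K \<or> y \<in> nf_units K)"

text \<open>The ideal generated by \<pi> and \<open>x\<close> is principal. Its generator divides
  \<pi>, so it is a unit or an associate of \<pi>. In the first case
  \<open>1 = r \<pi> + s x\<close> is multiplied by \<open>y\<close>; in the second \<pi> divides
  \<open>x\<close>.\<close>

lemma irr_prime:
  assumes p: "irr \<pi>" and xy: "x \<in> R" "y \<in> R" and dvd: "\<exists>z\<in>R. x * y = \<pi> * z"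
  shows "(\<exists>z\<in>R. x = \<pi> * z) \<or> (\<exists>z\<in>R. y = \<pi> * z)"
proof -
  have pR: "\<pi> \<in> R" using p by (simp add: irr_def)
  obtain z where z: "z \<in> R" "x * y = \<pi> * z" using dvd by auto
  define I where "I = {r * \<pi> + s * x | r s. r \<in> R \<and> s \<in> R}"
  have "nf_ideal K I"
    unfolding nf_ideal_def R_def[symmetric]
  proof (intro conjI ballI)
    show "I \<subseteq> R" unfolding I_def using pR xy by (auto intro: R_closed)
    show "0 \<in> I" unfolding I_def using R_closed(1) by (intro CollectI exI[of _ 0]) auto
    fix u assume "u \<in> I"
    then obtain r s where u: "u = r * \<pi> + s * x" "r \<in> R" "s \<in> R" unfolding I_def by auto
    {
      fix v assume "v \<in> I"
      then obtain r' s' where v: "v = r' * \<pi> + s' * x" "r' \<in> R" "s' \<in> R" unfolding I_def by auto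
      show "u + v \<in> I" unfolding I_def
        by (intro CollectI exI[of _ "r + r'"] exI[of _ "s + s'"])
           (use u v in \<open>auto intro: R_closed simp: algebra_simps\<close>)
    }
    fix q assume q: "q \<in> R"
    show "q * u \<in> I" unfolding I_def
      by (intro CollectI exI[of _ "q * r"] exI[of _ "q * s"])
         (use u q in \<open>auto intro: R_closed simp: algebra_simps\<close>)
  qed
  then obtain \<alpha> where a: "\<alpha> \<in> R" "I = (\<lambda>x. \<alpha> * x) ` R"
    using class_one unfolding class_number_one_def R_def by blast
  have "\<pi> \<in> I" unfolding I_def using R_closed by (intro CollectI exI[of _ 1] exI[of _ 0]) auto
  then obtain \<beta> where b: "\<beta> \<in> R" "\<pi> = \<alpha> * \<beta>" using a by auto
  have "x \<in> I" unfolding I_def using R_closed by (intro CollectI exI[of _ 0] exI[of _ 1]) auto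
  then obtain \<gamma> where c: "\<gamma> \<in> R" "x = \<alpha> * \<gamma>" using a by auto
  from p a(1) b have "\<alpha> \<in> nf_units K \<or> \<beta> \<in> nf_units K" unfolding irr_def by blast
  thus ?thesis
  proof
    assume "\<beta> \<in> nf_units K"
    then obtain \<delta> where d: "\<delta> \<in> R" "\<beta> * \<delta> = 1" unfolding nf_units_def R_def by auto
    have "x = \<pi> * (\<delta> * \<gamma>)" unfolding b c using d by (metis mult.assoc mult.commute mult_1)
    thus ?thesis using d c R_closed by blast
  next
    assume "\<alpha> \<in> nf_units K"
    then obtain \<delta> where d: "\<delta> \<in> R" "\<alpha> * \<delta> = 1" unfolding nf_units_def R_def by auto
    have "1 \<in> I" using d a by (metis imageI)
    then obtain r s where rs: "1 = r * \<pi> + s * x" "r \<in> R" "s \<in> R" unfolding I_def by auto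
    have "y = (r * \<pi> + s * x) * y" using rs(1) by simp
    also have "\<dots> = r * \<pi> * y + s * (x * y)" by (simp add: algebra_simps)
    also have "\<dots> = \<pi> * (r * y + s * z)" unfolding z by (simp add: algebra_simps)
    finally have "y = \<pi> * (r * y + s * z)" .
    thus ?thesis using rs z xy R_closed by blast
  qed
qed

lemma irr_divisor_exists:
  assumes "c \<in> R" "c \<noteq> 0" "c \<notin> nf_units K"
  obtains \<pi> c' where "irr \<pi>" "c' \<in> R" "c' \<noteq> 0" "c = \<pi> * c'" "N c' < N c"
proof -
  have "\<exists>\<pi> c'. irr \<pi> \<and> c' \<in> R \<and> c = \<pi> * c'"
    using assms
  proof (induction "N c" arbitrary: c rule: less_induct)
    case less
    show ?case
    proof (cases "irr c")
      case True
      thus ?thesis using R_closed(2) by (intro exI[of _ c] exI[of _ 1]) auto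
    next
      case False
      then obtain x y where xy: "x \<in> R" "y \<in> R" "c = x * y" "x \<notin> nf_units K" "y \<notin> nf_units K"
        using less.prems unfolding irr_def by blast
      have nz: "x \<noteq> 0" "y \<noteq> 0" using xy less.prems by auto
      have "N y > 1" using N_pos[OF xy(2) nz(2)] N_unit[OF xy(2)] xy(5) by (metis One_nat_def Suc_lessI)
      hence "N x < N c" using N_pos[OF xy(1) nz(1)] xy N_mult by simp
      from less.hyps[OF this xy(1) nz(1) xy(4)] obtain \<pi> c' where "irr \<pi>" "c' \<in> R" "x = \<pi> * c'" by auto
      thus ?thesis using xy R_closed(4) by (metis mult.assoc)
    qed
  qed
  then obtain \<pi> c' where p: "irr \<pi>" "c' \<in> R" "c = \<pi> * c'" by auto
  have "c' \<noteq> 0" using assms p by auto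
  have pR: "\<pi> \<in> R" "\<pi> \<noteq> 0" "\<pi> \<notin> nf_units K" using p(1) by (auto simp: irr_def)
  have "N \<pi> > 1" using N_pos[OF pR(1,2)] N_unit[OF pR(1)] pR(3) by (metis One_nat_def Suc_lessI)
  hence "N c' < N c" using N_pos[OF p(2) \<open>c' \<noteq> 0\<close>] p N_mult[OF pR(1) p(2)] by simp
  thus thesis using that p \<open>c' \<noteq> 0\<close> by blast
qed

lemma const_rdvd_iff: "[:\<pi>:] rdvd A \<longleftrightarrow> (\<forall>i. \<exists>z\<in>R. coeff A i = \<pi> * z)" if "\<pi> \<noteq> 0"
proof
  assume "[:\<pi>:] rdvd A"
  then obtain S where "S \<in> OKt K" "A = [:\<pi>:] * S" by (rule rdvdE)
  thus "\<forall>i. \<exists>z\<in>R. coeff A i = \<pi> * z" by (auto simp: OKt_iff)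
next
  assume *: "\<forall>i. \<exists>z\<in>R. coeff A i = \<pi> * z"
  define S where "S = smult (inverse \<pi>) A"
  have "S \<in> OKt K" unfolding OKt_iff S_def
  proof
    fix i
    obtain z where "z \<in> R" "coeff A i = \<pi> * z" using * by blast
    thus "coeff (smult (inverse \<pi>) A) i \<in> R" using that by (simp add: mult.assoc[symmetric])
  qed
  moreover have "A = [:\<pi>:] * S" using that by (simp add: S_def)
  ultimately show "[:\<pi>:] rdvd A" by (rule rdvdI)
qed

text \<open>Gauss lemma: if \<open>i\<close> and \<open>j\<close> are the first indices at which
  \<pi> fails to divide the coefficients of \<open>A\<close> and \<open>B\<close>, then all but one
  of the terms of the coefficient \<open>i + j\<close> of the product are divisible.\<close>

lemma irr_const_prime:
  assumes p: "irr \<pi>" and AB: "A \<in> OKt K" "B \<in> OKt K" and dvd: "[:\<pi>:] rdvd A * B"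
  shows "[:\<pi>:] rdvd A \<or> [:\<pi>:] rdvd B"
proof (rule ccontr)
  assume neg: "\<not> ?thesis"
  have p0: "\<pi> \<noteq> 0" "\<pi> \<in> R" using p by (auto simp: irr_def)
  define D where "D = (\<lambda>x. \<exists>z\<in>R. x = \<pi> * z)"
  have D_add: "D (x + y)" if "D x" "D y" for x y
    using that R_closed(3) unfolding D_def by (metis distrib_left)
  have D_sum: "(\<And>i. i \<in> I \<Longrightarrow> D (f i)) \<Longrightarrow> D (sum f I)" for f :: "nat \<Rightarrow> complex" and I
  proof (induction I rule: infinite_finite_induct)
    case empty
    show ?case using R_closed(1) by (auto simp: D_def)
  next
    case (infinite A)
    show ?case using R_closed(1) infinite by (auto simp: D_def)
  qed (auto intro: D_add)
  have D_mult: "D (x * y)" "D (y * x)" if "D x" "y \<in> R" for x y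
    using that R_closed(4) unfolding D_def by (metis mult.assoc mult.commute)+
  have "\<exists>i. \<not> D (coeff A i)" "\<exists>i. \<not> D (coeff B i)"
    using neg unfolding const_rdvd_iff[OF p0(1)] D_def by auto
  define i where "i = (LEAST i. \<not> D (coeff A i))"
  define j where "j = (LEAST j. \<not> D (coeff B j))"
  have i: "\<not> D (coeff A i)" "\<And>k. k < i \<Longrightarrow> D (coeff A k)"
    unfolding i_def by (rule LeastI_ex) (fact, use not_less_Least in blast)
  have j: "\<not> D (coeff B j)" "\<And>k. k < j \<Longrightarrow> D (coeff B k)"
    unfolding j_def by (rule LeastI_ex) (fact, use not_less_Least in blast)
  have Dc: "D (coeff (A * B) (i + j))" using dvd unfolding const_rdvd_iff[OF p0(1)] D_def by blast
  define f where "f = (\<lambda>k. coeff A k * coeff B (i + j - k))"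
  have cR: "coeff A k \<in> R" "coeff B k \<in> R" for k using AB by (auto simp: OKt_iff)
  have "coeff (A * B) (i + j) = sum f {..i + j}" by (simp add: coeff_mult f_def)
  also have "\<dots> = f i + sum f ({..i + j} - {i})" by (rule sum.remove) auto
  finally have "f i = coeff (A * B) (i + j) + - 1 * sum f ({..i + j} - {i})" by simp
  moreover have "D (sum f ({..i + j} - {i}))"
  proof (rule D_sum)
    fix k assume "k \<in> {..i + j} - {i}"
    hence "k < i \<or> i + j - k < j" by auto
    thus "D (f k)" unfolding f_def using i(2) j(2) D_mult cR by blast
  qed
  moreover have "- 1 \<in> R" using R_closed by blast
  ultimately have "D (f i)" using Dc D_add D_mult by metis
  hence "D (coeff A i * coeff B j)" by (simp add: f_def)
  hence "D (coeff A i) \<or> D (coeff B j)"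
    using irr_prime[OF p cR(1)[of i] cR(2)[of j]] by (auto simp: D_def)
  thus False using i j by blast
qed

end

section \<open>Unique factorization of polynomials over the integers of K\<close>

context normed_pid
begin

lemma irreducible_nz: "OKt_irreducible K P \<Longrightarrow> P \<noteq> 0" by (simp add: OKt_irreducible_def)
lemma irreducible_mem: "OKt_irreducible K P \<Longrightarrow> P \<in> OKt K" by (simp add: OKt_irreducible_def)
lemma irreducible_not_unit: "OKt_irreducible K P \<Longrightarrow> \<not> OKt_unit K P" by (simp add: OKt_irreducible_def)
lemma irreducibleD: "OKt_irreducible K P \<Longrightarrow> Q \<in> OKt K \<Longrightarrow> S \<in> OKt K \<Longrightarrow> P = Q * S \<Longrightarrow> OKt_unit K Q \<or> OKt_unit K S"
  unfolding OKt_irreducible_def by blast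

lemma const_unit_iff: "OKt_unit K [:c:] \<longleftrightarrow> c \<in> nf_units K"
  unfolding unit_iff by simp

lemma irreducible_const_irr: "OKt_irreducible K [:c:] \<Longrightarrow> irr c"
  unfolding irr_def
proof (intro conjI ballI impI)
  assume P: "OKt_irreducible K [:c:]"
  show "c \<in> R" using irreducible_mem[OF P] unfolding OKt_iff by (metis coeff_pCons_0)
  show "c \<noteq> 0" using irreducible_nz[OF P] by simp
  show "c \<notin> nf_units K" using irreducible_not_unit[OF P] by (simp add: const_unit_iff)
  fix x y assume "x \<in> R" "y \<in> R" "c = x * y"
  hence "OKt_unit K [:x:] \<or> OKt_unit K [:y:]"
    by (intro irreducibleD[OF P]) (auto intro: OKt_closed)
  thus "x \<in> nf_units K \<or> y \<in> nf_units K" by (simp add: const_unit_iff)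
qed

lemma const_not_rdvd_irreducible:
  assumes P: "OKt_irreducible K P" "degree P > 0" and p: "irr \<pi>"
  shows "\<not> [:\<pi>:] rdvd P"
proof
  assume "[:\<pi>:] rdvd P"
  then obtain S where S: "S \<in> OKt K" "P = [:\<pi>:] * S" by (rule rdvdE)
  have "[:\<pi>:] \<in> OKt K" using p by (auto simp: irr_def intro: OKt_closed)
  from irreducibleD[OF P(1) this S] p have "OKt_unit K S" by (auto simp: irr_def const_unit_iff)
  then obtain \<epsilon> where "S = [:\<epsilon>:]" unfolding unit_iff by auto
  thus False using S(2) P(2) by simp
qed

text \<open>A nonconstant irreducible polynomial has no constant irreducible factor, so each
  irreducible factor of \<open>c\<close> divides the cofactor and can be cancelled.\<close>

lemma rdvd_cancel_const:
  assumes P: "OKt_irreducible K P" "degree P > 0"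
    and "c \<in> R" "c \<noteq> 0" "B \<in> OKt K" "P rdvd smult c B"
  shows "P rdvd B"
  using assms(3-6)
proof (induction "N c" arbitrary: c rule: less_induct)
  case less
  obtain S where S: "S \<in> OKt K" "smult c B = P * S" using less.prems(4) by (rule rdvdE)
  show ?case
  proof (cases "c \<in> nf_units K")
    case True
    then obtain d where d: "d \<in> R" "c * d = 1" by (auto simp: nf_units_def R_def)
    have "B = smult (d * c) B" using d by (simp add: mult.commute)
    also have "\<dots> = P * smult d S" using S(2) by (simp flip: smult_smult)
    finally show ?thesis using d S by (intro rdvdI[of "smult d S"]) (auto intro: OKt_closed)
  next
    case False
    obtain \<pi> c' where p: "irr \<pi>" "c' \<in> R" "c' \<noteq> 0" "c = \<pi> * c'" "N c' < N c"
      using irr_divisor_exists[OF less.prems(1,2) False] by blast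
    have p0: "\<pi> \<noteq> 0" using p(1) by (simp add: irr_def)
    have "P * S = [:\<pi>:] * smult c' B" unfolding S(2)[symmetric] p(4) by (simp add: mult.commute)
    hence "[:\<pi>:] rdvd P * S" using p(2) less.prems(3) by (intro rdvdI[of "smult c' B"]) (auto intro: OKt_closed)
    hence "[:\<pi>:] rdvd S"
      using irr_const_prime[OF p(1) irreducible_mem[OF P(1)] S(1)] const_not_rdvd_irreducible[OF P p(1)] by blast
    then obtain S' where S': "S' \<in> OKt K" "S = [:\<pi>:] * S'" by (rule rdvdE)
    have "smult \<pi> (smult c' B) = smult \<pi> (P * S')" using S(2) unfolding p(4) S'(2) by simp
    hence "smult c' B = P * S'" using p0 by (rule smult_cancel[rotated])
    thus ?thesis using less.hyps[OF p(5,2,3) less.prems(3)] S' rdvdI by blast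
  qed
qed

text \<open>Every irreducible factor of \<open>c\<close> divides \<open>Q\<close> or
  \<open>F\<close> and is removed from it, which turns a factorization up to a constant into a
  factorization of \<open>P\<close>. The constant \<open>c1\<close> records what was removed from
  \<open>F\<close>.\<close>

lemma clear_const_of_product:
  assumes "c \<in> R" "c \<noteq> 0" "Q \<in> OKt K" "F \<in> OKt K" "P \<in> OKt K" "smult c P = Q * F"
  shows "\<exists>Q'\<in>OKt K. \<exists>F'\<in>OKt K. \<exists>c1\<in>R. P = Q' * F' \<and> F = smult c1 F'"
  using assms
proof (induction "N c" arbitrary: c Q F rule: less_induct)
  case less
  show ?case
  proof (cases "c \<in> nf_units K")
    case True
    then obtain d where d: "d \<in> R" "c * d = 1" by (auto simp: nf_units_def R_def)
    have "P = smult (d * c) P" using d by (simp add: mult.commute)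
    also have "\<dots> = smult d Q * F" using less.prems(6) by (simp flip: smult_smult)
    finally show ?thesis using d less.prems
      by (intro bexI[of _ "smult d Q"] bexI[of _ F] bexI[of _ 1]) (auto intro: OKt_closed R_closed)
  next
    case False
    obtain \<pi> c' where p: "irr \<pi>" "c' \<in> R" "c' \<noteq> 0" "c = \<pi> * c'" "N c' < N c"
      using irr_divisor_exists[OF less.prems(1,2) False] by blast
    have p0: "\<pi> \<noteq> 0" "\<pi> \<in> R" using p(1) by (auto simp: irr_def)
    have "Q * F = [:\<pi>:] * smult c' P" unfolding less.prems(6)[symmetric] p(4) by (simp add: mult.commute)
    hence "[:\<pi>:] rdvd Q * F" using p(2) less.prems(5) by (intro rdvdI[of "smult c' P"]) (auto intro: OKt_closed)
    hence "[:\<pi>:] rdvd Q \<or> [:\<pi>:] rdvd F"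
      using irr_const_prime[OF p(1) less.prems(3,4)] by blast
    thus ?thesis
    proof
      assume "[:\<pi>:] rdvd Q"
      then obtain Q' where Q': "Q' \<in> OKt K" "Q = [:\<pi>:] * Q'" by (rule rdvdE)
      have "smult \<pi> (smult c' P) = smult \<pi> (Q' * F)" using less.prems(6) unfolding p(4) Q'(2) by simp
      hence "smult c' P = Q' * F" using p0(1) by (rule smult_cancel[rotated])
      thus ?thesis using less.hyps[OF p(5,2,3) Q'(1) less.prems(4,5)] by blast
    next
      assume "[:\<pi>:] rdvd F"
      then obtain F' where F': "F' \<in> OKt K" "F = [:\<pi>:] * F'" by (rule rdvdE)
      have "smult \<pi> (smult c' P) = smult \<pi> (Q * F')" using less.prems(6) unfolding p(4) F'(2) by simp
      hence "smult c' P = Q * F'" using p0(1) by (rule smult_cancel[rotated])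
      then obtain Q1 F1 c1 where *: "Q1 \<in> OKt K" "F1 \<in> OKt K" "c1 \<in> R" "P = Q1 * F1" "F' = smult c1 F1"
        using less.hyps[OF p(5,2,3) less.prems(3) F'(1) less.prems(5)] by blast
      have "F = smult (\<pi> * c1) F1" using F'(2) *(5) by (simp add: mult.commute)
      thus ?thesis using * p0 R_closed(4) by blast
    qed
  qed
qed

text \<open>The set \<open>J\<close> of all \<open>F\<close> with \<open>P\<close> dividing \<open>c F B\<close> for some constant \<open>c \<noteq> 0\<close> is an ideal.
  Up to constants it is generated by an element of minimal degree, which divides \<open>P\<close>.\<close>

lemma irreducible_prime:
  assumes P: "OKt_irreducible K P" and AB: "A \<in> OKt K" "B \<in> OKt K" and dvd: "P rdvd A * B"
  shows "P rdvd A \<or> P rdvd B"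
proof (cases "degree P = 0")
  case True
  then obtain \<pi> where "P = [:\<pi>:]" by (rule degree_eq_zeroE)
  thus ?thesis using irr_const_prime[OF _ AB] irreducible_const_irr P dvd by blast
next
  case False
  hence deg: "degree P > 0" by simp
  have PO: "P \<in> OKt K" and P0: "P \<noteq> 0" using irreducible_mem[OF P] irreducible_nz[OF P] .
  define J where "J = {F \<in> OKt K. \<exists>c\<in>R. c \<noteq> 0 \<and> P rdvd smult c (F * B)}"
  have J_comb: "A1 * F + A2 * F' \<in> J" if "F \<in> J" "F' \<in> J" "A1 \<in> OKt K" "A2 \<in> OKt K" for F F' A1 A2
  proof -
    obtain c c' where c: "c \<in> R" "c \<noteq> 0" "P rdvd smult c (F * B)" and c': "c' \<in> R" "c' \<noteq> 0" "P rdvd smult c' (F' * B)"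
      using \<open>F \<in> J\<close> \<open>F' \<in> J\<close> unfolding J_def by auto
    have O: "F \<in> OKt K" "F' \<in> OKt K" using \<open>F \<in> J\<close> \<open>F' \<in> J\<close> unfolding J_def by auto
    have "P rdvd smult c (F * B) * (smult c' A1)"
      using c' \<open>A1 \<in> OKt K\<close> c(3) by (intro rdvd_mult_right) (auto intro: OKt_closed)
    moreover have "P rdvd smult c' (F' * B) * (smult c A2)"
      using c \<open>A2 \<in> OKt K\<close> c'(3) by (intro rdvd_mult_right) (auto intro: OKt_closed)
    ultimately have "P rdvd smult c (F * B) * (smult c' A1) + smult c' (F' * B) * (smult c A2)" by (rule rdvd_add)
    moreover have "smult c (F * B) * (smult c' A1) + smult c' (F' * B) * (smult c A2) = smult (c * c') ((A1 * F + A2 * F') * B)"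
      by (simp add: algebra_simps smult_add_right)
    ultimately show ?thesis unfolding J_def using c c' O that(3,4) R_closed(4)
      by (auto intro!: OKt_closed bexI[of _ "c * c'"])
  qed
  have "P \<in> J" unfolding J_def using PO AB(2) R_closed(2) by (auto intro!: bexI[of _ 1] rdvdI[of B])
  have "A \<in> J" unfolding J_def using AB dvd R_closed(2) by (auto intro!: bexI[of _ 1])
  obtain F0 where F0: "F0 \<in> J" "F0 \<noteq> 0" "\<And>F. F \<in> J \<Longrightarrow> F \<noteq> 0 \<Longrightarrow> degree F0 \<le> degree F"
    using exists_least_iff[of "\<lambda>n. \<exists>F\<in>J. F \<noteq> 0 \<and> degree F = n"] \<open>P \<in> J\<close> P0 by (metis not_le)
  define l where "l = lead_coeff F0"
  have F0O: "F0 \<in> OKt K" using F0(1) by (simp add: J_def)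
  have l: "l \<in> R" "l \<noteq> 0" using F0O F0(2) by (auto simp: l_def OKt_iff)
  \<comment> \<open>Pseudo-division by \<open>F0\<close>: the leading coefficient \<open>l\<close>
    may fail to be a unit, so each step multiplies by it, and the result holds up to a constant
    \<open>c\<close>.\<close>
  have gen: "\<exists>c\<in>R. \<exists>Q\<in>OKt K. c \<noteq> 0 \<and> smult c F = Q * F0" if "F \<in> J" for F
    using that
  proof (induction "degree F" arbitrary: F rule: less_induct)
    case less
    show ?case
    proof (cases "F = 0")
      case True
      thus ?thesis using R_closed(2) OKt_closed(1) by (intro bexI[of _ 1] bexI[of _ 0]) auto
    next
      case False
      have FO: "F \<in> OKt K" using less.prems by (simp add: J_def)
      have le: "degree F0 \<le> degree F" by (rule F0(3)[OF less.prems False])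
      define M where "M = monom (lead_coeff F) (degree F - degree F0)"
      have MO: "M \<in> OKt K" using FO by (auto simp: M_def OKt_iff R_closed)
      define F' where "F' = [:l:] * F + (- M) * F0"
      have F'J: "F' \<in> J" unfolding F'_def using less.prems F0(1) MO l by (intro J_comb) (auto intro: OKt_closed)
      have F'eq: "smult l F = M * F0 + F'" by (simp add: F'_def)
      show ?thesis
      proof (cases "F' = 0")
        case True
        thus ?thesis using F'eq l MO by (intro bexI[of _ l] bexI[of _ M]) auto
      next
        case F'0: False
        have "degree (M * F0) = degree F"
          using False F0(2) le by (simp add: M_def degree_mult_eq degree_monom_eq monom_eq_0_iff)
        moreover have "coeff (M * F0) (degree F) = l * lead_coeff F"
          using le by (simp add: M_def coeff_monom_mult l_def)
        ultimately have "degree F' \<le> degree F" "coeff F' (degree F) = 0"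
          unfolding F'_def by (auto intro!: degree_diff_le)
        hence lt: "degree F' < degree F"
          using F'0 by (metis leading_coeff_0_iff le_neq_implies_less)
        obtain c Q where cQ: "c \<in> R" "Q \<in> OKt K" "c \<noteq> 0" "smult c F' = Q * F0"
          using less.hyps[OF lt F'J] by blast
        have "smult (c * l) F = (smult c M + Q) * F0"
          using F'eq cQ(4) by (simp add: algebra_simps smult_add_right flip: smult_smult)
        thus ?thesis using cQ l MO R_closed(4) 
          by (intro bexI[of _ "c * l"] bexI[of _ "smult c M + Q"]) (auto intro: OKt_closed)
      qed
    qed
  qed
  obtain c Q where cQ: "c \<in> R" "Q \<in> OKt K" "c \<noteq> 0" "smult c P = Q * F0"
    using gen[OF \<open>P \<in> J\<close>] by blast
  \<comment> \<open>Once constants are cleared, irreducibility of \<open>P\<close> applies. If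
    \<open>F'\<close> is a unit, then \<open>F0\<close> is a constant in \<open>J\<close>, and
    \<open>P\<close> divides a constant multiple of \<open>B\<close>. If \<open>Q'\<close> is a
    unit, then \<open>P\<close> itself generates \<open>J\<close> up to constants, and
    \<open>A\<close> lies in \<open>J\<close>.\<close>
  obtain Q' F' c1 where QF: "Q' \<in> OKt K" "F' \<in> OKt K" "c1 \<in> R" "P = Q' * F'" "F0 = smult c1 F'"
    using clear_const_of_product[OF cQ(1,3,2) F0O PO cQ(4)] by blast
  from irreducibleD[OF P QF(1,2,4)] show ?thesis
  proof
    assume "OKt_unit K F'"
    then obtain \<epsilon> where e: "\<epsilon> \<in> nf_units K" "F' = [:\<epsilon>:]" unfolding unit_iff by auto
    have F0c: "F0 = [:c1 * \<epsilon>:]" using QF(5) e by simp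
    obtain d where d: "d \<in> R" "d \<noteq> 0" "P rdvd smult d (F0 * B)" using F0(1) unfolding J_def by auto
    have "smult d (F0 * B) = smult (d * (c1 * \<epsilon>)) B" unfolding F0c by simp
    moreover have "d * (c1 * \<epsilon>) \<in> R" "d * (c1 * \<epsilon>) \<noteq> 0"
      using d QF(3) e(1) F0(2) F0c R_closed(4) by (auto simp: nf_units_def R_def)
    ultimately have "P rdvd B" using rdvd_cancel_const[OF P deg] AB(2) d(3) by metis
    thus ?thesis ..
  next
    assume "OKt_unit K Q'"
    then obtain u where u: "OKt_unit K u" "Q' * u = 1" using unit_inverse by blast
    have F'P: "F' = P * u" unfolding QF(4) using u(2) by (metis mult.assoc mult.commute mult_1)
    obtain d Q2 where d: "d \<in> R" "Q2 \<in> OKt K" "d \<noteq> 0" "smult d A = Q2 * F0"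
      using gen[OF \<open>A \<in> J\<close>] by blast
    have "smult d A = P * (smult c1 (u * Q2))" unfolding d(4) QF(5) F'P by (simp add: mult_ac)
    hence "P rdvd smult d A" using d QF(3) unit_mem[OF u(1)] by (intro rdvdI[of "smult c1 (u * Q2)"]) (auto intro: OKt_closed)
    hence "P rdvd A" using rdvd_cancel_const[OF P deg d(1,3) AB(1)] by blast
    thus ?thesis ..
  qed
qed

text \<open>A size that grows under multiplication by any nonunit: a nonconstant factor raises the
  degree, a constant one the norm of the leading coefficient.\<close>

definition \<mu> :: "complex poly \<Rightarrow> nat" where "\<mu> P = degree P + N (lead_coeff P)"

lemma lead_R: "P \<in> OKt K \<Longrightarrow> lead_coeff P \<in> R" by (simp add: OKt_iff)

lemma \<mu>_less:
  assumes "P \<in> OKt K" "Q \<in> OKt K" "P \<noteq> 0" "Q \<noteq> 0" "\<not> OKt_unit K Q"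
  shows "\<mu> P < \<mu> (P * Q)"
proof -
  have NP: "N (lead_coeff P) > 0" and NQ: "N (lead_coeff Q) > 0"
    using N_pos lead_R assms by auto
  have eq: "\<mu> (P * Q) = degree P + degree Q + N (lead_coeff P) * N (lead_coeff Q)"
    unfolding \<mu>_def lead_coeff_mult N_mult[OF lead_R[OF assms(1)] lead_R[OF assms(2)]]
    using assms by (simp add: degree_mult_eq)
  show ?thesis
  proof (cases "degree Q = 0")
    case True
    then obtain c where c: "Q = [:c:]" by (rule degree_eq_zeroE)
    have "N c \<noteq> 1" using assms N_unit[of c] lead_R[OF assms(2)] by (auto simp: c const_unit_iff)
    hence "N (lead_coeff Q) > 1" using NQ c by simp
    hence "N (lead_coeff P) * 1 < N (lead_coeff P) * N (lead_coeff Q)" using NP by (simp only: mult_less_cancel1)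
    moreover have "\<mu> P = degree P + N (lead_coeff P)" by (simp add: \<mu>_def)
    ultimately show ?thesis unfolding eq by linarith
  next
    case False
    have "N (lead_coeff P) \<le> N (lead_coeff P) * N (lead_coeff Q)" using NQ by simp
    moreover have "\<mu> P = degree P + N (lead_coeff P)" by (simp add: \<mu>_def)
    ultimately show ?thesis using False unfolding eq by linarith
  qed
qed

lemma irreducible_divisor_exists:
  assumes "A \<in> OKt K" "A \<noteq> 0" "\<not> OKt_unit K A"
  obtains P where "OKt_irreducible K P" "P rdvd A"
proof -
  have "\<exists>P. OKt_irreducible K P \<and> P rdvd A"
    using assms
  proof (induction "\<mu> A" arbitrary: A rule: less_induct)
    case less
    show ?case
    proof (cases "OKt_irreducible K A")
      case True
      thus ?thesis using rdvd_refl by blast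
    next
      case False
      then obtain Q S where QS: "Q \<in> OKt K" "S \<in> OKt K" "A = Q * S" "\<not> OKt_unit K Q" "\<not> OKt_unit K S"
        using less.prems unfolding OKt_irreducible_def by blast
      have nz: "Q \<noteq> 0" "S \<noteq> 0" using QS less.prems by auto
      have "\<mu> Q < \<mu> A" unfolding QS(3) by (rule \<mu>_less[OF QS(1,2) nz QS(5)])
      from less.hyps[OF this QS(1) nz(1) QS(4)] show ?thesis
        using rdvd_mult_right[OF QS(2)] QS(3) by blast
    qed
  qed
  thus thesis using that by blast
qed

lemma squarefree_decomposition:
  assumes "A \<in> OKt K" "A \<noteq> 0"
  obtains s k where "s \<in> OKt K" "k \<in> OKt K" "A = s * k ^ 2" "\<And>P. OKt_irreducible K P \<Longrightarrow> \<not> P ^ 2 rdvd s"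
proof -
  have "\<exists>s\<in>OKt K. \<exists>k\<in>OKt K. A = s * k ^ 2 \<and> (\<forall>P. OKt_irreducible K P \<longrightarrow> \<not> P ^ 2 rdvd s)"
    using assms
  proof (induction "\<mu> A" arbitrary: A rule: less_induct)
    case less
    show ?case
    proof (cases "\<exists>P. OKt_irreducible K P \<and> P ^ 2 rdvd A")
      case False
      thus ?thesis using less.prems OKt_closed(2) by (intro bexI[of _ A] bexI[of _ 1]) auto
    next
      case True
      then obtain P where P: "OKt_irreducible K P" "P ^ 2 rdvd A" by blast
      then obtain S where S: "S \<in> OKt K" "A = P ^ 2 * S" by (auto elim: rdvdE)
      have nz: "S \<noteq> 0" "P ^ 2 \<noteq> 0" using S less.prems by auto
      have PO: "P \<in> OKt K" by (rule irreducible_mem[OF P(1)])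
      have "\<not> OKt_unit K (P ^ 2)"
        using unit_of_mult[OF PO PO] irreducible_not_unit[OF P(1)] by (auto simp: power2_eq_square)
      hence "\<mu> S < \<mu> A" unfolding S(2) using \<mu>_less[OF S(1) OKt_power[OF PO] nz] by (simp add: mult.commute)
      from less.hyps[OF this S(1) nz(1)] obtain s k where
        sk: "s \<in> OKt K" "k \<in> OKt K" "S = s * k ^ 2" "\<forall>P. OKt_irreducible K P \<longrightarrow> \<not> P ^ 2 rdvd s" by blast
      have "A = s * (P * k) ^ 2" unfolding S(2) sk(3) by (simp add: power_mult_distrib mult_ac)
      thus ?thesis using sk OKt_closed(4)[OF PO sk(2)] by blast
    qed
  qed
  thus thesis using that by blast
qed

lemma irreducible_dvd_power:
  assumes "OKt_irreducible K P" "A \<in> OKt K" "P rdvd A ^ n"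
  shows "P rdvd A"
  using assms(3)
proof (induction n)
  case 0
  then obtain S where "S \<in> OKt K" "1 = P * S" by (auto elim: rdvdE)
  hence "OKt_unit K P" unfolding OKt_unit_def using irreducible_mem[OF assms(1)] by auto
  thus ?case using irreducible_not_unit[OF assms(1)] by blast
next
  case (Suc n)
  thus ?case using irreducible_prime[OF assms(1,2) OKt_power[OF assms(2)]] by auto
qed

text \<open>Odd powers of a prime do not occur in squares. By descent, \<open>P\<close> divides
  \<open>y\<close>, then \<open>z\<close>, and can be cancelled from both.\<close>

lemma square_parity:
  assumes P: "OKt_irreducible K P" and x: "x \<in> OKt K" "\<not> P rdvd x"
    and "y \<in> OKt K" "z \<in> OKt K" "z \<noteq> 0" "y ^ 2 = P * x * z ^ 2"
  shows False
  using assms(4-7)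
proof (induction "\<mu> z" arbitrary: y z rule: less_induct)
  case less
  have PO: "P \<in> OKt K" and P0: "P \<noteq> 0" using irreducible_mem[OF P] irreducible_nz[OF P] .
  have "P rdvd y ^ 2" unfolding less.prems(4) using x less.prems
    by (intro rdvdI[of "x * z ^ 2"]) (auto intro: OKt_closed OKt_power simp: mult_ac)
  hence "P rdvd y" by (rule irreducible_dvd_power[OF P less.prems(1)])
  then obtain y' where y': "y' \<in> OKt K" "y = P * y'" by (rule rdvdE)
  have "P * (P * y' ^ 2) = P * (x * z ^ 2)"
    using less.prems(4) unfolding y'(2) by (simp add: power2_eq_square mult_ac)
  hence eq: "P * y' ^ 2 = x * z ^ 2" using P0 by simp
  hence "P rdvd x * z ^ 2" using y' by (intro rdvdI[of "y' ^ 2"]) (auto intro: OKt_power)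
  hence "P rdvd z ^ 2" using irreducible_prime[OF P x(1) OKt_power[OF less.prems(2)]] x(2) by blast
  hence "P rdvd z" by (rule irreducible_dvd_power[OF P less.prems(2)])
  then obtain z' where z': "z' \<in> OKt K" "z = P * z'" by (rule rdvdE)
  have z'0: "z' \<noteq> 0" using z' less.prems(3) by auto
  have "P * y' ^ 2 = P * (P * x * z' ^ 2)" unfolding eq z'(2) by (simp add: power2_eq_square mult_ac)
  hence eq': "y' ^ 2 = P * x * z' ^ 2" using P0 by simp
  have "\<mu> z' < \<mu> z" unfolding z'(2) using \<mu>_less[OF z'(1) PO z'0 P0 irreducible_not_unit[OF P]] by (simp add: mult.commute)
  from less.hyps[OF this y'(1) z'(1) z'0 eq'] show False .
qed

text \<open>A prime that divides \<open>s\<close> but not the product of the other, nonassociate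
  primes has to divide the cofactor.\<close>

lemma prod_irreducibles_rdvd:
  assumes "finite U" "\<And>Q. Q \<in> U \<Longrightarrow> OKt_irreducible K Q" "\<And>Q. Q \<in> U \<Longrightarrow> Q rdvd s"
    "\<And>Q Q'. Q \<in> U \<Longrightarrow> Q' \<in> U \<Longrightarrow> Q \<noteq> Q' \<Longrightarrow> \<not> OKt_assoc K Q Q'" "s \<in> OKt K"
  shows "\<Prod>U rdvd s"
  using assms
proof (induction U rule: finite_induct)
  case empty
  thus ?case by (intro rdvdI[of s]) auto
next
  case (insert Q U)
  have irr: "OKt_irreducible K Q" by (rule insert.prems(1)) simp
  have "\<Prod>U rdvd s" by (rule insert.IH) (use insert.prems in auto)
  then obtain x where x: "x \<in> OKt K" "s = \<Prod>U * x" by (rule rdvdE)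
  have UO: "\<Prod>U \<in> OKt K" using insert.prems(1) by (intro OKt_prod) (auto intro: irreducible_mem)
  have "\<not> Q rdvd \<Prod>V" if "V \<subseteq> U" "finite V" for V
    using that(2,1)
  proof (induction V rule: finite_induct)
    case empty
    show ?case using irreducible_dvd_power[OF irr OKt_closed(2), of 0] 
      irreducible_not_unit[OF irr] irreducible_mem[OF irr] unfolding OKt_unit_def rdvd_def by auto
  next
    case (insert Q' V)
    have Q': "OKt_irreducible K Q'" by (rule \<open>\<And>Q'. Q' \<in> insert Q U \<Longrightarrow> OKt_irreducible K Q'\<close>) (use insert in auto)
    have "\<not> Q rdvd Q'"
    proof
      assume "Q rdvd Q'"
      hence "OKt_assoc K Q Q'" by (rule irreducible_rdvd_imp_assoc[OF irr Q'])
      moreover have "Q \<noteq> Q'" using insert \<open>Q \<notin> U\<close> by auto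
      ultimately show False using \<open>\<And>S S'. S \<in> insert Q U \<Longrightarrow> S' \<in> insert Q U \<Longrightarrow> S \<noteq> S' \<Longrightarrow> \<not> OKt_assoc K S S'\<close>[of Q Q'] insert by auto
    qed
    moreover have "\<Prod>V \<in> OKt K"
      by (intro OKt_prod irreducible_mem \<open>\<And>Q'. Q' \<in> insert Q U \<Longrightarrow> OKt_irreducible K Q'\<close>) (use insert in auto)
    ultimately show ?case using insert irreducible_prime[OF irr irreducible_mem[OF Q']] by auto
  qed
  hence "\<not> Q rdvd \<Prod>U" using insert.hyps by blast
  moreover have "Q rdvd \<Prod>U * x" using insert.prems(2)[of Q] x by simp
  ultimately have "Q rdvd x" using irreducible_prime[OF irr UO x(1)] by blast
  then obtain x' where "x' \<in> OKt K" "x = Q * x'" by (rule rdvdE)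
  thus ?case using x insert.hyps by (intro rdvdI[of x']) (auto simp: mult_ac)
qed

end

subsection \<open>Cyclic cubic fields\<close>
interpretation of_rat_poly_hom: map_poly_inj_idom_hom "of_rat :: rat \<Rightarrow> complex" ..

text \<open>The left side is the value, at the root \<open>x\<close>, of the cofactor of the
  derivative in \<open>cubic_disc_combination\<close>, that is, the discriminant divided by
  \<open>f'(x)\<close>.\<close>

lemma cubic_conjugate_identity:
  fixes x y z :: "'a :: comm_ring_1"
  assumes a: "a = - (x + y + z)" and b: "b = x * y + y * z + z * x" and c: "c = - (x * y * z)"
  shows "(2 * a^2 - 6 * b) * x ^ 2 + (2 * a^3 - 7 * a * b + 9 * c) * x + (a^2 * b + 3 * a * c - 4 * b^2)
     = (x - y) * (x - z) * (y - z) ^ 2"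
  unfolding a b c by (simp add: algebra_simps eval_nat_numeral)

lemma cubic_disc_roots:
  fixes x y z :: "'a :: comm_ring_1"
  assumes a: "a = - (x + y + z)" and b: "b = x * y + y * z + z * x" and c: "c = - (x * y * z)"
  shows "cubic_disc a b c = ((x - y) * (y - z) * (z - x)) ^ 2"
  unfolding cubic_disc_def a b c by (simp add: algebra_simps eval_nat_numeral)

text \<open>An integer square root \<open>e\<close> of the discriminant is what makes the field
  cyclic. The equation for \<open>e\<close> ties its sign to the cyclic order of the roots, and
  thereby to the automorphism \<rho> that moves \<theta>1 to \<theta>2.\<close>

locale cyclic_cubic =
  fixes a b c e :: int and \<theta>1 \<theta>2 \<theta>3 :: complex and K :: "complex set"
  assumes irr: "irreducible (of_int_poly [:c, b, a, 1:] :: rat poly)"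
    and a_eq: "of_int a = - (\<theta>1 + \<theta>2 + \<theta>3)"
    and b_eq: "of_int b = \<theta>1 * \<theta>2 + \<theta>2 * \<theta>3 + \<theta>3 * \<theta>1"
    and c_eq: "of_int c = - (\<theta>1 * \<theta>2 * \<theta>3)"
    and e_eq: "of_int e = (\<theta>1 - \<theta>2) * (\<theta>2 - \<theta>3) * (\<theta>3 - \<theta>1)"
    and e0: "e \<noteq> 0"
    and K_split: "K = splitting_field_C [:c, b, a, 1:]"
begin

abbreviation ev :: "rat poly \<Rightarrow> complex \<Rightarrow> complex" where "ev F z \<equiv> poly (map_poly of_rat F) z"

definition fQ :: "rat poly" where "fQ = of_int_poly [:c, b, a, 1:]"

lemma f_eval: "poly (of_int_poly [:c, b, a, 1:]) z = (z - \<theta>1) * (z - \<theta>2) * (z - \<theta>3)"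
proof -
  have "poly (of_int_poly [:c, b, a, 1:]) z = of_int c + z * (of_int b + z * (of_int a + z))"
    by (simp add: hom_distribs)
  thus ?thesis unfolding a_eq b_eq c_eq by (simp add: algebra_simps)
qed

lemma fQ_eval: "ev fQ z = (z - \<theta>1) * (z - \<theta>2) * (z - \<theta>3)"
proof -
  have "map_poly of_rat fQ = (of_int_poly [:c, b, a, 1:] :: complex poly)"
    by (simp add: fQ_def hom_distribs)
  thus ?thesis by (simp only: f_eval)
qed

lemma distinct: "\<theta>1 \<noteq> \<theta>2" "\<theta>2 \<noteq> \<theta>3" "\<theta>3 \<noteq> \<theta>1"
proof -
  have "(\<theta>1 - \<theta>2) * (\<theta>2 - \<theta>3) * (\<theta>3 - \<theta>1) \<noteq> 0" using e_eq e0 by (metis of_int_eq_0_iff)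
  thus "\<theta>1 \<noteq> \<theta>2" "\<theta>2 \<noteq> \<theta>3" "\<theta>3 \<noteq> \<theta>1" by auto
qed

lemma bezout_fQ:
  assumes "\<not> fQ dvd F"
  obtains u v where "u * F + v * fQ = 1"
proof -
  have "prime_elem fQ" using irr unfolding fQ_def[symmetric] by (rule irreducible_imp_prime_elem)
  hence "coprime fQ F" using assms by (rule prime_elem_imp_coprime)
  hence "gcd fQ F = 1" by simp
  thus thesis using that bezout_coefficients_fst_snd[of fQ F] by (metis add.commute)
qed

lemma root_imp_dvd: 
  assumes "ev F z = 0" "z \<in> {\<theta>1, \<theta>2, \<theta>3}"
  shows "fQ dvd F"
proof (rule ccontr)
  assume "\<not> fQ dvd F"
  then obtain u v where "u * F + v * fQ = 1" by (rule bezout_fQ)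
  hence "ev (u * F + v * fQ) z = ev 1 z" by simp
  moreover have "ev fQ z = 0" using assms(2) unfolding fQ_eval by auto
  ultimately show False using assms(1) by (simp add: hom_distribs)
qed

text \<open>The three roots share the minimal polynomial \<open>fQ\<close>, so a rational relation
  at one root holds at all. This makes \<rho> well defined.\<close>

lemma ev_eq_transfer:
  assumes "ev F z = ev G z" "z \<in> {\<theta>1, \<theta>2, \<theta>3}" "w \<in> {\<theta>1, \<theta>2, \<theta>3}"
  shows "ev F w = ev G w"
proof -
  have "ev (F - G) z = 0" using assms(1) by (simp add: hom_distribs)
  then obtain H where "F - G = fQ * H" using root_imp_dvd[OF _ assms(2)] by (auto elim: dvdE)
  hence "ev (F - G) w = ev fQ w * ev H w" by (simp add: hom_distribs)
  also have "ev fQ w = 0" using assms(3) unfolding fQ_eval by auto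
  finally show ?thesis by (simp add: hom_distribs)
qed

text \<open>Let \<open>t\<close> be the cofactor of \<open>f'\<close> in the combination of \<open>f\<close> and \<open>f'\<close> that gives the discriminant
  \<open>e\<^sup>2\<close>. Then \<open>\<theta>2 - \<theta>3 = - e / f'(\<theta>1) = - t(\<theta>1) / e\<close> and \<open>\<theta>2 + \<theta>3 = - a - \<theta>1\<close> express \<open>\<theta>2\<close> by \<open>\<theta>1\<close>.\<close>

definition T :: "rat poly" where
  "T = smult (1 / 2) (- [:of_int a, 1:] - smult (1 / of_int e)
      [:of_int (a^2 * b + 3 * a * c - 4 * b^2), of_int (2 * a^3 - 7 * a * b + 9 * c), of_int (2 * a^2 - 6 * b):])"

lemma T_eval_aux:
  assumes a: "of_int a = - (x + y + z)" and b: "of_int b = x * y + y * z + z * x" and c: "of_int c = - (x * y * z)"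
    and e: "of_int e = (x - y) * (y - z) * (z - x)"
  shows "ev T x = y"
proof -
  have "of_int ((2 * a^2 - 6 * b)) * x ^ 2 + of_int (2 * a^3 - 7 * a * b + 9 * c) * x + of_int (a^2 * b + 3 * a * c - 4 * b^2)
     = (x - y) * (x - z) * (y - z) ^ 2"
    using cubic_conjugate_identity[OF a b c] by simp
  also have "\<dots> = - of_int e * (y - z)" unfolding e by (simp add: algebra_simps power2_eq_square)
  finally have t: "of_int ((2 * a^2 - 6 * b)) * x ^ 2 + of_int (2 * a^3 - 7 * a * b + 9 * c) * x + of_int (a^2 * b + 3 * a * c - 4 * b^2)
     = - of_int e * (y - z)" .
  have "ev T x = (- (of_int a + x) - (of_int ((2 * a^2 - 6 * b)) * x ^ 2 + of_int (2 * a^3 - 7 * a * b + 9 * c) * x + of_int (a^2 * b + 3 * a * c - 4 * b^2)) / of_int e) / 2"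
    unfolding T_def by (simp add: hom_distribs algebra_simps power2_eq_square add_divide_distrib diff_divide_distrib)
  also have "\<dots> = (- (of_int a + x) + (y - z)) / 2" unfolding t using e0 by simp
  also have "\<dots> = y" unfolding a by simp
  finally show ?thesis .
qed

lemma T_eval: "ev T \<theta>1 = \<theta>2" "ev T \<theta>2 = \<theta>3" "ev T \<theta>3 = \<theta>1"
proof -
  show "ev T \<theta>1 = \<theta>2" by (rule T_eval_aux[OF a_eq b_eq c_eq e_eq])
  show "ev T \<theta>2 = \<theta>3" by (rule T_eval_aux[where z = \<theta>1]) (simp_all add: a_eq b_eq c_eq e_eq)
  show "ev T \<theta>3 = \<theta>1" by (rule T_eval_aux[where z = \<theta>2]) (simp_all add: a_eq b_eq c_eq e_eq)
qed

lemma ev_pcompose: "ev (F \<circ>\<^sub>p G) z = ev F (ev G z)"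
  by (simp add: hom_distribs poly_pcompose)

lemma ev_\<theta>2: "ev F \<theta>2 = ev (F \<circ>\<^sub>p T) \<theta>1" by (simp add: ev_pcompose T_eval)
lemma ev_\<theta>3: "ev F \<theta>3 = ev (F \<circ>\<^sub>p T) \<theta>2" by (simp add: ev_pcompose T_eval)
lemma ev_\<theta>1: "ev F \<theta>1 = ev (F \<circ>\<^sub>p T) \<theta>3" by (simp add: ev_pcompose T_eval)

text \<open>The other roots are polynomials in \<theta>1 by \<open>T\<close>, and Bezout with the
  irreducible \<open>fQ\<close> gives inverses.\<close>

lemma K_eq: "K = range (\<lambda>F. ev F \<theta>1)"
proof
  have sub: "subfield_C (range (\<lambda>F. ev F \<theta>1))"
    unfolding subfield_C_def
  proof (intro conjI ballI)
    show "0 \<in> range (\<lambda>F. ev F \<theta>1)" by (intro range_eqI[of _ _ 0]) simp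
    show "1 \<in> range (\<lambda>F. ev F \<theta>1)" by (intro range_eqI[of _ _ 1]) simp
    fix x assume "x \<in> range (\<lambda>F. ev F \<theta>1)"
    then obtain F where x: "x = ev F \<theta>1" by auto
    show "- x \<in> range (\<lambda>F. ev F \<theta>1)" by (intro range_eqI[of _ _ "- F"]) (simp add: x hom_distribs)
    show "inverse x \<in> range (\<lambda>F. ev F \<theta>1)"
    proof (cases "fQ dvd F")
      case True
      then obtain H where "F = fQ * H" by (rule dvdE)
      hence "x = 0" using fQ_eval[of \<theta>1] by (simp add: x hom_distribs)
      thus ?thesis by (intro range_eqI[of _ _ 0]) simp
    next
      case False
      then obtain u v where uv: "u * F + v * fQ = 1" by (rule bezout_fQ)
      hence "ev (u * F + v * fQ) \<theta>1 = ev 1 \<theta>1" by simp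
      hence "x * ev u \<theta>1 = 1" using fQ_eval[of \<theta>1] by (simp add: x hom_distribs mult.commute)
      hence "inverse x = ev u \<theta>1" by (rule inverse_unique)
      thus ?thesis by blast
    qed
    fix y assume "y \<in> range (\<lambda>F. ev F \<theta>1)"
    then obtain G where y: "y = ev G \<theta>1" by auto
    show "x + y \<in> range (\<lambda>F. ev F \<theta>1)" by (intro range_eqI[of _ _ "F + G"]) (simp add: x y hom_distribs)
    show "x * y \<in> range (\<lambda>F. ev F \<theta>1)" by (intro range_eqI[of _ _ "F * G"]) (simp add: x y hom_distribs)
  qed
  have "\<theta>1 = ev [:0, 1:] \<theta>1" by (simp add: hom_distribs)
  moreover have "\<theta>2 = ev T \<theta>1" "\<theta>3 = ev (T \<circ>\<^sub>p T) \<theta>1"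
    by (simp_all only: ev_pcompose T_eval)
  ultimately have ids: "\<theta>1 \<in> range (\<lambda>F. ev F \<theta>1)" "\<theta>2 \<in> range (\<lambda>F. ev F \<theta>1)" "\<theta>3 \<in> range (\<lambda>F. ev F \<theta>1)"
    by (metis rangeI)+
  have "{z. poly (of_int_poly [:c, b, a, 1:]) z = 0} \<subseteq> range (\<lambda>F. ev F \<theta>1)"
  proof
    fix z :: complex assume "z \<in> {z. poly (of_int_poly [:c, b, a, 1:]) z = 0}"
    hence "(z - \<theta>1) * (z - \<theta>2) * (z - \<theta>3) = 0" unfolding f_eval by (rule CollectD)
    hence "z = \<theta>1 \<or> z = \<theta>2 \<or> z = \<theta>3" by simp
    thus "z \<in> range (\<lambda>F. ev F \<theta>1)" using ids by metis
  qed
  thus "K \<subseteq> range (\<lambda>F. ev F \<theta>1)" unfolding K_split by (rule splitting_field_C_least[OF sub])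
  have subK: "subfield_C K" unfolding K_split by (rule splitting_field_C_subfield)
  have "\<theta>1 \<in> K" unfolding K_split by (rule splitting_field_C_roots, unfold f_eval) simp
  hence "ev F \<theta>1 \<in> K" for F
  proof (induction F)
    case 0
    show ?case using subK by (simp add: subfield_C_def)
  next
    case (pCons r F)
    thus ?case using subK subfield_of_rat[OF subK, of r] unfolding subfield_C_def by (simp add: hom_distribs)
  qed
  thus "range (\<lambda>F. ev F \<theta>1) \<subseteq> K" by blast
qed

sublocale integer_ring K "ring_of_integers K"
  by unfold_locales (simp_all add: K_split splitting_field_C_subfield)

abbreviation R where "R \<equiv> ring_of_integers K"

text \<open>By \<open>ev_eq_transfer\<close> the choice of \<open>F\<close> is immaterial. The
  identity outside \<open>K\<close> is the convention of \<open>nf_Gal\<close>.\<close>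

definition \<rho> :: "complex \<Rightarrow> complex" where
  "\<rho> z = (if z \<in> K then ev (SOME F. z = ev F \<theta>1) \<theta>2 else z)"

lemma \<rho>_ev: "\<rho> (ev F \<theta>1) = ev F \<theta>2" "\<rho> (ev F \<theta>2) = ev F \<theta>3" "\<rho> (ev F \<theta>3) = ev F \<theta>1"
proof -
  show 1: "\<rho> (ev F \<theta>1) = ev F \<theta>2" for F
  proof -
    have "ev F \<theta>1 \<in> K" unfolding K_eq by blast
    moreover have "ev F \<theta>1 = ev (SOME G. ev F \<theta>1 = ev G \<theta>1) \<theta>1" by (rule someI[of _ F]) simp
    from ev_eq_transfer[OF this[symmetric], of \<theta>2] have "ev (SOME G. ev F \<theta>1 = ev G \<theta>1) \<theta>2 = ev F \<theta>2" by simp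
    ultimately show ?thesis by (simp add: \<rho>_def)
  qed
  show 2: "\<rho> (ev F \<theta>2) = ev F \<theta>3" for F
    unfolding ev_\<theta>2[of F] 1 ev_\<theta>3 ..
  show "\<rho> (ev F \<theta>3) = ev F \<theta>1"
    unfolding ev_\<theta>3[of F] 2 ev_\<theta>1 ..
qed

lemma \<rho>_outside: "z \<notin> K \<Longrightarrow> \<rho> z = z" by (simp add: \<rho>_def)

lemma in_KE: assumes "z \<in> K" obtains F where "z = ev F \<theta>1" using assms unfolding K_eq by blast

lemma ev_K: "ev F \<theta>1 \<in> K" "ev F \<theta>2 \<in> K" "ev F \<theta>3 \<in> K"
proof -
  show 1: "ev F \<theta>1 \<in> K" for F unfolding K_eq by blast
  show 2: "ev F \<theta>2 \<in> K" for F unfolding ev_\<theta>2 by (rule 1)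
  show "ev F \<theta>3 \<in> K" unfolding ev_\<theta>3 by (rule 2)
qed

lemma \<rho>_K: "z \<in> K \<Longrightarrow> \<rho> z \<in> K" by (elim in_KE) (simp add: \<rho>_ev ev_K)

lemma \<rho>3: "\<rho> (\<rho> (\<rho> z)) = z"
proof (cases "z \<in> K")
  case True
  thus ?thesis by (elim in_KE) (simp add: \<rho>_ev)
qed (simp add: \<rho>_outside)

lemma \<rho>_add: "x \<in> K \<Longrightarrow> y \<in> K \<Longrightarrow> \<rho> (x + y) = \<rho> x + \<rho> y"
proof (elim in_KE)
  fix F G assume "x = ev F \<theta>1" "y = ev G \<theta>1"
  thus ?thesis using \<rho>_ev(1)[of "F + G"] by (simp add: \<rho>_ev hom_distribs)
qed

lemma \<rho>_mult: "x \<in> K \<Longrightarrow> y \<in> K \<Longrightarrow> \<rho> (x * y) = \<rho> x * \<rho> y"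
proof (elim in_KE)
  fix F G assume "x = ev F \<theta>1" "y = ev G \<theta>1"
  thus ?thesis using \<rho>_ev(1)[of "F * G"] by (simp add: \<rho>_ev hom_distribs)
qed

lemma \<rho>_of_rat: "\<rho> (of_rat r) = of_rat r"
  using \<rho>_ev(1)[of "[:r:]"] by (simp add: hom_distribs)

lemma \<rho>_simps [simp]: "\<rho> 0 = 0" "\<rho> 1 = 1" "\<rho> (of_int n) = of_int n"
  using \<rho>_of_rat[of 0] \<rho>_of_rat[of 1] \<rho>_of_rat[of "of_int n"] by simp_all

lemma \<rho>_\<theta>: "\<rho> \<theta>1 = \<theta>2" "\<rho> \<theta>2 = \<theta>3" "\<rho> \<theta>3 = \<theta>1"
  using \<rho>_ev[of "[:0, 1:]"] by (simp_all add: hom_distribs)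

lemma \<theta>_K: "\<theta>1 \<in> K" "\<theta>2 \<in> K" "\<theta>3 \<in> K"
  using ev_K[of "[:0, 1:]"] by (simp_all add: hom_distribs)

lemma nf_hom_\<rho>: "nf_hom K \<rho>" unfolding nf_hom_def by (simp add: \<rho>_add \<rho>_mult)

lemma nf_hom_ev:
  assumes s: "nf_hom K s" and z: "z \<in> K"
  shows "s (ev F z) = ev F (s z)"
proof -
  have "ev F z \<in> K \<and> s (ev F z) = ev F (s z)"
  proof (induction F)
    case 0
    show ?case using nf_hom_of_rat[OF sub s, of 0] K_closed by simp
  next
    case (pCons r F)
    have r: "of_rat r \<in> K" by (rule subfield_of_rat[OF sub])
    have "s (of_rat r + z * ev F z) = of_rat r + s z * ev F (s z)"
      using s r z pCons.IH K_closed(4) nf_hom_of_rat[OF sub s, of r] unfolding nf_hom_def by metis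
    moreover have "of_rat r + z * ev F z \<in> K" using r z pCons.IH K_closed by blast
    ultimately show ?case by (simp add: hom_distribs)
  qed
  thus ?thesis ..
qed

text \<open>Modulo \<open>fQ\<close> the element is given by a polynomial of degree at most 2, which
  takes the same value at three distinct points and is therefore constant.\<close>

lemma fixed_imp_rational:
  assumes "z \<in> K" "\<rho> z = z"
  obtains r where "z = of_rat r"
proof -
  obtain F where F: "z = ev F \<theta>1" using assms(1) by (rule in_KE)
  define G where "G = F mod fQ"
  have degf: "degree fQ = 3" by (simp add: fQ_def)
  hence f0: "fQ \<noteq> 0" by auto
  have degG: "degree G < 3"
    using degree_mod_less'[of fQ F] f0 degf by (cases "G = 0") (auto simp: G_def)
  have "ev F w = ev G w" if "w \<in> {\<theta>1, \<theta>2, \<theta>3}" for w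
  proof -
    have "F = F div fQ * fQ + G" by (simp add: G_def)
    hence "ev F w = ev (F div fQ * fQ + G) w" by simp
    also have "\<dots> = ev (F div fQ) w * ev fQ w + ev G w" by (simp only: hom_distribs poly_add poly_mult)
    also have "ev fQ w = 0" using that unfolding fQ_eval by auto
    finally show ?thesis by simp
  qed
  moreover have "ev F \<theta>2 = z" using assms(2) unfolding F \<rho>_ev .
  moreover have "ev F \<theta>3 = z" using assms(2) \<open>ev F \<theta>2 = z\<close> \<rho>_ev(2)[of F] by simp
  ultimately have G: "ev G \<theta>1 = z" "ev G \<theta>2 = z" "ev G \<theta>3 = z" using F by auto
  define H where "H = map_poly of_rat G - [:z:]"
  have "H = 0"
  proof (rule ccontr)
    assume H0: "H \<noteq> 0"
    have "card {w. poly H w = 0} \<le> degree H" by (rule card_poly_roots_bound[OF H0])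
    also have "degree H \<le> 2" unfolding H_def using degG by (intro degree_diff_le) simp_all
    finally have "card {w. poly H w = 0} \<le> 2" .
    moreover have "card {\<theta>1, \<theta>2, \<theta>3} \<le> card {w. poly H w = 0}"
      by (rule card_mono[OF poly_roots_finite[OF H0]]) (use G in \<open>auto simp: H_def\<close>)
    moreover have "card {\<theta>1, \<theta>2, \<theta>3} = 3" using distinct by auto
    ultimately show False by simp
  qed
  hence "coeff (map_poly of_rat G) 0 = z" by (simp add: H_def)
  thus thesis using that[of "coeff G 0"] by simp
qed

text \<open>An automorphism is determined by the image of \<theta>1, and that image is a
  root.\<close>

lemma Gal_cases:
  assumes "s \<in> nf_Gal K"
  shows "s = id \<or> s = \<rho> \<or> s = \<rho> \<circ> \<rho>"
proof -
  have s: "nf_hom K s" "\<And>z. z \<notin> K \<Longrightarrow> s z = z" using assms unfolding nf_Gal_def by auto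
  have "ev fQ (s \<theta>1) = s (ev fQ \<theta>1)" by (rule nf_hom_ev[OF s(1) \<theta>_K(1), symmetric])
  also have "\<dots> = 0" using nf_hom_of_rat[OF sub s(1), of 0] by (simp add: fQ_eval)
  finally have s1: "s \<theta>1 = \<theta>1 \<or> s \<theta>1 = \<theta>2 \<or> s \<theta>1 = \<theta>3" by (simp add: fQ_eval)
  have eq: "s = t" if "\<And>F. ev F (s \<theta>1) = t (ev F \<theta>1)" "\<And>z. z \<notin> K \<Longrightarrow> t z = z" for t
  proof
    fix z
    show "s z = t z"
    proof (cases "z \<in> K")
      case True
      then obtain F where z: "z = ev F \<theta>1" by (rule in_KE)
      show ?thesis unfolding z nf_hom_ev[OF s(1) \<theta>_K(1)] by (rule that(1))
    qed (simp add: s that)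
  qed
  from s1 show ?thesis
  proof (elim disjE)
    assume 1: "s \<theta>1 = \<theta>1"
    have "s = id" by (rule eq) (simp_all add: 1)
    thus ?thesis by simp
  next
    assume 2: "s \<theta>1 = \<theta>2"
    have "s = \<rho>" by (rule eq) (simp_all add: 2 \<rho>_ev \<rho>_outside)
    thus ?thesis by simp
  next
    assume 3: "s \<theta>1 = \<theta>3"
    have "s = \<rho> \<circ> \<rho>" by (rule eq) (simp_all add: 3 \<rho>_ev \<rho>_outside)
    thus ?thesis by simp
  qed
qed

lemma \<rho>_Gal: "\<rho> \<in> nf_Gal K"
  unfolding nf_Gal_def
proof (intro CollectI conjI)
  show "\<rho> ` K = K"
  proof
    show "K \<subseteq> \<rho> ` K"
    proof
      fix z assume "z \<in> K"
      hence "\<rho> (\<rho> z) \<in> K" by (intro \<rho>_K)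
      thus "z \<in> \<rho> ` K" using \<rho>3[of z] by (metis imageI)
    qed
  qed (auto intro: \<rho>_K)
qed (simp_all add: nf_hom_\<rho> \<rho>_outside)

lemma \<rho>_generator: "Gal_generator K \<rho>"
  unfolding Gal_generator_def
proof (intro conjI ballI \<rho>_Gal)
  fix s assume "s \<in> nf_Gal K"
  from Gal_cases[OF this] show "\<exists>k. s = \<rho> ^^ k"
  proof (elim disjE)
    assume "s = id" thus ?thesis by (intro exI[of _ 0]) simp
  next
    assume "s = \<rho>" thus ?thesis by (intro exI[of _ 1]) simp
  next
    assume "s = \<rho> \<circ> \<rho>" thus ?thesis by (intro exI[of _ 2]) (simp add: eval_nat_numeral)
  qed
qed

lemma generator_cases:
  assumes "Gal_generator K s"
  shows "s = \<rho> \<or> s = \<rho> \<circ> \<rho>"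
proof -
  have "s \<noteq> id"
  proof
    assume "s = id"
    obtain k where "\<rho> = s ^^ k" using assms \<rho>_Gal unfolding Gal_generator_def by blast
    hence "\<rho> = id" using \<open>s = id\<close> by simp
    thus False using \<rho>_\<theta>(1) distinct(1) by simp
  qed
  thus ?thesis using Gal_cases assms unfolding Gal_generator_def by blast
qed

lemma \<rho>_integral: "z \<in> R \<Longrightarrow> \<rho> z \<in> R"
proof -
  assume "z \<in> R"
  hence zK: "z \<in> K" and zi: "algebraic_integer z" by (auto simp: ring_of_integers_def)
  obtain p :: "int poly" where p: "lead_coeff p = 1" "poly (of_int_poly p) z = 0"
    using zi unfolding algebraic_integer_def by auto
  have map: "map_poly of_rat (of_int_poly p :: rat poly) = (of_int_poly p :: complex poly)"
    by (rule poly_eqI) simp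
  have "ev (of_int_poly p) (\<rho> z) = \<rho> (ev (of_int_poly p) z)"
    by (rule nf_hom_ev[OF nf_hom_\<rho> zK, symmetric])
  hence "poly (of_int_poly p) (\<rho> z) = 0" using p(2) unfolding map by simp
  thus "\<rho> z \<in> R" using p(1) \<rho>_K[OF zK] unfolding ring_of_integers_def algebraic_integer_def by blast
qed

lemma fixed_integral:
  assumes "z \<in> R" "\<rho> z = z"
  obtains n where "z = of_int n"
proof -
  have "z \<in> K" "algebraic_integer z" using assms(1) by (auto simp: ring_of_integers_def)
  then obtain r where r: "z = of_rat r" using fixed_imp_rational assms(2) by blast
  then obtain n where "r = of_int n" using rational_algebraic_integer \<open>algebraic_integer z\<close> by blast
  thus thesis using that r by simp
qed

lemma of_int_R: "of_int m \<in> R"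
  using subfield_of_rat[OF sub, of "of_int m"] by (simp add: ring_of_integers_def)

definition Nm :: "complex \<Rightarrow> nat" where
  "Nm z = nat \<bar>THE n. of_int n = z * \<rho> z * \<rho> (\<rho> z)\<bar>"

lemma Nm:
  assumes "z \<in> R"
  obtains n where "of_int n = z * \<rho> z * \<rho> (\<rho> z)" "Nm z = nat \<bar>n\<bar>"
proof -
  have \<rho>R: "\<rho> z \<in> R" "\<rho> (\<rho> z) \<in> R" using assms \<rho>_integral by auto
  have K: "z \<in> K" "\<rho> z \<in> K" "\<rho> (\<rho> z) \<in> K" using assms \<rho>R R_subset_K by auto
  have "z * \<rho> z * \<rho> (\<rho> z) \<in> R" by (intro R_closed(4) assms \<rho>R)
  moreover have "\<rho> (z * \<rho> z * \<rho> (\<rho> z)) = z * \<rho> z * \<rho> (\<rho> z)"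
    using K K_closed(4) by (simp add: \<rho>_mult \<rho>3)
  ultimately obtain n where n: "z * \<rho> z * \<rho> (\<rho> z) = of_int n" by (rule fixed_integral)
  have "(THE n. of_int n = z * \<rho> z * \<rho> (\<rho> z)) = n" unfolding n by (rule the_equality) simp_all
  thus thesis using that[of n] n by (simp add: Nm_def)
qed

lemma normed_pid: 
  assumes "class_number_one K"
  shows "normed_pid K Nm"
proof unfold_locales
  show "class_number_one K" by fact
  fix x y assume x: "x \<in> ring_of_integers K" and y: "y \<in> ring_of_integers K"
  have R: "x \<in> R" "y \<in> R" using x y by simp_all
  have K: "x \<in> K" "y \<in> K" using R R_subset_K by auto
  obtain m where m: "of_int m = x * \<rho> x * \<rho> (\<rho> x)" "Nm x = nat \<bar>m\<bar>" using Nm[OF R(1)] .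
  obtain n where n: "of_int n = y * \<rho> y * \<rho> (\<rho> y)" "Nm y = nat \<bar>n\<bar>" using Nm[OF R(2)] .
  obtain l where l: "of_int l = (x * y) * \<rho> (x * y) * \<rho> (\<rho> (x * y))" "Nm (x * y) = nat \<bar>l\<bar>"
    using Nm[OF R_closed(4)[OF R]] .
  have "(of_int l :: complex) = of_int (m * n)"
    unfolding l(1) of_int_mult m(1) n(1) using K \<rho>_K by (simp add: \<rho>_mult mult_ac)
  hence "l = m * n" by (simp only: of_int_eq_iff)
  thus "Nm (x * y) = Nm x * Nm y" unfolding l m n by (simp add: abs_mult nat_mult_distrib)
next
  fix x assume x: "x \<in> ring_of_integers K" "x \<noteq> 0"
  have R: "x \<in> R" using x by simp
  obtain m where m: "of_int m = x * \<rho> x * \<rho> (\<rho> x)" "Nm x = nat \<bar>m\<bar>" using Nm[OF R] .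
  have "\<rho> w \<noteq> 0" if "w \<noteq> 0" for w using that \<rho>3[of w] by auto
  hence "x * \<rho> x * \<rho> (\<rho> x) \<noteq> 0" using x by auto
  hence "m \<noteq> 0" using m(1) by (metis of_int_0)
  thus "Nm x > 0" using m(2) by simp
next
  fix x assume x: "x \<in> ring_of_integers K" "Nm x = 1"
  have R: "x \<in> R" using x by simp
  obtain m where m: "of_int m = x * \<rho> x * \<rho> (\<rho> x)" "Nm x = nat \<bar>m\<bar>" using Nm[OF R] .
  have "m = 1 \<or> m = -1" using m(2) x(2) by auto
  hence mm: "of_int m * of_int m = (1 :: complex)" by auto
  \<comment> \<open>The inverse of an element of norm 1 or -1 is, up to sign, the product of its two
    other conjugates.\<close>
  have "x * (of_int m * (\<rho> x * \<rho> (\<rho> x))) = of_int m * (x * \<rho> x * \<rho> (\<rho> x))" by (simp only: mult_ac)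
  hence "x * (of_int m * (\<rho> x * \<rho> (\<rho> x))) = 1" by (simp only: m(1)[symmetric] mm)
  moreover have "of_int m * (\<rho> x * \<rho> (\<rho> x)) \<in> R"
    by (intro R_closed(4) \<rho>_integral R of_int_R)
  ultimately show "x \<in> nf_units K" using x(1) unfolding nf_units_def by auto
qed

end

section \<open>Galois action and norms on polynomials over K\<close>

context cyclic_cubic
begin

text \<open>\<rho> is known to respect sums and products on \<open>K\<close>, so coefficientwise
  conjugation is treated as a ring homomorphism on these polynomials.\<close>

definition KX :: "complex poly set" where "KX = {P. \<forall>i. coeff P i \<in> K}"

abbreviation r :: "complex poly \<Rightarrow> complex poly" where "r P \<equiv> map_poly \<rho> P"

lemma coeff_r [simp]: "coeff (r P) i = \<rho> (coeff P i)" by (simp add: coeff_map_poly)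

lemma OKt_KX: "P \<in> OKt K \<Longrightarrow> P \<in> KX" using R_subset_K by (auto simp: KX_def OKt_iff)

lemma K_sum: "(\<And>i. i \<in> I \<Longrightarrow> f i \<in> K) \<Longrightarrow> sum f I \<in> K"
  by (induction I rule: infinite_finite_induct) (auto intro: K_closed)

lemma \<rho>_sum: "(\<And>i. i \<in> I \<Longrightarrow> f i \<in> K) \<Longrightarrow> \<rho> (sum f I) = (\<Sum>i\<in>I. \<rho> (f i))"
  by (induction I rule: infinite_finite_induct) (auto simp: \<rho>_add K_sum)

lemma KX_closed: "P \<in> KX \<Longrightarrow> Q \<in> KX \<Longrightarrow> P + Q \<in> KX" "P \<in> KX \<Longrightarrow> Q \<in> KX \<Longrightarrow> P * Q \<in> KX"
    "x \<in> K \<Longrightarrow> P \<in> KX \<Longrightarrow> smult x P \<in> KX" "P \<in> KX \<Longrightarrow> r P \<in> KX"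
  by (auto simp: KX_def coeff_mult intro!: K_sum K_closed \<rho>_K)

lemma r_add: "P \<in> KX \<Longrightarrow> Q \<in> KX \<Longrightarrow> r (P + Q) = r P + r Q"
  by (rule poly_eqI) (simp add: \<rho>_add KX_def)

lemma r_mult: "P \<in> KX \<Longrightarrow> Q \<in> KX \<Longrightarrow> r (P * Q) = r P * r Q"
proof (rule poly_eqI)
  fix n assume "P \<in> KX" "Q \<in> KX"
  hence P: "coeff P i \<in> K" and Q: "coeff Q i \<in> K" for i by (auto simp: KX_def)
  have "coeff (r (P * Q)) n = \<rho> (\<Sum>i\<le>n. coeff P i * coeff Q (n - i))" by (simp add: coeff_mult)
  also have "\<dots> = (\<Sum>i\<le>n. \<rho> (coeff P i * coeff Q (n - i)))"
    by (rule \<rho>_sum) (intro K_closed(4) P Q)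
  also have "\<dots> = coeff (r P * r Q) n" by (simp add: coeff_mult \<rho>_mult P Q)
  finally show "coeff (r (P * Q)) n = coeff (r P * r Q) n" .
qed

lemma r_smult: "x \<in> K \<Longrightarrow> P \<in> KX \<Longrightarrow> r (smult x P) = smult (\<rho> x) (r P)"
  by (rule poly_eqI) (simp add: \<rho>_mult KX_def)

lemma r3 [simp]: "r (r (r P)) = P" by (rule poly_eqI) (simp add: \<rho>3)

lemma r_comp: "map_poly (\<rho> \<circ> \<rho>) P = r (r P)" by (rule poly_eqI) (simp add: coeff_map_poly)

lemma r_inj: "r P = r Q \<Longrightarrow> P = Q" by (metis r3)

lemma r_OKt [simp]: "P \<in> OKt K \<Longrightarrow> r P \<in> OKt K" by (simp add: OKt_iff \<rho>_integral)

lemma r_of_int [simp]: "r (of_int_poly p) = of_int_poly p" by (rule poly_eqI) simp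

lemma of_int_OKt [simp]: "of_int_poly p \<in> OKt K" by (simp add: OKt_iff of_int_R)

lemma r_eq_0 [simp]: "r P = 0 \<longleftrightarrow> P = 0" by (metis r3 map_poly_0)

lemma fixed_OKt:
  assumes "P \<in> OKt K" "r P = P"
  obtains p where "P = of_int_poly p"
proof -
  define h where "h = (\<lambda>z :: complex. THE n. z = of_int n)"
  have h: "h (of_int n) = n" for n unfolding h_def by (rule the_equality) auto
  have h0: "h 0 = 0" using h[of 0] by simp
  have "P = of_int_poly (map_poly h P)"
  proof (rule poly_eqI)
    fix i
    have "\<rho> (coeff P i) = coeff P i" using assms(2) coeff_r by metis
    moreover have "coeff P i \<in> R" using assms(1) by (simp add: OKt_iff)
    ultimately obtain n where "coeff P i = of_int n" by (metis fixed_integral)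
    thus "coeff P i = coeff (of_int_poly (map_poly h P)) i" using h h0 by (simp add: coeff_map_poly)
  qed
  thus thesis by (rule that)
qed

lemma fixed_KX:
  assumes "P \<in> KX" "r P = P"
  obtains p where "P = map_poly of_rat p"
proof -
  define h where "h = (\<lambda>z :: complex. THE n. z = of_rat n)"
  have h: "h (of_rat n) = n" for n unfolding h_def by (rule the_equality) auto
  have h0: "h 0 = 0" using h[of 0] by simp
  have "P = map_poly of_rat (map_poly h P)"
  proof (rule poly_eqI)
    fix i
    have "\<rho> (coeff P i) = coeff P i" using assms(2) coeff_r by metis
    moreover have "coeff P i \<in> K" using assms(1) by (simp add: KX_def)
    ultimately obtain n where "coeff P i = of_rat n" by (metis fixed_imp_rational)
    thus "coeff P i = coeff (map_poly of_rat (map_poly h P)) i" using h h0 by (simp add: coeff_map_poly)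
  qed
  thus thesis by (rule that)
qed

lemma r_rdvd: "P \<in> OKt K \<Longrightarrow> P rdvd Q \<Longrightarrow> r P rdvd r Q"
proof -
  assume P: "P \<in> OKt K" and "P rdvd Q"
  then obtain S where "S \<in> OKt K" "Q = P * S" by (elim rdvdE)
  thus ?thesis using P by (intro rdvdI[of "r S"]) (auto simp: r_mult OKt_KX)
qed

lemma r_rdvd_iff: "P \<in> OKt K \<Longrightarrow> r P rdvd r Q \<longleftrightarrow> P rdvd Q"
  using r_rdvd[of "r P" "r Q"] r_rdvd[of "r (r P)" "r (r Q)"] r_rdvd[of P Q] by auto

text \<open>Conjugation has order three, so moving it across the divisibility inverts it.\<close>

lemma r_rdvd_shift: "P \<in> OKt K \<Longrightarrow> P rdvd r Q \<longleftrightarrow> r (r P) rdvd Q" "P \<in> OKt K \<Longrightarrow> P rdvd r (r Q) \<longleftrightarrow> r P rdvd Q"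
  using r_rdvd_iff[of P "r Q"] r_rdvd_iff[of "r P" "r (r Q)"] r_rdvd_iff[of P "r (r Q)"] by auto

lemma r_unit: "OKt_unit K u \<Longrightarrow> OKt_unit K (r u)"
proof -
  assume "OKt_unit K u"
  then obtain v where v: "u \<in> OKt K" "v \<in> OKt K" "u * v = 1" by (auto simp: OKt_unit_def)
  hence "r u * r v = 1" using r_mult[of u v] by (simp add: OKt_KX)
  thus ?thesis using v unfolding OKt_unit_def by auto
qed

lemma r_assoc: "P \<in> OKt K \<Longrightarrow> OKt_assoc K Q P \<Longrightarrow> OKt_assoc K (r Q) (r P)"
  unfolding OKt_assoc_def using r_unit r_mult OKt_KX unit_mem by blast

lemma r_irreducible:
  assumes P: "OKt_irreducible K P"
  shows "OKt_irreducible K (r P)"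
  unfolding OKt_irreducible_def
proof (intro conjI ballI impI)
  have PO: "P \<in> OKt K" using P by (simp add: OKt_irreducible_def)
  thus "r P \<in> OKt K" by simp
  show "r P \<noteq> 0" using P by (simp add: OKt_irreducible_def)
  show "\<not> OKt_unit K (r P)"
  proof
    assume "OKt_unit K (r P)"
    from r_unit[OF r_unit[OF this]] have "OKt_unit K P" by simp
    thus False using P by (simp add: OKt_irreducible_def)
  qed
  fix Q S assume QS: "Q \<in> OKt K" "S \<in> OKt K" "r P = Q * S"
  have "P = r (r (Q * S))" using QS(3) r3 by metis
  also have "\<dots> = r (r Q) * r (r S)" using QS by (simp add: r_mult OKt_KX)
  finally have "OKt_unit K (r (r Q)) \<or> OKt_unit K (r (r S))"
    using P QS r_OKt unfolding OKt_irreducible_def by blast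
  thus "OKt_unit K Q \<or> OKt_unit K S" using r_unit r3 by metis
qed

definition Nr :: "complex poly \<Rightarrow> complex poly" where "Nr P = P * r P * r (r P)"

lemma Nr_OKt [simp]: "P \<in> OKt K \<Longrightarrow> Nr P \<in> OKt K"
  unfolding Nr_def by (intro OKt_closed(4)) simp_all

lemma Nr_mult: "P \<in> OKt K \<Longrightarrow> Q \<in> OKt K \<Longrightarrow> Nr (P * Q) = Nr P * Nr Q"
  unfolding Nr_def by (simp add: r_mult OKt_KX mult_ac)

lemma Nr_r: "Nr (r P) = Nr P" unfolding Nr_def by (simp add: mult_ac)

lemma Nr_int:
  assumes "P \<in> OKt K"
  obtains m where "Nr P = of_int_poly m"
proof (rule fixed_OKt)
  show "Nr P \<in> OKt K" using assms by simp
  have KX: "P \<in> KX" "r P \<in> KX" "r (r P) \<in> KX" using assms by (simp_all add: OKt_KX)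
  show "r (Nr P) = Nr P" unfolding Nr_def using KX by (simp add: r_mult KX_closed mult_ac)
qed (rule that)

lemma Nr_rdvd: "P \<in> OKt K \<Longrightarrow> P rdvd Q \<Longrightarrow> Nr P rdvd Nr Q"
  unfolding Nr_def by (intro rdvd_mono r_rdvd) simp_all

text \<open>The cofactor is invariant under \<rho>, hence has integer coefficients.\<close>

lemma int_rdvd_imp_dvd:
  assumes "of_int_poly A rdvd of_int_poly B" "A \<noteq> 0"
  shows "A dvd B"
proof -
  obtain S where S: "S \<in> OKt K" "of_int_poly B = of_int_poly A * S" using assms(1) by (rule rdvdE)
  have "of_int_poly A * r S = r (of_int_poly A * S)"
    using S(1) by (simp add: r_mult OKt_KX)
  also have "\<dots> = of_int_poly A * S" unfolding S(2)[symmetric] by (rule r_of_int)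
  finally have "r S = S" using assms(2) by simp
  then obtain s where "S = of_int_poly s" using fixed_OKt[OF S(1)] by blast
  hence "of_int_poly B = (of_int_poly (A * s) :: complex poly)" using S(2) by (simp add: hom_distribs)
  hence "B = A * s" by (simp only: of_int_poly_hom.eq_iff)
  thus ?thesis by simp
qed

lemma assoc_conj:
  assumes "P \<in> OKt K" "OKt_assoc K P (r P)"
  shows "OKt_assoc K P (r (r P))" "OKt_assoc K (r P) (r (r P))"
proof -
  show 1: "OKt_assoc K (r P) (r (r P))" by (rule r_assoc) (use assms in simp_all)
  show "OKt_assoc K P (r (r P))" by (rule assoc_trans[OF assms(2) 1])
qed

lemma assoc_conj':
  assumes "P \<in> OKt K" "OKt_assoc K P (r (r P))"
  shows "OKt_assoc K P (r P)"
proof -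
  have "OKt_assoc K (r P) (r (r (r P)))" by (rule r_assoc) (use assms in simp_all)
  thus ?thesis using assoc_sym by simp
qed

lemma nonassoc_conjugates:
  assumes "P \<in> OKt K" "\<not> OKt_assoc K P (r P)" "Q \<in> {P, r P, r (r P)}" "Q' \<in> {P, r P, r (r P)}" "Q \<noteq> Q'"
  shows "\<not> OKt_assoc K Q Q'"
proof -
  have n: "\<not> OKt_assoc K P (r (r P))" using assoc_conj' assms by blast
  have n': "\<not> OKt_assoc K (r P) (r (r P))"
  proof
    assume "OKt_assoc K (r P) (r (r P))"
    from r_assoc[OF _ this] have "OKt_assoc K (r (r P)) P" using assms(1) by simp
    thus False using n assoc_sym by blast
  qed
  show ?thesis using assms(2-5) n n' assoc_sym by auto
qed

text \<open>\<open>splits_in_OKt\<close> allows any generator. The only one besides \<rho> is its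
  square, which merely exchanges the two proper conjugates of \<open>P\<close>.\<close>

lemma splits_with_any_generator:
  assumes "splits_with K t H P"
  shows "splits_with K \<rho> H P"
proof -
  have P: "OKt_irreducible K P" "\<not> OKt_assoc K P (map_poly t P)"
    and eq: "of_int_poly H = P * map_poly t P * map_poly (t \<circ> t) P \<or> of_int_poly H = - (P * map_poly t P * map_poly (t \<circ> t) P)"
    and "Gal_generator K t" using assms unfolding splits_with_def by blast+
  have PO: "P \<in> OKt K" using P by (simp add: OKt_irreducible_def)
  from generator_cases[OF \<open>Gal_generator K t\<close>] show ?thesis
  proof
    assume "t = \<rho>" thus ?thesis using assms by simp
  next
    assume t: "t = \<rho> \<circ> \<rho>"
    have 2: "map_poly t P = r (r P)" unfolding t r_comp ..
    have 3: "map_poly (t \<circ> t) P = r P" unfolding t by (rule poly_eqI) (simp add: coeff_map_poly \<rho>3)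
    have "\<not> OKt_assoc K P (r P)" using assoc_conj(1)[OF PO] P(2) unfolding 2 by blast
    thus ?thesis using P(1) eq \<rho>_generator unfolding splits_with_def 2 3 r_comp by (simp add: mult_ac)
  qed
qed

lemma splits_with_iff:
  "splits_with K \<rho> H P \<longleftrightarrow> OKt_irreducible K P \<and> \<not> OKt_assoc K P (r P) \<and> (of_int_poly H = Nr P \<or> of_int_poly H = - Nr P)"
  unfolding splits_with_def r_comp Nr_def using \<rho>_generator by simp

end

section \<open>Primes above integer polynomials and square classes\<close>

locale cyclic_cubic_pid = cyclic_cubic +
  assumes class_one: "class_number_one K"

sublocale cyclic_cubic_pid \<subseteq> normed_pid K "ring_of_integers K" Nm
  by (rule normed_pid[OF class_one])

context cyclic_cubic_pid
begin

lemma prime_factor_below: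
  assumes P: "OKt_irreducible K P" and x: "x \<noteq> 0" and dvd: "P rdvd of_int_poly x"
  obtains H where "prime H" "H dvd x" "P rdvd of_int_poly H"
proof -
  have "x \<noteq> 0 \<longrightarrow> P rdvd of_int_poly x \<longrightarrow> (\<exists>H. prime H \<and> H dvd x \<and> P rdvd of_int_poly H)"
  proof (induction x rule: prime_divisors_induct)
    case zero
    show ?case by simp
  next
    case (unit x)
    have "x = 1 \<or> x = -1" using unit by (simp only: is_unit_int_poly_iff)
    hence "of_int_poly x * of_int_poly x = (1 :: complex poly)" by (auto simp: hom_distribs)
    hence "OKt_unit K (of_int_poly x)"
      unfolding OKt_unit_def by (intro conjI bexI[of _ "of_int_poly x"]) simp_all
    hence "\<not> P rdvd of_int_poly x"
      using unit_of_mult irreducible_mem[OF P] irreducible_not_unit[OF P] by (metis rdvdE)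
    thus ?case by simp
  next
    case (factor p x)
    show ?case
    proof (intro impI)
      assume nz: "p * x \<noteq> 0" and "P rdvd of_int_poly (p * x)"
      hence "P rdvd of_int_poly p * of_int_poly x" by (simp add: hom_distribs)
      hence "P rdvd of_int_poly p \<or> P rdvd of_int_poly x" by (intro irreducible_prime[OF P]) simp_all
      thus "\<exists>H. prime H \<and> H dvd p * x \<and> P rdvd of_int_poly H"
      proof
        assume "P rdvd of_int_poly p"
        thus ?thesis using factor(1) by (intro exI[of _ p]) simp
      next
        assume "P rdvd of_int_poly x"
        moreover have "x \<noteq> 0" using nz by simp
        ultimately obtain H where "prime H" "H dvd x" "P rdvd of_int_poly H" using factor(2) by blast
        thus ?thesis by (intro exI[of _ H]) (simp add: dvd_mult)
      qed
    qed
  qed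
  thus thesis using that x dvd by blast
qed

lemma Nr_rdvd_of_conjugates:
  assumes P: "OKt_irreducible K P" and na: "\<not> OKt_assoc K P (r P)"
    and A: "A \<in> OKt K" and dvd: "P rdvd A" "r P rdvd A" "r (r P) rdvd A"
  shows "Nr P rdvd A"
proof -
  have PO: "P \<in> OKt K" by (rule irreducible_mem[OF P])
  note nonassoc = nonassoc_conjugates[OF PO na]
  have ne: "P \<noteq> r P" "P \<noteq> r (r P)" "r P \<noteq> r (r P)"
  proof -
    have refl: "OKt_assoc K P P"
      unfolding OKt_assoc_def using OKt_closed(2) by (intro exI[of _ 1]) (auto simp: OKt_unit_def)
    show 1: "P \<noteq> r P" using na refl by metis
    show 2: "P \<noteq> r (r P)" using assoc_conj'[OF PO] na refl by metis
    show "r P \<noteq> r (r P)" using 1 r_inj by blast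
  qed
  have "\<Prod>{P, r P, r (r P)} rdvd A"
    by (rule prod_irreducibles_rdvd)
       (use P dvd A nonassoc r_irreducible in auto)
  thus ?thesis using ne by (simp add: Nr_def mult.assoc)
qed

lemma unit_of_Nr_unit:
  assumes "P \<in> OKt K" "Nr P = of_int_poly m" "is_unit m"
  shows "OKt_unit K P"
proof -
  have "m = 1 \<or> m = -1" using assms(3) by (simp add: is_unit_int_poly_iff)
  hence "Nr P * Nr P = 1" unfolding assms(2) by (auto simp: hom_distribs)
  hence "P * (r P * r (r P) * Nr P) = 1" by (simp add: Nr_def mult_ac)
  moreover have "r P * r (r P) * Nr P \<in> OKt K" using assms(1) by (intro OKt_closed(4)) simp_all
  ultimately show ?thesis using assms(1) unfolding OKt_unit_def by blast
qed

text \<open>The three conjugates are pairwise nonassociate primes that divide \<open>H\<close>, so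
  their product, an integer polynomial, divides the irreducible \<open>H\<close>.\<close>

lemma splits_of_divisor:
  assumes P: "OKt_irreducible K P" and na: "\<not> OKt_assoc K P (r P)"
    and H: "prime H" "P rdvd of_int_poly H"
  shows "splits_with K \<rho> H P"
proof -
  have PO: "P \<in> OKt K" by (rule irreducible_mem[OF P])
  have "r P rdvd of_int_poly H" "r (r P) rdvd of_int_poly H"
    using r_rdvd[OF PO H(2)] r_rdvd[of "r P" "of_int_poly H"] PO by simp_all
  hence N: "Nr P rdvd of_int_poly H" by (intro Nr_rdvd_of_conjugates[OF P na]) (use H in simp_all)
  obtain m where m: "Nr P = of_int_poly m" using Nr_int[OF PO] .
  have "Nr P \<noteq> 0" unfolding Nr_def using irreducible_nz[OF P] by simp
  hence "m \<noteq> 0" using m by auto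
  hence "m dvd H" using N unfolding m by (intro int_rdvd_imp_dvd)
  then obtain w where w: "H = m * w" by (rule dvdE)
  have "\<not> is_unit m" using unit_of_Nr_unit[OF PO m] irreducible_not_unit[OF P] by blast
  moreover have "irreducible H" using H(1) by (intro prime_elem_imp_irreducible) simp
  ultimately have "is_unit w" using w Factorial_Ring.irreducibleD by blast
  hence "w = 1 \<or> w = -1" by (simp add: is_unit_int_poly_iff)
  hence "of_int_poly H = Nr P \<or> of_int_poly H = - Nr P"
    unfolding w m by (auto simp: hom_distribs)
  thus ?thesis unfolding splits_with_iff using P na by blast
qed

lemma split_multiplicity:
  assumes P: "OKt_irreducible K P" and t: "t \<in> OKt K" "\<not> P ^ 2 rdvd t"
  obtains t' where "t' \<in> OKt K" "\<not> P rdvd t'" "t = P ^ (of_bool (P rdvd t)) * t'"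
proof (cases "P rdvd t")
  case True
  then obtain t' where t': "t' \<in> OKt K" "t = P * t'" by (rule rdvdE)
  have "\<not> P rdvd t'"
  proof
    assume "P rdvd t'"
    hence "P * P rdvd P * t'" by (intro rdvd_mono rdvd_refl)
    thus False using t t' by (simp add: power2_eq_square)
  qed
  thus thesis using that[of t'] t' True by simp
next
  case False
  thus thesis using that[of t] t by simp
qed

text \<open>Here \<open>s * k ^ 2\<close> stands for \<open>p - \<theta>1 g q\<^sup>2\<close>, whose
  norm is the square of the ordinate polynomial \<open>y\<close>.\<close>

context
  fixes s k Y :: "complex poly"
  assumes s: "s \<in> OKt K" and k: "k \<in> OKt K" "k \<noteq> 0" and Y: "Y \<in> OKt K"
    and sqf: "\<And>P. OKt_irreducible K P \<Longrightarrow> \<not> P ^ 2 rdvd s"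
    and norm: "Nr (s * k ^ 2) = Y ^ 2"
begin

text \<open>As \<open>s\<close> has no squared irreducible factor, the multiplicity of
  \<open>P\<close> in the norm of \<open>s\<close> is the number of conjugates of \<open>P\<close>
  that divide \<open>s\<close>. That norm times a square is a square.\<close>

lemma conjugate_parity:
  assumes P: "OKt_irreducible K P"
  shows "even (of_bool (P rdvd s) + of_bool (r P rdvd s) + of_bool (r (r P) rdvd s) :: nat)"
proof -
  have PO: "P \<in> OKt K" by (rule irreducible_mem[OF P])
  define m0 m1 m2 :: nat where "m0 = of_bool (P rdvd s)" and "m1 = of_bool (P rdvd r s)" and "m2 = of_bool (P rdvd r (r s))"
  have rr: "r (Q ^ 2) = r Q ^ 2" if "Q \<in> OKt K" for Q
    using that by (simp add: power2_eq_square r_mult OKt_KX)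
  have sq: "\<not> P ^ 2 rdvd r s" "\<not> P ^ 2 rdvd r (r s)"
    using sqf[of "r (r P)"] sqf[of "r P"] r_irreducible[OF P] r_irreducible[OF r_irreducible[OF P]]
    by (simp_all add: r_rdvd_shift OKt_power PO rr)
  obtain t0 where t0: "t0 \<in> OKt K" "\<not> P rdvd t0" "s = P ^ m0 * t0"
    using split_multiplicity[OF P s sqf[OF P]] unfolding m0_def by blast
  obtain t1 where t1: "t1 \<in> OKt K" "\<not> P rdvd t1" "r s = P ^ m1 * t1"
    using split_multiplicity[OF P _ sq(1)] s unfolding m1_def by auto
  obtain t2 where t2: "t2 \<in> OKt K" "\<not> P rdvd t2" "r (r s) = P ^ m2 * t2"
    using split_multiplicity[OF P _ sq(2)] s unfolding m2_def by auto
  define x where "x = t0 * t1 * t2"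
  have xO: "x \<in> OKt K" unfolding x_def by (intro OKt_closed(4) t0 t1 t2)
  have nx: "\<not> P rdvd x"
    unfolding x_def using irreducible_prime[OF P] t0 t1 t2 OKt_closed(4) by blast
  have "even (m0 + m1 + m2)"
  proof (rule ccontr)
    assume "odd (m0 + m1 + m2)"
    then obtain n where n: "m0 + m1 + m2 = 2 * n + 1" by (rule oddE)
    have "Y ^ 2 = Nr s * Nr k ^ 2"
      unfolding norm[symmetric] using s k by (simp add: Nr_mult OKt_closed power2_eq_square)
    also have "Nr s = P ^ (m0 + m1 + m2) * x"
      unfolding Nr_def t0(3)[symmetric] x_def by (subst (1) t0(3), subst t1(3), subst t2(3)) (simp add: power_add mult_ac)
    also have "\<dots> = P * x * (P ^ n) ^ 2" unfolding n by (simp add: power_add mult_ac flip: power_mult)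
    finally have "Y ^ 2 = P * x * (P ^ n * Nr k) ^ 2" by (simp add: power_mult_distrib mult_ac)
    moreover have "P ^ n * Nr k \<in> OKt K" using PO k by (intro OKt_closed(4) OKt_power Nr_OKt)
    moreover have "P ^ n * Nr k \<noteq> 0" using irreducible_nz[OF P] k by (simp add: Nr_def)
    ultimately show False using square_parity[OF P xO nx Y] by blast
  qed
  moreover have "m1 = of_bool (r (r P) rdvd s)" "m2 = of_bool (r P rdvd s)"
    unfolding m1_def m2_def by (simp_all add: r_rdvd_shift PO)
  ultimately show ?thesis unfolding m0_def by (simp add: add_ac)
qed

lemma irreducible_divisor_nonassoc:
  assumes P: "OKt_irreducible K P" "P rdvd s"
  shows "\<not> OKt_assoc K P (r P)" "r P rdvd s \<or> r (r P) rdvd s"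
proof -
  have PO: "P \<in> OKt K" by (rule irreducible_mem[OF P(1)])
  show "r P rdvd s \<or> r (r P) rdvd s"
    using conjugate_parity[OF P(1)] P(2) by (auto split: if_splits)
  show "\<not> OKt_assoc K P (r P)"
  proof
    assume a: "OKt_assoc K P (r P)"
    hence "r P rdvd s" using assoc_imp_rdvd[OF a] P(2) rdvd_trans by blast
    moreover have "r (r P) rdvd s" using assoc_imp_rdvd[OF assoc_conj(1)[OF PO a]] P(2) rdvd_trans by blast
    ultimately show False using conjugate_parity[OF P(1)] P(2) by simp
  qed
qed

text \<open>Since the norm of \<open>s\<close> is a square up to squares, an even number of the three primes over a split
  prime divides \<open>s\<close>, and a prime associated to its conjugates cannot divide \<open>s\<close>.\<close>

lemma squarefree_part_as_choice:
  fixes E :: "int poly"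
  defines "Gs \<equiv> {H \<in> prime_factors E. splits_in_OKt K H}"
  assumes E0: "E \<noteq> 0" and s0: "s \<noteq> 0"
    and bad: "\<And>P. OKt_irreducible K P \<Longrightarrow> P rdvd s \<Longrightarrow> r P rdvd s \<or> r (r P) rdvd s \<Longrightarrow> P rdvd of_int_poly E"
  obtains P S \<epsilon> where "\<And>H. H \<in> Gs \<Longrightarrow> splits_with K \<rho> H (P H)"
    "\<And>H. H \<in> Gs \<Longrightarrow> S H \<subseteq> {P H, map_poly \<rho> (P H), map_poly (\<rho> \<circ> \<rho>) (P H)}"
    "\<And>H. H \<in> Gs \<Longrightarrow> card (S H) \<in> {0, 2}"
    "\<epsilon> \<in> nf_units K" "s = smult \<epsilon> (\<Prod>H\<in>Gs. \<Prod>(S H))"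
proof -
  have finG: "finite Gs" by (simp add: Gs_def)
  define P where "P = (\<lambda>H. SOME P. splits_with K \<rho> H P)"
  have P: "splits_with K \<rho> H (P H)" if HG: "H \<in> Gs" for H
  proof -
    obtain t Q where "splits_with K t H Q" using HG unfolding Gs_def splits_in_OKt_def by blast
    from splits_with_any_generator[OF this] show ?thesis unfolding P_def by (rule someI)
  qed
  have Pirr: "OKt_irreducible K (P H)" and Pna: "\<not> OKt_assoc K (P H) (r (P H))"
    and PN: "of_int_poly H = Nr (P H) \<or> of_int_poly H = - Nr (P H)" if "H \<in> Gs" for H
    using P[OF that] unfolding splits_with_iff by blast+
  have PO: "P H \<in> OKt K" if "H \<in> Gs" for H by (rule irreducible_mem[OF Pirr[OF that]])
  define C where "C = (\<lambda>H. {P H, r (P H), r (r (P H))})"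
  have Cirr: "OKt_irreducible K Q" and CN: "Nr Q = Nr (P H)" if "H \<in> Gs" "Q \<in> C H" for H Q
    using that Pirr[OF that(1)] r_irreducible unfolding C_def by (auto simp: Nr_r)
  have Cna: "\<not> OKt_assoc K Q Q'" if "H \<in> Gs" "Q \<in> C H" "Q' \<in> C H" "Q \<noteq> Q'" for H Q Q'
    using nonassoc_conjugates[OF PO Pna] that unfolding C_def by blast
  have rdvd_neg: "A rdvd - B \<longleftrightarrow> A rdvd B" for A B
    using rdvd_uminus[of A B] rdvd_uminus[of A "- B"] by auto
  have neg_rdvd: "- A rdvd B \<longleftrightarrow> A rdvd B" for A B
  proof
    assume "- A rdvd B"
    moreover have "A rdvd - A" unfolding rdvd_neg by (rule rdvd_refl)
    ultimately show "A rdvd B" using rdvd_trans by blast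
  next
    assume "A rdvd B"
    moreover have "- A rdvd A" using rdvd_uminus[OF rdvd_refl, of "- A"] by simp
    ultimately show "- A rdvd B" using rdvd_trans by blast
  qed
  \<comment> \<open>Primes above different \<open>H\<close> are not even associated: taking norms,
    \<open>Q rdvd Q'\<close> yields \<open>H dvd H'\<close>. Hence the sets \<open>S H\<close> are
    disjoint.\<close>
  have same: "H = H'" if "H \<in> Gs" "H' \<in> Gs" "Q \<in> C H" "Q' \<in> C H'" "Q rdvd Q'" for H H' Q Q'
  proof -
    have "Nr Q rdvd Nr Q'" using irreducible_mem[OF Cirr[OF that(1,3)]] that(5) by (rule Nr_rdvd)
    hence "Nr (P H) rdvd Nr (P H')" using CN that by simp
    hence "of_int_poly H rdvd of_int_poly H'"
      using PN[OF that(1)] PN[OF that(2)] by (auto simp: rdvd_neg neg_rdvd)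
    moreover have pr: "prime H" "prime H'" using that(1,2) by (auto simp: Gs_def in_prime_factors_iff)
    moreover have "H \<noteq> 0" using pr by auto
    ultimately have "H dvd H'" by (intro int_rdvd_imp_dvd)
    thus ?thesis using pr primes_dvd_imp_eq by blast
  qed
  define S where "S = (\<lambda>H. {Q \<in> C H. Q rdvd s})"
  have cardS: "card (S H) \<in> {0, 2}" if H: "H \<in> Gs" for H
  proof -
    define b0 b1 b2 where "b0 \<longleftrightarrow> P H rdvd s" and "b1 \<longleftrightarrow> r (P H) rdvd s" and "b2 \<longleftrightarrow> r (r (P H)) rdvd s"
    have refl: "OKt_assoc K Q Q" for Q
      unfolding OKt_assoc_def using OKt_closed(2) by (intro exI[of _ 1]) (auto simp: OKt_unit_def)
    have ne: "P H \<noteq> r (P H)" "P H \<noteq> r (r (P H))" "r (P H) \<noteq> r (r (P H))"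
    proof -
      show 1: "P H \<noteq> r (P H)" using Pna[OF H] refl by metis
      show "P H \<noteq> r (r (P H))" using assoc_conj'[OF PO[OF H]] Pna[OF H] refl by metis
      show "r (P H) \<noteq> r (r (P H))" using 1 r_inj by blast
    qed
    have "S H = (if b0 then {P H} else {}) \<union> (if b1 then {r (P H)} else {}) \<union> (if b2 then {r (r (P H))} else {})"
      unfolding S_def C_def b0_def b1_def b2_def by auto
    moreover have "even (of_bool b0 + of_bool b1 + of_bool b2 :: nat)"
      unfolding b0_def b1_def b2_def by (rule conjugate_parity[OF Pirr[OF H]])
    ultimately show ?thesis using ne by (cases b0; cases b1; cases b2) simp_all
  qed
  define U where "U = (\<Union>H\<in>Gs. S H)"
  define h where "h = (\<Prod>H\<in>Gs. \<Prod>(S H))"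
  have finS: "finite (S H)" for H by (simp add: S_def C_def)
  have hU: "h = \<Prod>U" unfolding h_def U_def
    by (rule prod.UNION_disjoint[symmetric, unfolded id_def])
       (use finG finS same rdvd_refl in \<open>auto simp: S_def\<close>)
  have "\<Prod>U rdvd s"
  proof (rule prod_irreducibles_rdvd)
    show "finite U" using finG finS by (simp add: U_def)
    show "OKt_irreducible K Q" "Q rdvd s" if "Q \<in> U" for Q using that Cirr by (auto simp: U_def S_def)
    fix Q Q' assume Q: "Q \<in> U" "Q' \<in> U" "Q \<noteq> Q'"
    then obtain H H' where H: "H \<in> Gs" "Q \<in> C H" "H' \<in> Gs" "Q' \<in> C H'" by (auto simp: U_def S_def)
    show "\<not> OKt_assoc K Q Q'"
    proof
      assume a: "OKt_assoc K Q Q'"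
      have "H = H'" by (rule same[OF H(1,3,2,4) assoc_imp_rdvd'[OF a]])
      thus False using Cna[OF H(1,2) _ Q(3)] H(4) a by blast
    qed
  qed (rule s)
  then obtain u where u: "u \<in> OKt K" "s = h * u" unfolding hU by (rule rdvdE)
  \<comment> \<open>An irreducible \<open>W\<close> dividing \<open>u\<close> would lie above some
    \<open>H\<close> in \<open>Gs\<close>, so some conjugate \<open>Q\<close> of \<open>P H\<close>
    would divide it. This \<open>Q\<close> divides \<open>s\<close>, hence occurs in
    \<open>h\<close>, and a second time in \<open>u\<close>, so its square would divide
    \<open>s\<close>.\<close>
  have "OKt_unit K u"
  proof (rule ccontr)
    assume "\<not> OKt_unit K u"
    moreover have "u \<noteq> 0" using s0 u by auto
    ultimately obtain W where W: "OKt_irreducible K W" "W rdvd u" using irreducible_divisor_exists u(1) by blast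
    have WO: "W \<in> OKt K" by (rule irreducible_mem[OF W(1)])
    have Us: "\<Prod>U \<in> OKt K" by (intro OKt_prod irreducible_mem) (auto simp: U_def S_def Cirr)
    hence hO: "h \<in> OKt K" by (simp add: hU)
    have Ws: "W rdvd s" unfolding u(2) by (rule rdvd_mult_left[OF hO W(2)])
    have na: "\<not> OKt_assoc K W (r W)" and two: "r W rdvd s \<or> r (r W) rdvd s"
      using irreducible_divisor_nonassoc[OF W(1) Ws] by auto
    have "W rdvd of_int_poly E" by (rule bad[OF W(1) Ws two])
    then obtain H where H: "prime H" "H dvd E" "W rdvd of_int_poly H" using prime_factor_below[OF W(1) E0] by blast
    have sp: "splits_with K \<rho> H W" by (rule splits_of_divisor[OF W(1) na H(1,3)])
    hence HG: "H \<in> Gs" using H E0 unfolding Gs_def splits_in_OKt_def by (auto simp: in_prime_factors_iff)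
    have "P H rdvd of_int_poly H"
    proof -
      have "P H rdvd Nr (P H)" unfolding Nr_def mult.assoc using PO[OF HG] by (intro rdvdI[of "r (P H) * r (r (P H))"] OKt_closed) simp_all
      thus ?thesis using PN[OF HG] by (auto simp: rdvd_neg)
    qed
    moreover have "of_int_poly H = Nr W \<or> of_int_poly H = - Nr W" using sp unfolding splits_with_iff by blast
    ultimately have "P H rdvd Nr W" by (auto simp: rdvd_neg)
    hence "P H rdvd W * r W \<or> P H rdvd r (r W)"
      unfolding Nr_def using WO by (intro irreducible_prime[OF Pirr[OF HG]] OKt_closed(4)) simp_all
    hence "P H rdvd W \<or> P H rdvd r W \<or> P H rdvd r (r W)"
      using irreducible_prime[OF Pirr[OF HG] WO, of "r W"] WO by auto
    hence "P H rdvd W \<or> r (r (P H)) rdvd W \<or> r (P H) rdvd W"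
      using r_rdvd_shift[OF PO[OF HG], of W] by blast
    then obtain Q where Q: "Q \<in> C H" "Q rdvd W" unfolding C_def by auto
    have "Q rdvd s" using Q(2) Ws rdvd_trans by blast
    hence "Q \<in> S H" using Q(1) by (simp add: S_def)
    hence "Q \<in> U" using HG by (auto simp: U_def)
    have finU: "finite U" using finG finS by (simp add: U_def)
    have "h = Q * \<Prod>(U - {Q})" unfolding hU by (rule prod.remove[OF finU \<open>Q \<in> U\<close>])
    moreover have "\<Prod>(U - {Q}) \<in> OKt K" by (intro OKt_prod irreducible_mem) (auto simp: U_def S_def Cirr)
    ultimately have "Q rdvd h" using rdvdI by blast
    moreover have "Q rdvd u" using Q(2) W(2) rdvd_trans by blast
    ultimately have "Q * Q rdvd h * u" by (rule rdvd_mono)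
    hence "Q ^ 2 rdvd s" unfolding u(2) by (simp add: power2_eq_square)
    thus False using sqf[OF Cirr[OF HG Q(1)]] by blast
  qed
  then obtain \<epsilon> where e: "\<epsilon> \<in> nf_units K" "u = [:\<epsilon>:]" unfolding unit_iff by auto
  have "s = smult \<epsilon> h" unfolding u(2) e by simp
  moreover have "S H \<subseteq> {P H, map_poly \<rho> (P H), map_poly (\<rho> \<circ> \<rho>) (P H)}" for H
    unfolding S_def C_def r_comp by blast
  ultimately show thesis using that[of P S \<epsilon>] P cardS e(1) unfolding h_def by blast
qed

end

end

subsection \<open>Halving over a cyclic cubic field\<close>
text \<open>The numerator is made so that \<open>p' - e1 = (k1 + k2) (k3 + k1)\<close>, and likewise
  for the other roots. The product of the three differences is then the square of the product of the
  three sums.\<close>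

lemma half_point_of_three_square_roots:
  fixes p k1 k2 k3 e1 e2 e3 A B C q :: "'a :: idom"
  assumes A: "A * q ^ 2 = - (e1 + e2 + e3)" and B: "B * q ^ 4 = e1 * e2 + e2 * e3 + e3 * e1"
    and C: "C * q ^ 6 = - (e1 * e2 * e3)"
    and k: "k1 ^ 2 = p - e1" "k2 ^ 2 = p - e2" "k3 ^ 2 = p - e3"
  defines "p' \<equiv> p + k1 * k2 + k2 * k3 + k3 * k1" and "y' \<equiv> (k1 + k2) * (k2 + k3) * (k3 + k1)"
  shows "y' ^ 2 = p' ^ 3 + A * p' ^ 2 * q ^ 2 + B * p' * q ^ 4 + C * q ^ 6"
    and "dup_num A B C p' (q ^ 2) = 4 * p * y' ^ 2"
proof -
  define u v w where "u = k1 + k2" and "v = k2 + k3" and "w = k3 + k1"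
  have e: "e1 = p - k1 ^ 2" "e2 = p - k2 ^ 2" "e3 = p - k3 ^ 2" using k by simp_all
  have d: "p' - e1 = u * w" "p' - e2 = u * v" "p' - e3 = v * w"
    unfolding p'_def e u_def v_def w_def by (simp_all add: algebra_simps power2_eq_square)
  have y': "y' = u * v * w" unfolding y'_def u_def v_def w_def ..
  define f where "f = p' ^ 3 + (A * q ^ 2) * p' ^ 2 * 1 + (B * q ^ 4) * p' * 1 ^ 2 + (C * q ^ 6) * 1 ^ 3"
  define f' where "f' = 3 * p' ^ 2 + 2 * (A * q ^ 2) * p' * 1 + (B * q ^ 4) * 1 ^ 2"
  have "f = (p' - e1) * (p' - e2) * (p' - e3)"
    unfolding f_def A B C by (simp add: algebra_simps eval_nat_numeral)
  also have "\<dots> = y' ^ 2" unfolding d y' by (simp add: algebra_simps power2_eq_square)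
  finally have f: "f = y' ^ 2" .
  thus "y' ^ 2 = p' ^ 3 + A * p' ^ 2 * q ^ 2 + B * p' * q ^ 4 + C * q ^ 6"
    unfolding f_def by (simp add: algebra_simps)
  have "f' = (p' - e1) * (p' - e2) + (p' - e2) * (p' - e3) + (p' - e3) * (p' - e1)"
    unfolding f'_def A B by (simp add: algebra_simps eval_nat_numeral)
  also have "\<dots> = y' * (u + v + w)" unfolding d y' by (simp add: algebra_simps)
  finally have f': "f' = y' * (u + v + w)" .
  have "8 * p' + 4 * (A * q ^ 2) * 1 = 4 * ((p' - e1) + (p' - e2) + (p' - e3)) - 4 * p'"
    unfolding A by (simp add: algebra_simps)
  hence l: "8 * p' + 4 * (A * q ^ 2) * 1 = 4 * (u * w + u * v + v * w) - 4 * p'" unfolding d .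
  have s: "(u + v + w) ^ 2 - 4 * (u * w + u * v + v * w) + 4 * p' = 4 * p"
    unfolding u_def v_def w_def p'_def by (simp add: algebra_simps power2_eq_square)
  have "dup_num A B C p' (q ^ 2) = dup_num (A * q ^ 2) (B * q ^ 4) (C * q ^ 6) p' 1"
    unfolding dup_num_def by (simp add: algebra_simps eval_nat_numeral)
  also have "\<dots> = f' ^ 2 - (8 * p' + 4 * (A * q ^ 2) * 1) * f"
    unfolding f_def f'_def by (rule dup_num_eq)
  also have "\<dots> = y' ^ 2 * ((u + v + w) ^ 2 - 4 * (u * w + u * v + v * w) + 4 * p')"
    unfolding f f' l by (simp add: algebra_simps power2_eq_square)
  finally show "dup_num A B C p' (q ^ 2) = 4 * p * y' ^ 2" unfolding s by (simp add: mult_ac)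
qed

lemma poly_of_int_poly_of_rat: "poly (of_int_poly p) (of_rat t) = (of_rat (poly (of_int_poly p) t) :: complex)"
  by (simp add: poly_altdef of_rat_sum of_rat_mult of_rat_power)

context cyclic_cubic_pid
begin

lemma \<theta>_R: "\<theta>1 \<in> R" "\<theta>2 \<in> R" "\<theta>3 \<in> R"
proof -
  have "algebraic_integer z" if "z = \<theta>1 \<or> z = \<theta>2 \<or> z = \<theta>3" for z
    unfolding algebraic_integer_def
    by (intro exI[of _ "[:c, b, a, 1:]"] conjI) (use that in \<open>auto simp only: f_eval, simp_all\<close>)
  thus "\<theta>1 \<in> R" "\<theta>2 \<in> R" "\<theta>3 \<in> R" using \<theta>_K by (auto simp: ring_of_integers_def)
qed

lemma \<rho>_uminus: "x \<in> K \<Longrightarrow> \<rho> (- x) = - \<rho> x"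
  using \<rho>_add[of x "- x"] K_closed(5)[of x] by (simp add: eq_neg_iff_add_eq_0 add.commute)

lemma poly_r_of_rat:
  assumes "P \<in> KX"
  shows "poly P (of_rat t) \<in> K" "poly (r P) (of_rat t) = \<rho> (poly P (of_rat t))"
proof -
  have t: "of_rat t ^ n \<in> K" "\<rho> (of_rat t ^ n) = of_rat t ^ n" for n
    using subfield_of_rat[OF sub, of "t ^ n"] \<rho>_of_rat[of "t ^ n"] by (simp_all add: of_rat_power)
  have c: "coeff P i \<in> K" for i using assms by (simp add: KX_def)
  have "degree (r (r (r P))) \<le> degree (r P)" using degree_map_poly_le le_trans by blast
  hence d: "degree (r P) = degree P" using degree_map_poly_le[of \<rho> P] by simp
  show "poly P (of_rat t) \<in> K" unfolding poly_altdef by (intro K_sum K_closed(4) c t)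
  have "\<rho> (poly P (of_rat t)) = (\<Sum>i\<le>degree P. \<rho> (coeff P i * of_rat t ^ i))"
    unfolding poly_altdef by (intro \<rho>_sum K_closed(4) c t)
  also have "\<dots> = poly (r P) (of_rat t)"
    unfolding poly_altdef d by (simp add: \<rho>_mult c t)
  finally show "poly (r P) (of_rat t) = \<rho> (poly P (of_rat t))" ..
qed

text \<open>The difference of the two conjugates is \<open>g q^2\<close> times a difference of roots
  that divides \<open>e\<close>. And \<open>P\<close> cannot divide \<open>q\<close>, for then it
  would divide \<open>p\<close> too.\<close>

lemma prime_common_divisor_of_conjugates:
  fixes p q g :: "int poly"
  assumes P: "OKt_irreducible K P" and cop: "coprime p q"
    and xyz: "x \<in> R" "y \<in> R" "w \<in> R" "of_int e = (x - y) * w"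
    and dvd: "P rdvd of_int_poly p - [:x:] * of_int_poly (g * q ^ 2)"
       "P rdvd of_int_poly p - [:y:] * of_int_poly (g * q ^ 2)"
  shows "P rdvd of_int_poly (smult e g)"
proof -
  have PO: "P \<in> OKt K" by (rule irreducible_mem[OF P])
  define G where "G = (of_int_poly (g * q ^ 2) :: complex poly)"
  have "P rdvd (of_int_poly p - [:x:] * G) - (of_int_poly p - [:y:] * G)"
    using dvd unfolding G_def by (rule rdvd_diff)
  hence "P rdvd ((of_int_poly p - [:x:] * G) - (of_int_poly p - [:y:] * G)) * [:- w:]"
    by (rule rdvd_mult_right[rotated]) (intro OKt_closed(7) R_closed(5) xyz)
  also have "((of_int_poly p - [:x:] * G) - (of_int_poly p - [:y:] * G)) * [:- w:] = smult ((x - y) * w) G"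
    by (simp add: smult_diff_left algebra_simps)
  also have "\<dots> = of_int_poly (smult e g) * of_int_poly q ^ 2"
    unfolding xyz(4)[symmetric] G_def by (simp add: hom_distribs)
  finally have "P rdvd of_int_poly (smult e g) \<or> P rdvd of_int_poly q ^ 2"
    by (intro irreducible_prime[OF P]) (simp_all add: OKt_power)
  moreover have "\<not> P rdvd of_int_poly q ^ 2"
  proof
    assume "P rdvd of_int_poly q ^ 2"
    hence Pq: "P rdvd of_int_poly q" by (rule irreducible_dvd_power[OF P of_int_OKt])
    have xG: "[:x:] * (of_int_poly g * of_int_poly q) \<in> OKt K"
      using OKt_closed(7)[OF xyz(1)] of_int_OKt by (intro OKt_closed(4))
    have "P rdvd [:x:] * (of_int_poly g * of_int_poly q) * of_int_poly q" by (rule rdvd_mult_left[OF xG Pq])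
    hence "P rdvd [:x:] * G" unfolding G_def by (simp add: hom_distribs power2_eq_square mult_ac)
    with dvd(1) have "P rdvd (of_int_poly p - [:x:] * G) + [:x:] * G" unfolding G_def by (rule rdvd_add)
    hence Pp: "P rdvd of_int_poly p" by simp
    obtain m where m: "Nr P = of_int_poly m" using Nr_int[OF PO] .
    have "Nr P \<noteq> 0" unfolding Nr_def using irreducible_nz[OF P] by simp
    hence m0: "m \<noteq> 0" using m by auto
    \<comment> \<open>Norms carry a common prime of \<open>p\<close> and \<open>q\<close> back to
      \<int>[t], where the two are known to be coprime.\<close>
    have "m dvd z ^ 3" if "P rdvd of_int_poly z" for z
    proof (rule int_rdvd_imp_dvd[OF _ m0])
      have "Nr P rdvd Nr (of_int_poly z)" by (rule Nr_rdvd[OF PO that])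
      moreover have "Nr (of_int_poly z) = of_int_poly (z ^ 3)"
        unfolding Nr_def by (simp add: hom_distribs power3_eq_cube)
      ultimately show "of_int_poly m rdvd of_int_poly (z ^ 3)" unfolding m by simp
    qed
    hence "m dvd p ^ 3" "m dvd q ^ 3" using Pp Pq by blast+
    moreover have "coprime (p ^ 3) (q ^ 3)" using cop by simp
    ultimately have "is_unit m" by (meson coprime_common_divisor)
    thus False using unit_of_Nr_unit[OF PO m] irreducible_not_unit[OF P] by blast
  qed
  ultimately show ?thesis by blast
qed

text \<open>Write \<open>p - \<theta>1 g q\<^sup>2 = \<epsilon> h k\<^sup>2\<close> with a product
  \<open>h\<close> as in \<open>cond_B\<close>. At \<open>t0\<close> the left side is a nonzero
  rational square, so \<open>\<epsilon> h(t0)\<close> is a square in \<open>K\<close> and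
  \<open>h\<close> must be constant. The rational value \<kappa> of the root at \<open>t0\<close> is
  recorded because the conjugate roots share it.\<close>

lemma difference_is_square_of_cond_B:
  fixes g p q y :: "int poly" and t0 :: rat
  assumes condB: "cond_B K e g t0" and g0: "g \<noteq> 0" and cop: "coprime p q"
    and y: "y ^ 2 = p ^ 3 + [:a:] * g * p ^ 2 * q ^ 2 + [:b:] * g ^ 2 * p * q ^ 4 + [:c:] * g ^ 3 * q ^ 6"
    and qt: "poly (of_int_poly q) t0 = 0" and pt: "poly (of_int_poly p) t0 \<noteq> 0"
  defines "G \<equiv> of_int_poly (g * q ^ 2)"
  obtains k \<kappa> where "k \<in> KX" "of_int_poly p - [:\<theta>1:] * G = k ^ 2" "poly k (of_rat t0) = of_rat \<kappa>" "\<kappa> \<noteq> 0"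
    "poly (of_int_poly p) t0 = \<kappa> ^ 2"
proof -
  define Pc where "Pc = (of_int_poly p :: complex poly)"
  define \<alpha> where "\<alpha> = Pc - [:\<theta>1:] * G"
  have PcO: "Pc \<in> OKt K" and GO: "G \<in> OKt K" by (simp_all add: Pc_def G_def)
  have \<theta>O: "[:\<theta>1:] \<in> OKt K" "[:\<theta>2:] \<in> OKt K" "[:\<theta>3:] \<in> OKt K" by (simp_all add: OKt_closed(7) \<theta>_R)
  have \<alpha>O: "\<alpha> \<in> OKt K" unfolding \<alpha>_def by (intro OKt_closed(6) OKt_closed(4) PcO GO \<theta>O)
  have rdiff: "r (Pc - [:x:] * G) = Pc - [:\<rho> x:] * G" if "x \<in> K" for x
  proof -
    have "r (Pc + smult (- x) G) = r Pc + smult (\<rho> (- x)) (r G)"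
      using that OKt_KX[OF PcO] OKt_KX[OF GO] by (simp only: r_add r_smult KX_closed K_closed)
    also have "\<dots> = Pc + smult (\<rho> (- x)) G" unfolding Pc_def G_def r_of_int ..
    finally show ?thesis using that by (simp add: \<rho>_uminus)
  qed
  have r1: "r \<alpha> = Pc - [:\<theta>2:] * G" unfolding \<alpha>_def rdiff[OF \<theta>_K(1)] \<rho>_\<theta> ..
  have r2: "r (r \<alpha>) = Pc - [:\<theta>3:] * G" unfolding r1 rdiff[OF \<theta>_K(2)] \<rho>_\<theta> ..
  define Y where "Y = (of_int_poly y :: complex poly)"
  have norm: "Nr \<alpha> = Y ^ 2"
  proof -
    define x1 x2 x3 where "x1 = [:\<theta>1:]" and "x2 = [:\<theta>2:]" and "x3 = [:\<theta>3:]"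
    have va: "[:of_int a:] = - (x1 + x2 + x3)" "[:of_int b:] = x1 * x2 + x2 * x3 + x3 * x1" "[:of_int c:] = - (x1 * x2 * x3)"
      unfolding x1_def x2_def x3_def a_eq b_eq c_eq by simp_all
    define g' q' where "g' = (of_int_poly g :: complex poly)" and "q' = (of_int_poly q :: complex poly)"
    have G: "G = g' * q' ^ 2" unfolding G_def g'_def q'_def by (simp add: hom_distribs)
    have const: "of_int_poly [:n:] = ([:of_int n:] :: complex poly)" for n by (simp add: hom_distribs)
    have "Y ^ 2 = of_int_poly (y ^ 2)" unfolding Y_def by (simp add: hom_distribs)
    also have "\<dots> = Pc ^ 3 + [:of_int a:] * g' * Pc ^ 2 * q' ^ 2 + [:of_int b:] * g' ^ 2 * Pc * q' ^ 4 + [:of_int c:] * g' ^ 3 * q' ^ 6"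
      unfolding y Pc_def g'_def q'_def
      by (simp only: of_int_poly_hom.hom_add of_int_poly_hom.hom_mult of_int_poly_hom.hom_power const)
    also have "\<dots> = (Pc - x1 * G) * (Pc - x2 * G) * (Pc - x3 * G)"
      unfolding va G by (simp add: algebra_simps eval_nat_numeral)
    also have "\<dots> = Nr \<alpha>" unfolding Nr_def r1 r2[unfolded r1] x1_def x2_def x3_def by (simp only: \<alpha>_def)
    finally show ?thesis ..
  qed
  have ev\<alpha>: "poly \<alpha> (of_rat t0) = of_rat (poly (of_int_poly p) t0)"
    unfolding \<alpha>_def Pc_def G_def using qt
    by (simp add: hom_distribs poly_of_int_poly_of_rat)
  have \<alpha>0: "\<alpha> \<noteq> 0" using ev\<alpha> pt by auto
  define evq where "evq = poly (of_int_poly y) t0 / poly (of_int_poly p) t0"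
  have psq: "poly (of_int_poly p) t0 = evq ^ 2"
  proof -
    have "poly (of_int_poly (y ^ 2)) t0 = poly (of_int_poly p) t0 ^ 3"
      unfolding y using qt by (simp add: hom_distribs)
    hence "poly (of_int_poly y) t0 ^ 2 = poly (of_int_poly p) t0 ^ 3" by (simp add: hom_distribs)
    thus ?thesis using pt by (simp add: evq_def power_divide power2_eq_square power3_eq_cube)
  qed
  have evq0: "evq \<noteq> 0" using psq pt by auto
  obtain s k where sk: "s \<in> OKt K" "k \<in> OKt K" "\<alpha> = s * k ^ 2" "\<And>P. OKt_irreducible K P \<Longrightarrow> \<not> P ^ 2 rdvd s"
    using squarefree_decomposition[OF \<alpha>O \<alpha>0] by blast
  have nz: "s \<noteq> 0" "k \<noteq> 0" using sk(3) \<alpha>0 by auto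
  have YO: "Y \<in> OKt K" by (simp add: Y_def)
  have E0: "smult e g \<noteq> 0" using g0 e0 by simp
  \<comment> \<open>If \<open>P\<close> and a conjugate of \<open>P\<close> divide \<open>s\<close>,
    then \<open>P\<close> divides two different conjugates of \<alpha>.\<close>
  have bad: "P rdvd of_int_poly (smult e g)"
    if P: "OKt_irreducible K P" "P rdvd s" and two: "r P rdvd s \<or> r (r P) rdvd s" for P
  proof -
    have PO: "P \<in> OKt K" by (rule irreducible_mem[OF P(1)])
    have lift: "Q rdvd \<alpha>" if "Q rdvd s" for Q unfolding sk(3)
      by (rule rdvd_mult_right[OF OKt_power[OF sk(2)] that])
    have P\<alpha>: "P rdvd Pc - [:\<theta>1:] * G" using lift[OF P(2)] unfolding \<alpha>_def .
    from two show ?thesis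
    proof
      assume "r P rdvd s"
      hence "P rdvd r (r \<alpha>)" using lift r_rdvd_shift(2)[OF PO] by blast
      hence P3: "P rdvd Pc - [:\<theta>3:] * G" unfolding r2 .
      show ?thesis
        by (rule prime_common_divisor_of_conjugates[OF P(1) cop \<theta>_R(3,1), of "(\<theta>1 - \<theta>2) * (\<theta>2 - \<theta>3)"])
           (use P3 P\<alpha> \<theta>_R in \<open>auto simp: Pc_def G_def e_eq mult_ac intro!: R_closed(4,6)\<close>)
    next
      assume "r (r P) rdvd s"
      hence "P rdvd r \<alpha>" using lift r_rdvd_shift(1)[OF PO] by blast
      hence P2: "P rdvd Pc - [:\<theta>2:] * G" unfolding r1 .
      show ?thesis
        by (rule prime_common_divisor_of_conjugates[OF P(1) cop \<theta>_R(1,2), of "(\<theta>2 - \<theta>3) * (\<theta>3 - \<theta>1)"])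
           (use P2 P\<alpha> \<theta>_R in \<open>auto simp: Pc_def G_def e_eq mult_ac intro!: R_closed(4,6)\<close>)
    qed
  qed
  define Gs where "Gs = {H \<in> prime_factors (smult e g). splits_in_OKt K H}"
  obtain P S \<epsilon> where PS: "\<And>H. H \<in> Gs \<Longrightarrow> splits_with K \<rho> H (P H)"
    "\<And>H. H \<in> Gs \<Longrightarrow> S H \<subseteq> {P H, map_poly \<rho> (P H), map_poly (\<rho> \<circ> \<rho>) (P H)}"
    "\<And>H. H \<in> Gs \<Longrightarrow> card (S H) \<in> {0, 2}"
    "\<epsilon> \<in> nf_units K" "s = smult \<epsilon> (\<Prod>H\<in>Gs. \<Prod>(S H))"
    using squarefree_part_as_choice[OF sk(1,2) nz(2) YO sk(4) norm[unfolded sk(3)] E0 nz(1) bad]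
    unfolding Gs_def by blast
  define h where "h = (\<Prod>H\<in>Gs. \<Prod>(S H))"
  have evk: "of_rat evq ^ 2 = \<epsilon> * poly h (of_rat t0) * poly k (of_rat t0) ^ 2"
    using ev\<alpha> unfolding psq sk(3) PS(5) h_def[symmetric] by (simp add: of_rat_power mult.assoc)
  have kK: "poly k (of_rat t0) \<in> K" by (rule poly_r_of_rat(1)[OF OKt_KX[OF sk(2)]])
  have k0: "poly k (of_rat t0) \<noteq> 0" using evk evq0 by auto
  define z where "z = of_rat evq / poly k (of_rat t0)"
  have zK: "z \<in> K" unfolding z_def by (intro K_closed(8) subfield_of_rat[OF sub] kK)
  have z2: "z ^ 2 = \<epsilon> * poly h (of_rat t0)" unfolding z_def power_divide evk using k0 by simp
  have "degree h = 0"
  proof (rule ccontr)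
    assume "degree h \<noteq> 0"
    hence "degree (\<Prod>H\<in>Gs. \<Prod>(S H)) > 0" by (simp add: h_def)
    moreover have "\<forall>H\<in>Gs. splits_with K \<rho> H (P H)
                 \<and> S H \<subseteq> {P H, map_poly \<rho> (P H), map_poly (\<rho> \<circ> \<rho>) (P H)}
                 \<and> card (S H) \<in> {0, 2}" using PS(1-3) by (intro ballI conjI)
    ultimately have "\<not> (\<exists>z\<in>K. z ^ 2 = \<epsilon> * poly (\<Prod>H\<in>Gs. \<Prod>(S H)) (of_rat t0))"
      using condB[unfolded cond_B_def Let_def, folded Gs_def, rule_format, of \<rho> P S \<epsilon>] PS(4) by blast
    thus False using zK z2 unfolding h_def by blast
  qed
  \<comment> \<open>For constant \<open>h\<close> the relation \<open>z^2 = \<epsilon> h\<close>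
    holds between polynomials and not only at \<open>t0\<close>.\<close>
  then obtain \<eta> where \<eta>: "h = [:\<eta>:]" by (rule degree_eq_zeroE)
  have "\<alpha> = (smult z k) ^ 2"
    using z2 unfolding sk(3) PS(5) h_def[symmetric] \<eta> by (simp add: power2_eq_square)
  moreover have "smult z k \<in> KX" by (rule KX_closed(3)[OF zK OKt_KX[OF sk(2)]])
  moreover have "poly (smult z k) (of_rat t0) = of_rat evq" using k0 by (simp add: z_def)
  ultimately show thesis using that[of "smult z k" evq] evq0 psq unfolding \<alpha>_def Pc_def by blast
qed

end

subsection \<open>Injectivity of the specialization\<close>
lemma map_of_rat_of_int_poly: "map_poly of_rat (of_int_poly p :: rat poly) = (of_int_poly p :: complex poly)"
  by (rule poly_eqI) simp

text \<open>Conjugating one square root gives the other two, and \<rho> permutes the three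
  cyclically, so the symmetric expressions \<open>p1\<close> and \<open>y1\<close> are rational. All
  three take the value \<kappa> at \<open>t0\<close>, which makes the numerator
  \<open>4 \<kappa>\<^sup>2\<close> there.\<close>

lemma (in cyclic_cubic_pid) halvable_of_cond_B:
  fixes g p q y :: "int poly" and t0 :: rat
  defines "A \<equiv> [:a:] * g" and "B \<equiv> [:b:] * g ^ 2" and "C \<equiv> [:c:] * g ^ 3"
  assumes condB: "cond_B K e g t0" and g0: "g \<noteq> 0" and cop: "coprime p q"
    and y: "y ^ 2 = p ^ 3 + A * p ^ 2 * q ^ 2 + B * p * q ^ 4 + C * q ^ 6"
    and qt: "poly (of_int_poly q) t0 = 0" and pt: "poly (of_int_poly p) t0 \<noteq> 0"
  shows "\<exists>p' y' :: rat poly. poly p' t0 \<noteq> 0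
         \<and> y' ^ 2 = p' ^ 3 + of_int_poly A * p' ^ 2 * of_int_poly q ^ 2
             + of_int_poly B * p' * of_int_poly q ^ 4 + of_int_poly C * of_int_poly q ^ 6
         \<and> dup_num (of_int_poly A) (of_int_poly B) (of_int_poly C) p' (of_int_poly q ^ 2) = 4 * of_int_poly p * y' ^ 2"
proof -
  define G where "G = (of_int_poly (g * q ^ 2) :: complex poly)"
  define Pc where "Pc = (of_int_poly p :: complex poly)"
  define Q where "Q = (of_int_poly q :: complex poly)"
  obtain k \<kappa> where k: "k \<in> KX" "Pc - [:\<theta>1:] * G = k ^ 2" "poly k (of_rat t0) = of_rat \<kappa>" "\<kappa> \<noteq> 0"
    "poly (of_int_poly p) t0 = \<kappa> ^ 2"
    using difference_is_square_of_cond_B[OF condB g0 cop y[unfolded A_def B_def C_def] qt pt] unfolding G_def Pc_def by blast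
  define k2 k3 where "k2 = r k" and "k3 = r (r k)"
  have kX: "k \<in> KX" "k2 \<in> KX" "k3 \<in> KX" unfolding k2_def k3_def by (intro KX_closed k(1))+
  have PcX: "Pc \<in> KX" and GX: "G \<in> KX" by (simp_all add: Pc_def G_def OKt_KX)
  have rk: "r k = k2" "r k2 = k3" "r k3 = k" by (simp_all add: k2_def k3_def)
  have rsq: "r (m ^ 2) = r m ^ 2" if "m \<in> KX" for m using that by (simp add: power2_eq_square r_mult)
  have rdiff: "r (Pc - [:x:] * G) = Pc - [:\<rho> x:] * G" if "x \<in> K" for x
  proof -
    have "r (Pc + smult (- x) G) = r Pc + smult (\<rho> (- x)) (r G)"
      using that PcX GX by (simp only: r_add r_smult KX_closed K_closed)
    also have "\<dots> = Pc + smult (\<rho> (- x)) G" unfolding Pc_def G_def r_of_int ..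
    finally show ?thesis using that by (simp add: \<rho>_uminus)
  qed
  have "r (Pc - [:\<theta>1:] * G) = r k ^ 2" unfolding k(2) by (rule rsq[OF kX(1)])
  hence K2: "Pc - [:\<theta>2:] * G = k2 ^ 2" unfolding rdiff[OF \<theta>_K(1)] \<rho>_\<theta> rk .
  have "r (Pc - [:\<theta>2:] * G) = r k2 ^ 2" unfolding K2 by (rule rsq[OF kX(2)])
  hence K3: "Pc - [:\<theta>3:] * G = k3 ^ 2" unfolding rdiff[OF \<theta>_K(2)] \<rho>_\<theta> rk .
  define x1 x2 x3 where "x1 = [:\<theta>1:]" and "x2 = [:\<theta>2:]" and "x3 = [:\<theta>3:]"
  have va: "[:of_int a:] = - (x1 + x2 + x3)" "[:of_int b:] = x1 * x2 + x2 * x3 + x3 * x1" "[:of_int c:] = - (x1 * x2 * x3)"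
    unfolding x1_def x2_def x3_def a_eq b_eq c_eq by simp_all
  define g' where "g' = (of_int_poly g :: complex poly)"
  have Geq: "G = g' * Q ^ 2" unfolding G_def g'_def Q_def by (simp add: hom_distribs)
  have const: "of_int_poly [:n:] = ([:of_int n:] :: complex poly)" for n by (simp add: hom_distribs)
  have ABC: "of_int_poly A = [:of_int a:] * g'" "of_int_poly B = [:of_int b:] * g' ^ 2" "of_int_poly C = [:of_int c:] * g' ^ 3"
    unfolding A_def B_def C_def g'_def
    by (simp_all only: of_int_poly_hom.hom_mult of_int_poly_hom.hom_power const)
  have eA: "of_int_poly A * Q ^ 2 = - (x1 * G + x2 * G + x3 * G)"
    unfolding ABC va Geq by (simp add: algebra_simps)
  have eB: "of_int_poly B * Q ^ 4 = (x1 * G) * (x2 * G) + (x2 * G) * (x3 * G) + (x3 * G) * (x1 * G)"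
    unfolding ABC va Geq by (simp add: algebra_simps eval_nat_numeral)
  have eC: "of_int_poly C * Q ^ 6 = - ((x1 * G) * (x2 * G) * (x3 * G))"
    unfolding ABC va Geq by (simp add: algebra_simps eval_nat_numeral)
  define p1 where "p1 = Pc + k * k2 + k2 * k3 + k3 * k"
  define y1 where "y1 = (k + k2) * (k2 + k3) * (k3 + k)"
  note half = half_point_of_three_square_roots[OF eA eB eC k(2)[symmetric, folded x1_def]
      K2[symmetric, folded x2_def] K3[symmetric, folded x3_def], folded p1_def y1_def]
  have pX: "p1 \<in> KX" "y1 \<in> KX" unfolding p1_def y1_def by (intro KX_closed kX PcX)+
  have "r Pc = Pc" by (simp add: Pc_def)
  hence "r p1 = p1" unfolding p1_def using kX PcX by (simp add: r_add r_mult KX_closed rk add_ac mult_ac)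
  then obtain p' where p': "p1 = map_poly of_rat p'" using fixed_KX[OF pX(1)] by blast
  have "r y1 = y1" unfolding y1_def using kX by (simp add: r_add r_mult KX_closed rk add_ac mult_ac)
  then obtain y' where y': "y1 = map_poly of_rat y'" using fixed_KX[OF pX(2)] by blast
  have kt2: "poly k2 (of_rat t0) = of_rat \<kappa>"
    using poly_r_of_rat(2)[OF kX(1), of t0] unfolding rk k(3) \<rho>_of_rat .
  have kt3: "poly k3 (of_rat t0) = of_rat \<kappa>"
    using poly_r_of_rat(2)[OF kX(2), of t0] unfolding rk kt2 \<rho>_of_rat .
  have "poly p1 (of_rat t0) = of_rat (4 * \<kappa> ^ 2)"
    unfolding p1_def Pc_def using k(5)
    by (simp add: poly_of_int_poly_of_rat kt2 kt3 k(3) of_rat_mult of_rat_power power2_eq_square)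
  hence "poly p' t0 \<noteq> 0" unfolding p' using k(4) by (simp only: of_rat_hom.poly_map_poly of_rat_eq_iff) simp
  moreover have "y' ^ 2 = p' ^ 3 + of_int_poly A * p' ^ 2 * of_int_poly q ^ 2
             + of_int_poly B * p' * of_int_poly q ^ 4 + of_int_poly C * of_int_poly q ^ 6"
  proof -
    have "map_poly of_rat (y' ^ 2) = (map_poly of_rat (p' ^ 3 + of_int_poly A * p' ^ 2 * of_int_poly q ^ 2
             + of_int_poly B * p' * of_int_poly q ^ 4 + of_int_poly C * of_int_poly q ^ 6) :: complex poly)"
      using half(1) unfolding y' p' Q_def
      by (simp only: of_rat_poly_hom.hom_add of_rat_poly_hom.hom_mult of_rat_poly_hom.hom_power map_of_rat_of_int_poly)
    thus ?thesis by (simp only: of_rat_poly_hom.eq_iff)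
  qed
  moreover have "dup_num (of_int_poly A) (of_int_poly B) (of_int_poly C) p' (of_int_poly q ^ 2) = 4 * of_int_poly p * y' ^ 2"
  proof -
    have "map_poly of_rat (dup_num (of_int_poly A) (of_int_poly B) (of_int_poly C) p' (of_int_poly q ^ 2))
       = (map_poly of_rat (4 * of_int_poly p * y' ^ 2) :: complex poly)"
      using half(2) unfolding y' p' Q_def Pc_def dup_num_def
      by (simp only: of_rat_poly_hom.hom_add of_rat_poly_hom.hom_minus of_rat_poly_hom.hom_mult of_rat_poly_hom.hom_power
           of_rat_poly_hom.hom_numeral map_of_rat_of_int_poly)
    thus ?thesis by (simp only: of_rat_poly_hom.eq_iff)
  qed
  ultimately show ?thesis by blast
qed

section \<open>Roots, discriminant and smoothness of the cubic\<close>

lemma cubic_roots_exist: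
  fixes a b c :: int
  obtains x y z :: complex where "of_int a = - (x + y + z)" "of_int b = x * y + y * z + z * x" "of_int c = - (x * y * z)"
proof -
  define p where "p = [:of_int c, of_int b, of_int a, 1 :: complex:]"
  have lc: "coeff p (degree p) = 1" and dp: "degree p = 3" by (simp_all add: p_def)
  obtain as where as: "(\<Prod>u\<leftarrow>as. [:- u, 1:]) = p" "length as = 3"
    using fundamental_theorem_algebra_factorized[of p] lc dp by auto
  then obtain x y z where "as = [x, y, z]"
    by (auto simp: length_Suc_conv eval_nat_numeral)
  hence "p = [:- x, 1:] * ([:- y, 1:] * [:- z, 1:])" using as(1) by simp
  hence "p = [:- (x * y * z), x * y + y * z + z * x, - (x + y + z), 1:]"
    by (simp add: algebra_simps)
  thus thesis using that[of x y z] unfolding p_def by simp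
qed

lemma cubic_disc_nz_of_rsquarefree:
  fixes a b c :: int
  assumes "rsquarefree (of_int_poly [:c, b, a, 1:] :: complex poly)"
  shows "cubic_disc a b c \<noteq> 0"
proof
  assume 0: "cubic_disc a b c = 0"
  obtain x y z :: complex where v: "of_int a = - (x + y + z)" "of_int b = x * y + y * z + z * x" "of_int c = - (x * y * z)"
    by (rule cubic_roots_exist)
  have "cubic_disc (of_int a) (of_int b) (of_int c) = (of_int (cubic_disc a b c) :: complex)"
    unfolding cubic_disc_def by simp
  hence "((x - y) * (y - z) * (z - x)) ^ 2 = 0" using cubic_disc_roots[OF v] 0 by simp
  hence eq: "x = y \<or> y = z \<or> z = x" by auto
  define P where "P = (of_int_poly [:c, b, a, 1:] :: complex poly)"
  have P: "poly P w = (w - x) * (w - y) * (w - z)" for w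
  proof -
    have "poly P w = of_int c + w * (of_int b + w * (of_int a + w))" by (simp add: P_def hom_distribs)
    thus ?thesis unfolding v by (simp add: algebra_simps)
  qed
  have P': "poly (pderiv P) w = (w - x) * (w - y) + (w - y) * (w - z) + (w - z) * (w - x)" for w
  proof -
    have "poly (pderiv P) w = of_int b + w * (2 * of_int a + w * 3)" by (simp add: P_def hom_distribs pderiv_pCons algebra_simps)
    thus ?thesis unfolding v by (simp add: algebra_simps)
  qed
  have "\<exists>w. poly P w = 0 \<and> poly (pderiv P) w = 0"
    using eq
  proof (elim disjE)
    assume "x = y" thus ?thesis by (intro exI[of _ x]) (simp add: P P')
  next
    assume "y = z" thus ?thesis by (intro exI[of _ y]) (simp add: P P')
  next
    assume "z = x" thus ?thesis by (intro exI[of _ z]) (simp add: P P')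
  qed
  thus False using assms unfolding P_def[symmetric] rsquarefree_roots by blast
qed

lemma smooth_of_rsquarefree:
  fixes A B C :: rat
  assumes sq: "rsquarefree (map_poly of_rat [:C, B, A, 1:] :: complex poly)"
    and x: "x ^ 3 + A * x ^ 2 + B * x + C = 0"
  shows "3 * x ^ 2 + 2 * A * x + B \<noteq> 0"
proof
  assume d: "3 * x ^ 2 + 2 * A * x + B = 0"
  define P where "P = [:C, B, A, 1:]"
  have "poly P x = x ^ 3 + A * x ^ 2 + B * x + C" by (simp add: P_def algebra_simps eval_nat_numeral)
  hence "poly P x = 0" using x by simp
  hence 1: "poly (map_poly of_rat P) (of_rat x) = (0 :: complex)" by simp
  have "poly (pderiv P) x = 3 * x ^ 2 + 2 * A * x + B" by (simp add: P_def pderiv_pCons algebra_simps eval_nat_numeral)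
  hence "poly (pderiv P) x = 0" using d by simp
  hence "poly (map_poly of_rat (pderiv P)) (of_rat x) = (0 :: complex)" by simp
  hence "poly (pderiv (map_poly of_rat P)) (of_rat x) = (0 :: complex)" by (simp add: hom_distribs)
  thus False using 1 sq unfolding P_def[symmetric] rsquarefree_roots by blast
qed

text \<open>Separability of \<open>f\<close> enters through the degree bound for duplication, and
  that of the specialized cubic through the smoothness used for differences of points.\<close>

lemma inj_on_specialize_if_halvable:
  fixes a b c :: int and g :: "int poly" and t0 :: rat
  defines "A \<equiv> [:a:] * g" and "B \<equiv> [:b:] * g ^ 2" and "C \<equiv> [:c:] * g ^ 3"
  assumes f_sqfree: "rsquarefree (map_poly of_int [:c, b, a, 1:] :: complex poly)"
    and g0: "g \<noteq> 0"
    and spec_ok: "rsquarefree (map_poly of_rat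
          [:of_int c * poly (map_poly of_int g) t0 ^ 3, of_int b * poly (map_poly of_int g) t0 ^ 2,
            of_int a * poly (map_poly of_int g) t0, 1:] :: complex poly)"
    and halve: "\<And>p q y. coprime p q \<Longrightarrow> q \<noteq> 0 \<Longrightarrow>
       y ^ 2 = p ^ 3 + A * p ^ 2 * q ^ 2 + B * p * q ^ 4 + C * q ^ 6 \<Longrightarrow>
       poly (of_int_poly q) t0 = 0 \<Longrightarrow> poly (of_int_poly p) t0 \<noteq> 0 \<Longrightarrow>
       \<exists>p' y' :: rat poly. poly p' t0 \<noteq> 0
         \<and> y' ^ 2 = p' ^ 3 + of_int_poly A * p' ^ 2 * of_int_poly q ^ 2
             + of_int_poly B * p' * of_int_poly q ^ 4 + of_int_poly C * of_int_poly q ^ 6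
         \<and> dup_num (of_int_poly A) (of_int_poly B) (of_int_poly C) p' (of_int_poly q ^ 2) = 4 * of_int_poly p * y' ^ 2"
  shows "inj_on (specialize t0) (Eg_points a b c g)"
proof -
  define A' B' C' where "A' = rf_of_intpoly A" and "B' = rf_of_intpoly B" and "C' = rf_of_intpoly C"
  have ABC: "A' = of_int a * rf_of_intpoly g" "B' = of_int b * rf_of_intpoly g ^ 2" "C' = of_int c * rf_of_intpoly g ^ 3"
    unfolding A'_def B'_def C'_def A_def B_def C_def
    by (simp_all only: rf_of_intpoly_hom(4) rf_of_intpoly_power rf_of_intpoly_of_int)
  have g: "rf_regular t0 (rf_of_intpoly g)" "rf_eval t0 (rf_of_intpoly g) = poly (of_int_poly g) t0"
    unfolding rf_of_intpoly_def by (rule rf_to_fract)+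
  have reg: "rf_regular t0 A'" "rf_regular t0 B'" "rf_regular t0 C'"
    unfolding ABC by (intro rf_mult(1) rf_power(1) g rf_of_int)+
  have ev: "rf_eval t0 A' = of_int a * poly (of_int_poly g) t0" "rf_eval t0 B' = of_int b * poly (of_int_poly g) t0 ^ 2"
    "rf_eval t0 C' = of_int c * poly (of_int_poly g) t0 ^ 3"
    unfolding ABC by (simp_all add: rf_mult rf_power g)
  have "inj_on (specialize t0) ({None} \<union> {Some (X, Y) | X Y. Y ^ 2 = X ^ 3 + A' * X ^ 2 + B' * X + C'})"
  proof (rule inj_on_specialize_if_no_pole[OF reg])
    show "3 * x ^ 2 + 2 * rf_eval t0 A' * x + rf_eval t0 B' \<noteq> 0"
      if "x ^ 3 + rf_eval t0 A' * x ^ 2 + rf_eval t0 B' * x + rf_eval t0 C' = 0" for x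
      using that unfolding ev by (rule smooth_of_rsquarefree[OF spec_ok])
    show "rf_regular t0 X" if "Y ^ 2 = X ^ 3 + A' * X ^ 2 + B' * X + C'" for X Y
      by (rule no_pole_if_halvable[OF cubic_disc_nz_of_rsquarefree[OF f_sqfree] g0 _
            that[unfolded A'_def B'_def C'_def A_def B_def C_def]])
         (rule halve[unfolded A_def B_def C_def])
  qed
  thus ?thesis unfolding Eg_points_def Let_def ABC .
qed

theorem theorem4p3:
  fixes a b c :: int and g :: "int poly" and t0 :: rat
  assumes f_sqfree: "rsquarefree (map_poly of_int [:c, b, a, 1:] :: complex poly)"
    and g_nonconst: "degree g > 0"
    and spec_ok: "rsquarefree (map_poly of_rat
          [:of_int c * poly (map_poly of_int g) t0 ^ 3, of_int b * poly (map_poly of_int g) t0 ^ 2,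
            of_int a * poly (map_poly of_int g) t0, 1:] :: complex poly)"
  shows "(\<forall>K e d D. c = 0
            \<and> irreducible (map_poly of_int [:b, a, 1:] :: rat poly)
            \<and> K = splitting_field_C [:b, a, 1:] \<and> class_number_one K
            \<and> a ^ 2 - 4 * b = e ^ 2 * d \<and> squarefree d \<and> nf_disc K D
            \<and> cond_A1 b g t0 \<and> cond_A2 e D g t0
          \<longrightarrow> inj_on (specialize t0) (Eg_points a b c g))
       \<and> (\<forall>K e. irreducible (map_poly of_int [:c, b, a, 1:] :: rat poly)
            \<and> K = splitting_field_C [:c, b, a, 1:] \<and> Gal_cyclic K \<and> class_number_one K
            \<and> e ^ 2 = a^2 * b^2 - 4 * b^3 - 4 * a^3 * c - 27 * c^2 + 18 * a * b * c
            \<and> cond_B K e g t0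
          \<longrightarrow> inj_on (specialize t0) (Eg_points a b c g))"
proof (intro conjI allI impI; elim conjE)
  fix K e d D
  assume c0: "c = 0" and irr: "irreducible (of_int_poly [:b, a, 1:] :: rat poly)"
    and K: "K = splitting_field_C [:b, a, 1:]" and disc: "a ^ 2 - 4 * b = e ^ 2 * d" and sqf: "squarefree d"
    and D: "nf_disc K D" and A1: "cond_A1 b g t0" and A2: "cond_A2 e D g t0"
  have g0: "g \<noteq> 0" using g_nonconst by auto
  note quad = quadratic_field_splitting[OF irr disc sqf]
  have Ddvd: "(if d mod 4 = 1 then d else 2 * d) dvd D"
    by (rule quadratic_field.disc_dvd[OF quad(1) D[unfolded K]])
  show "inj_on (specialize t0) (Eg_points a b c g)"
  proof (rule inj_on_specialize_if_halvable[OF f_sqfree g0 spec_ok])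
    fix p q y
    define A B C where "A = [:a:] * g" and "B = [:b:] * g ^ 2" and "C = [:c:] * g ^ 3"
    assume cop: "coprime p q" and q0: "q \<noteq> 0"
      and y: "y ^ 2 = p ^ 3 + [:a:] * g * p ^ 2 * q ^ 2 + [:b:] * g ^ 2 * p * q ^ 4 + [:c:] * g ^ 3 * q ^ 6"
      and qt: "poly (of_int_poly q) t0 = 0" and pt: "poly (of_int_poly p) t0 \<noteq> 0"
    have C0: "C = 0" by (simp add: C_def c0)
    have "y ^ 2 = p ^ 3 + [:a:] * g * p ^ 2 * q ^ 2 + [:b:] * g ^ 2 * p * q ^ 4"
      using y by (simp add: c0)
    from halvable_of_cond_A[OF A1 A2 disc quad(2) g0 Ddvd cop q0 this qt pt]
    obtain k v w where kvw: "p = k ^ 2" "w ^ 2 = k ^ 4 + A * k ^ 2 * q ^ 2 + B * q ^ 4"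
      "v ^ 2 = 2 * w + 2 * k ^ 2 + A * q ^ 2" "poly (of_int_poly (k ^ 2 + k * v + w)) t0 \<noteq> 0"
      unfolding A_def B_def by blast
    define p' where "p' = k ^ 2 + k * v + w"
    note half = half_point_of_square_roots[OF kvw(2,3), folded p'_def]
    have "(of_int_poly ((v * p') ^ 2) :: rat poly)
        = of_int_poly (p' ^ 3 + A * p' ^ 2 * q ^ 2 + B * p' * q ^ 4 + C * q ^ 6)"
      unfolding C0 half(1) ..
    hence 1: "(of_int_poly (v * p') :: rat poly) ^ 2 = of_int_poly p' ^ 3 + of_int_poly A * of_int_poly p' ^ 2 * of_int_poly q ^ 2
        + of_int_poly B * of_int_poly p' * of_int_poly q ^ 4 + of_int_poly C * of_int_poly q ^ 6"
      by (simp only: of_int_poly_hom.hom_add of_int_poly_hom.hom_mult of_int_poly_hom.hom_power)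
    have "(of_int_poly (dup_num A B C p' (q ^ 2)) :: rat poly) = of_int_poly (4 * p * (v * p') ^ 2)"
      unfolding C0 half(2) kvw(1) ..
    hence 2: "dup_num (of_int_poly A) (of_int_poly B) (of_int_poly C) (of_int_poly p' :: rat poly) (of_int_poly q ^ 2)
        = 4 * of_int_poly p * of_int_poly (v * p') ^ 2"
      unfolding dup_num_def
      by (simp only: of_int_poly_hom.hom_add of_int_poly_hom.hom_minus of_int_poly_hom.hom_mult of_int_poly_hom.hom_power
           of_int_poly_hom.hom_numeral)
    show "\<exists>p' y' :: rat poly. poly p' t0 \<noteq> 0
         \<and> y' ^ 2 = p' ^ 3 + of_int_poly ([:a:] * g) * p' ^ 2 * of_int_poly q ^ 2
             + of_int_poly ([:b:] * g ^ 2) * p' * of_int_poly q ^ 4 + of_int_poly ([:c:] * g ^ 3) * of_int_poly q ^ 6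
         \<and> dup_num (of_int_poly ([:a:] * g)) (of_int_poly ([:b:] * g ^ 2)) (of_int_poly ([:c:] * g ^ 3)) p' (of_int_poly q ^ 2)
             = 4 * of_int_poly p * y' ^ 2"
      unfolding A_def[symmetric] B_def[symmetric] C_def[symmetric]
      by (intro exI[of _ "of_int_poly p'"] exI[of _ "of_int_poly (v * p')"] conjI 1 2) (use kvw(4) in \<open>simp only: p'_def not_False_eq_True\<close>)
  qed
next
  fix K e
  assume irr: "irreducible (of_int_poly [:c, b, a, 1:] :: rat poly)"
    and K: "K = splitting_field_C [:c, b, a, 1:]" and cl: "class_number_one K"
    and e: "e ^ 2 = a^2 * b^2 - 4 * b^3 - 4 * a^3 * c - 27 * c^2 + 18 * a * b * c"
    and B: "cond_B K e g t0"
  have g0: "g \<noteq> 0" using g_nonconst by auto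
  have e2: "e ^ 2 = cubic_disc a b c" unfolding e cubic_disc_def ..
  have e0: "e \<noteq> 0" using e2 cubic_disc_nz_of_rsquarefree[OF f_sqfree] by auto
  obtain x y z :: complex where v: "of_int a = - (x + y + z)" "of_int b = x * y + y * z + z * x" "of_int c = - (x * y * z)"
    by (rule cubic_roots_exist)
  have "(of_int e :: complex) ^ 2 = cubic_disc (of_int a) (of_int b) (of_int c)"
    unfolding of_int_power[symmetric] e2 cubic_disc_def by simp
  hence "of_int e ^ 2 = ((x - y) * (y - z) * (z - x)) ^ 2" unfolding cubic_disc_roots[OF v] .
  \<comment> \<open>Exchanging two roots changes the sign of the product, so one of the two orders
    fits the given \<open>e\<close>.\<close>
  hence "of_int e = (x - y) * (y - z) * (z - x) \<or> of_int e = - ((x - y) * (y - z) * (z - x))"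
    by (simp only: power2_eq_iff)
  then obtain \<theta>1 \<theta>2 \<theta>3 where "cyclic_cubic a b c e \<theta>1 \<theta>2 \<theta>3 K"
  proof
    assume exyz: "of_int e = (x - y) * (y - z) * (z - x)"
    have "cyclic_cubic a b c e x y z K" by unfold_locales (fact irr v exyz e0 K)+
    thus thesis by (rule that)
  next
    assume "of_int e = - ((x - y) * (y - z) * (z - x))"
    hence exzy: "of_int e = (x - z) * (z - y) * (y - x)" by (simp add: algebra_simps)
    have v': "of_int a = - (x + z + y)" "of_int b = x * z + z * y + y * x" "of_int c = - (x * z * y)"
      unfolding v by (simp_all add: algebra_simps)
    have "cyclic_cubic a b c e x z y K" by unfold_locales (fact irr v' exzy e0 K)+
    thus thesis by (rule that)
  qed
  then interpret cyclic_cubic a b c e \<theta>1 \<theta>2 \<theta>3 K .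
  interpret cyclic_cubic_pid a b c e \<theta>1 \<theta>2 \<theta>3 K by unfold_locales (rule cl)
  show "inj_on (specialize t0) (Eg_points a b c g)"
    by (rule inj_on_specialize_if_halvable[OF f_sqfree g0 spec_ok]) (rule halvable_of_cond_B[OF B g0])
qed

end
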